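(* The theory $\mathbf{SPOT}+\mathbf{SN}$ is a conservative extension of $\mathbf{ZF}$; that is, for every sentence $\theta$ in the $\in$-language, if $\mathbf{SPOT}+\mathbf{SN}\vdash\theta$ then $\mathbf{ZF}\vdash\theta$.
   Context: The $\mathrm{st}$-$\in$-language extends the $\in$-language of set theory by a unary predicate $\mathrm{st}$ ($\mathrm{st}(x)$ reads "$x$ is standard"). An $\in$-formula is a formula not involving $\mathrm{st}$; an $\mathrm{st}$-$\in$-formula may involve it. $\forall^{\mathrm{st}}$ and $\exists^{\mathrm{st}}$ are quantifiers over standard sets. $\mathbf{ZF}$ is Zermelo–Fraenkel set theory without Choice (when part of a theory in the $\mathrm{st}$-$\in$-language, its Separation and Replacement schemas are for $\in$-formulas only). $\mathbb N$ is the set of natural numbers. $\mathbf{SPOT}$ is the theory in the $\mathrm{st}$-$\in$-language with the axioms: - $\mathbf{ZF}$; - Transfer ($\mathbf T$): for each $\in$-formula $\phi$ with standard parameters, $\forall^{\mathrm{st}}x\,\phi(x)\rightarrow\forall x\,\phi(x)$; - Nontriviality ($\mathbf O$): $\exists\nu\in\mathbb N\ \forall^{\mathrm{st}}n\in\mathbb N\ (n\neq\nu)$; - Standard Part ($\mathbf{SP}'$): $\forall A\subseteq\mathbb N\ \exists^{\mathrm{st}}B\subseteq\mathbb N\ \forall^{\mathrm{st}}n\in\mathbb N\ (n\in B\leftrightarrow n\in A)$. $\mathbf{SN}$ (Standardization for parameter-free formulas) is the schema: for each $\mathrm{st}$-$\in$-formula $\phi(v)$ with no parameters, $\forall^{\mathrm{st}}A\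 \exists^{\mathrm{st}}S\ \forall^{\mathrm{st}}x\ (x\in S\leftrightarrow x\in A\wedge\phi(x))$. *)

theory Defs
  imports Main
begin

text \<open>
  Formulas of the st-\<open>\<in>\<close>-language, with de Bruijn indices as variables: under a quantifier, index
  0 is the variable bound by that quantifier, and index \<open>n + 1\<close> is the variable that was called
  \<open>n\<close> outside. There are no function symbols, so the only terms are variables.
\<close>

datatype fm =
    Fls  ("\<^bold>\<bottom>")
  | Eql nat nat  (infix "\<^bold>=" 50)
  | Mem nat nat  (infix "\<^bold>\<in>" 50)
  | Std nat
  | Imp fm fm  (infixr "\<^bold>\<longrightarrow>" 25)
  | Forall fm  ("\<^bold>\<forall>_" [10] 10)

definition Neg :: "fm \<Rightarrow> fm"  ("\<^bold>\<not>_" [40] 40) where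
  "(\<^bold>\<not>\<phi>) = (\<phi> \<^bold>\<longrightarrow> \<^bold>\<bottom>)"

definition Disj :: "fm \<Rightarrow> fm \<Rightarrow> fm"  (infixr "\<^bold>\<or>" 30) where
  "(\<phi> \<^bold>\<or> \<psi>) = (\<^bold>\<not>\<phi> \<^bold>\<longrightarrow> \<psi>)"

definition Conj :: "fm \<Rightarrow> fm \<Rightarrow> fm"  (infixr "\<^bold>\<and>" 35) where
  "(\<phi> \<^bold>\<and> \<psi>) = (\<^bold>\<not>(\<phi> \<^bold>\<longrightarrow> \<^bold>\<not>\<psi>))"

definition Equiv :: "fm \<Rightarrow> fm \<Rightarrow> fm"  (infixr "\<^bold>\<longleftrightarrow>" 25) where
  "(\<phi> \<^bold>\<longleftrightarrow> \<psi>) = ((\<phi> \<^bold>\<longrightarrow> \<psi>) \<^bold>\<and> (\<psi> \<^bold>\<longrightarrow> \<phi>))"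

definition Exists :: "fm \<Rightarrow> fm"  ("\<^bold>\<exists>_" [10] 10) where
  "(\<^bold>\<exists>\<phi>) = (\<^bold>\<not>(\<^bold>\<forall>\<^bold>\<not>\<phi>))"

definition Forall_st :: "fm \<Rightarrow> fm"  ("\<^bold>\<forall>\<^sup>s\<^sup>t_" [10] 10) where
  "(\<^bold>\<forall>\<^sup>s\<^sup>t\<phi>) = (\<^bold>\<forall>Std 0 \<^bold>\<longrightarrow> \<phi>)"

definition Exists_st :: "fm \<Rightarrow> fm"  ("\<^bold>\<exists>\<^sup>s\<^sup>t_" [10] 10) where
  "(\<^bold>\<exists>\<^sup>s\<^sup>t\<phi>) = (\<^bold>\<exists>Std 0 \<^bold>\<and> \<phi>)"

primrec st_free :: "fm \<Rightarrow> bool" where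
  "st_free \<^bold>\<bottom> = True"
| "st_free (i \<^bold>= j) = True"
| "st_free (i \<^bold>\<in> j) = True"
| "st_free (Std i) = False"
| "st_free (\<phi> \<^bold>\<longrightarrow> \<psi>) = (st_free \<phi> \<and> st_free \<psi>)"
| "st_free (\<^bold>\<forall>\<phi>) = st_free \<phi>"

definition in_language :: "fm set" where
  "in_language = {\<phi>. st_free \<phi>}"

definition st_in_language :: "fm set" where
  "st_in_language = UNIV"

text \<open>The least \<open>n\<close> such that all free variables of the formula are below \<open>n\<close>.\<close>

primrec fv_bound :: "fm \<Rightarrow> nat" where
  "fv_bound \<^bold>\<bottom> = 0"
| "fv_bound (i \<^bold>= j) = max (Suc i) (Suc j)"
| "fv_bound (i \<^bold>\<in> j) = max (Suc i) (Suc j)"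
| "fv_bound (Std i) = Suc i"
| "fv_bound (\<phi> \<^bold>\<longrightarrow> \<psi>) = max (fv_bound \<phi>) (fv_bound \<psi>)"
| "fv_bound (\<^bold>\<forall>\<phi>) = fv_bound \<phi> - 1"

definition sentence :: "fm \<Rightarrow> bool" where
  "sentence \<phi> \<longleftrightarrow> fv_bound \<phi> = 0"

text \<open>Universal closure, with the parameters ranging over all sets, respectively over standard sets.\<close>

definition forall_closure :: "fm \<Rightarrow> fm" where
  "forall_closure \<phi> = (Forall ^^ fv_bound \<phi>) \<phi>"

definition forall_closure_st :: "fm \<Rightarrow> fm" where
  "forall_closure_st \<phi> = (Forall_st ^^ fv_bound \<phi>) \<phi>"

primrec rename :: "(nat \<Rightarrow> nat) \<Rightarrow> fm \<Rightarrow> fm" where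
  "rename f \<^bold>\<bottom> = \<^bold>\<bottom>"
| "rename f (i \<^bold>= j) = (f i \<^bold>= f j)"
| "rename f (i \<^bold>\<in> j) = (f i \<^bold>\<in> f j)"
| "rename f (Std i) = Std (f i)"
| "rename f (\<phi> \<^bold>\<longrightarrow> \<psi>) = (rename f \<phi> \<^bold>\<longrightarrow> rename f \<psi>)"
| "rename f (\<^bold>\<forall>\<phi>) = (\<^bold>\<forall>rename (case_nat 0 (\<lambda>n. Suc (f n))) \<phi>)"

text \<open>
  \<open>inst ts d \<phi>\<close> replaces the variables \<open>0, \<dots>, length ts - 1\<close> of \<open>\<phi>\<close> by the entries of \<open>ts\<close>. The
  remaining variables, the parameters, are renumbered from 0 and then moved under \<open>d\<close> quantifiers.
\<close>

definition inst :: "nat list \<Rightarrow> nat \<Rightarrow> fm \<Rightarrow> fm" where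
  "inst ts d = rename (\<lambda>n. if n < length ts then ts ! n else n - length ts + d)"

text \<open>
  Natural deduction for classical first-order logic with equality, carried out inside a language
  \<open>L\<close>. The side conditions ensure that, for a language closed under subformulas and renaming (as
  both languages here are), every formula occurring as a conclusion in a derivation belongs to \<open>L\<close>.
  In \<open>AllI\<close>, shifting the assumptions frees the variable 0, which plays the role of the
  eigenvariable.
\<close>

inductive derives :: "fm set \<Rightarrow> fm set \<Rightarrow> fm \<Rightarrow> bool"
  for L :: "fm set" where
  Assm: "\<phi> \<in> \<Gamma> \<Longrightarrow> \<phi> \<in> L \<Longrightarrow> derives L \<Gamma> \<phi>"
| ImpI: "\<phi> \<in> L \<Longrightarrow> derives L (insert \<phi> \<Gamma>) \<psi> \<Longrightarrow> derives L \<Gamma> (\<phi> \<^bold>\<longrightarrow> \<psi>)"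
| ImpE: "derives L \<Gamma> (\<phi> \<^bold>\<longrightarrow> \<psi>) \<Longrightarrow> derives L \<Gamma> \<phi> \<Longrightarrow> derives L \<Gamma> \<psi>"
| RAA: "\<phi> \<in> L \<Longrightarrow> derives L (insert (\<^bold>\<not>\<phi>) \<Gamma>) \<^bold>\<bottom> \<Longrightarrow> derives L \<Gamma> \<phi>"
| AllI: "derives L (inst [] 1 ` \<Gamma>) \<phi> \<Longrightarrow> derives L \<Gamma> (\<^bold>\<forall>\<phi>)"
| AllE: "derives L \<Gamma> (\<^bold>\<forall>\<phi>) \<Longrightarrow> derives L \<Gamma> (inst [t] 0 \<phi>)"
| EqRefl: "derives L \<Gamma> (t \<^bold>= t)"
| EqSubst: "derives L \<Gamma> (s \<^bold>= t) \<Longrightarrow> derives L \<Gamma> (inst [s] 0 \<phi>) \<Longrightarrow> derives L \<Gamma> (inst [t] 0 \<phi>)"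

text \<open>Formulas next to the definitions below give their reading with named variables.\<close>

definition Subset :: "nat \<Rightarrow> nat \<Rightarrow> fm"  (infix "\<^bold>\<subseteq>" 50) where
  "(i \<^bold>\<subseteq> j) = (\<^bold>\<forall>0 \<^bold>\<in> Suc i \<^bold>\<longrightarrow> 0 \<^bold>\<in> Suc j)"

text \<open>\<open>s = y \<union> {y}\<close>\<close>

definition Is_succ :: "nat \<Rightarrow> nat \<Rightarrow> fm" where
  "Is_succ s y = (\<^bold>\<forall>0 \<^bold>\<in> Suc s \<^bold>\<longleftrightarrow> 0 \<^bold>\<in> Suc y \<^bold>\<or> 0 \<^bold>= Suc y)"

definition Is_empty :: "nat \<Rightarrow> fm" where
  "Is_empty e = (\<^bold>\<forall>\<^bold>\<not>(0 \<^bold>\<in> Suc e))"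

text \<open>\<open>(\<exists>e. e \<in> I \<and> e = \<emptyset>) \<and> (\<forall>y. y \<in> I \<longrightarrow> (\<exists>s. s \<in> I \<and> s = y \<union> {y}))\<close>\<close>

definition Inductive :: "nat \<Rightarrow> fm" where
  "Inductive i = ((\<^bold>\<exists>0 \<^bold>\<in> Suc i \<^bold>\<and> Is_empty 0) \<^bold>\<and>
    (\<^bold>\<forall>0 \<^bold>\<in> Suc i \<^bold>\<longrightarrow> (\<^bold>\<exists>0 \<^bold>\<in> Suc (Suc i) \<^bold>\<and> Is_succ 0 1)))"

text \<open>\<open>\<forall>x y. (\<forall>z. z \<in> x \<longleftrightarrow> z \<in> y) \<longrightarrow> x = y\<close>\<close>

definition Extensionality :: fm where
  "Extensionality = (\<^bold>\<forall>\<^bold>\<forall>(\<^bold>\<forall>0 \<^bold>\<in> 2 \<^bold>\<longleftrightarrow> 0 \<^bold>\<in> 1) \<^bold>\<longrightarrow> 1 \<^bold>= 0)"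

text \<open>\<open>\<forall>x. (\<exists>y. y \<in> x) \<longrightarrow> (\<exists>y. y \<in> x \<and> \<not> (\<exists>z. z \<in> x \<and> z \<in> y))\<close>\<close>

definition Foundation :: fm where
  "Foundation = (\<^bold>\<forall>(\<^bold>\<exists>0 \<^bold>\<in> 1) \<^bold>\<longrightarrow> (\<^bold>\<exists>0 \<^bold>\<in> 1 \<^bold>\<and> \<^bold>\<not>(\<^bold>\<exists>0 \<^bold>\<in> 2 \<^bold>\<and> 0 \<^bold>\<in> 1)))"

text \<open>\<open>\<forall>x y. \<exists>p. \<forall>w. w \<in> p \<longleftrightarrow> w = x \<or> w = y\<close>\<close>

definition Pairing :: fm where
  "Pairing = (\<^bold>\<forall>\<^bold>\<forall>\<^bold>\<exists>\<^bold>\<forall>0 \<^bold>\<in> 1 \<^bold>\<longleftrightarrow> 0 \<^bold>= 3 \<^bold>\<or> 0 \<^bold>= 2)"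

text \<open>\<open>\<forall>x. \<exists>u. \<forall>w. w \<in> u \<longleftrightarrow> (\<exists>y. y \<in> x \<and> w \<in> y)\<close>\<close>

definition Union_Axiom :: fm where
  "Union_Axiom = (\<^bold>\<forall>\<^bold>\<exists>\<^bold>\<forall>0 \<^bold>\<in> 1 \<^bold>\<longleftrightarrow> (\<^bold>\<exists>0 \<^bold>\<in> 3 \<^bold>\<and> 1 \<^bold>\<in> 0))"

text \<open>\<open>\<forall>x. \<exists>p. \<forall>w. w \<in> p \<longleftrightarrow> w \<subseteq> x\<close>\<close>

definition Powerset :: fm where
  "Powerset = (\<^bold>\<forall>\<^bold>\<exists>\<^bold>\<forall>0 \<^bold>\<in> 1 \<^bold>\<longleftrightarrow> 0 \<^bold>\<subseteq> 2)"

definition Infinity :: fm where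
  "Infinity = (\<^bold>\<exists>Inductive 0)"

text \<open>\<open>\<forall>A. \<exists>S. \<forall>x. x \<in> S \<longleftrightarrow> x \<in> A \<and> \<phi>(x, p)\<close>, where \<open>x\<close> is variable 0 of \<open>\<phi>\<close>\<close>

definition Separation :: "fm \<Rightarrow> fm" where
  "Separation \<phi> = forall_closure (\<^bold>\<forall>\<^bold>\<exists>\<^bold>\<forall>0 \<^bold>\<in> 1 \<^bold>\<longleftrightarrow> 0 \<^bold>\<in> 2 \<^bold>\<and> inst [0] 3 \<phi>)"

text \<open>
  \<open>(\<forall>x y z. \<phi>(x, y, p) \<and> \<phi>(x, z, p) \<longrightarrow> y = z) \<longrightarrow> (\<forall>A. \<exists>B. \<forall>y. y \<in> B \<longleftrightarrow> (\<exists>x. x \<in> A \<and> \<phi>(x, y, p)))\<close>,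
  where \<open>x\<close> and \<open>y\<close> are variables 0 and 1 of \<open>\<phi>\<close>
\<close>

definition Replacement :: "fm \<Rightarrow> fm" where
  "Replacement \<phi> = forall_closure
    ((\<^bold>\<forall>\<^bold>\<forall>\<^bold>\<forall>inst [2, 1] 3 \<phi> \<^bold>\<and> inst [2, 0] 3 \<phi> \<^bold>\<longrightarrow> 1 \<^bold>= 0) \<^bold>\<longrightarrow>
     (\<^bold>\<forall>\<^bold>\<exists>\<^bold>\<forall>0 \<^bold>\<in> 1 \<^bold>\<longleftrightarrow> (\<^bold>\<exists>0 \<^bold>\<in> 3 \<^bold>\<and> inst [0, 1] 4 \<phi>)))"

definition ZF :: "fm set" where
  "ZF = {Extensionality, Foundation, Pairing, Union_Axiom, Powerset, Infinity}
    \<union> {Separation \<phi> | \<phi>. \<phi> \<in> in_language} \<union> {Replacement \<phi> | \<phi>. \<phi> \<in> in_language}"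

text \<open>\<open>x \<in> \<nat>\<close>, where \<open>\<nat>\<close> is the least inductive set: \<open>\<forall>I. I inductive \<longrightarrow> x \<in> I\<close>\<close>

definition In_Nat :: "nat \<Rightarrow> fm" where
  "In_Nat i = (\<^bold>\<forall>Inductive 0 \<^bold>\<longrightarrow> Suc i \<^bold>\<in> 0)"

definition Subset_Nat :: "nat \<Rightarrow> fm" where
  "Subset_Nat i = (\<^bold>\<forall>0 \<^bold>\<in> Suc i \<^bold>\<longrightarrow> In_Nat 0)"

definition Transfer :: "fm \<Rightarrow> fm" where
  "Transfer \<phi> = forall_closure_st ((\<^bold>\<forall>\<^sup>s\<^sup>t\<phi>) \<^bold>\<longrightarrow> (\<^bold>\<forall>\<phi>))"

text \<open>\<open>\<exists>\<nu>. \<nu> \<in> \<nat> \<and> (\<forall>\<^sup>s\<^sup>tn. n \<in> \<nat> \<longrightarrow> n \<noteq> \<nu>)\<close>\<close>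

definition Nontriviality :: fm where
  "Nontriviality = (\<^bold>\<exists>In_Nat 0 \<^bold>\<and> (\<^bold>\<forall>\<^sup>s\<^sup>tIn_Nat 0 \<^bold>\<longrightarrow> \<^bold>\<not>(0 \<^bold>= 1)))"

text \<open>\<open>\<forall>A. A \<subseteq> \<nat> \<longrightarrow> (\<exists>\<^sup>s\<^sup>tB. B \<subseteq> \<nat> \<and> (\<forall>\<^sup>s\<^sup>tn. n \<in> \<nat> \<longrightarrow> (n \<in> B \<longleftrightarrow> n \<in> A)))\<close>\<close>

definition Standard_Part :: fm where
  "Standard_Part = (\<^bold>\<forall>Subset_Nat 0 \<^bold>\<longrightarrow>
    (\<^bold>\<exists>\<^sup>s\<^sup>tSubset_Nat 0 \<^bold>\<and> (\<^bold>\<forall>\<^sup>s\<^sup>tIn_Nat 0 \<^bold>\<longrightarrow> (0 \<^bold>\<in> 1 \<^bold>\<longleftrightarrow> 0 \<^bold>\<in> 2))))"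

definition SPOT :: "fm set" where
  "SPOT = ZF \<union> {Transfer \<phi> | \<phi>. \<phi> \<in> in_language} \<union> {Nontriviality, Standard_Part}"

text \<open>
  \<open>\<forall>\<^sup>s\<^sup>tA. \<exists>\<^sup>s\<^sup>tS. \<forall>\<^sup>s\<^sup>tx. x \<in> S \<longleftrightarrow> x \<in> A \<and> \<phi>(x)\<close>; no renaming is needed, since at most variable 0 is
  free in \<open>\<phi>\<close>.
\<close>

definition Standardization :: "fm \<Rightarrow> fm" where
  "Standardization \<phi> = (\<^bold>\<forall>\<^sup>s\<^sup>t\<^bold>\<exists>\<^sup>s\<^sup>t\<^bold>\<forall>\<^sup>s\<^sup>t0 \<^bold>\<in> 1 \<^bold>\<longleftrightarrow> 0 \<^bold>\<in> 2 \<^bold>\<and> \<phi>)"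

definition SN :: "fm set" where
  "SN = {Standardization \<phi> | \<phi>. \<phi> \<in> st_in_language \<and> fv_bound \<phi> \<le> 1}"

end

theory Submission
  imports Defs "HOL-Library.Countable" "HOL-Library.Infinite_Set"
begin

text \<open>
  If \<open>\<theta>\<close> is not derivable in ZF, the completeness theorem yields a model \<open>M\<close> of ZF and \<open>\<not> \<theta>\<close>. Over \<open>M\<close> we
  interpret the st-\<open>\<in>\<close>-language by forcing, with a category instead of a poset of conditions. A stage is a
  set \<open>X\<close> of \<open>M\<close> with an unbounded index map \<open>X \<rightarrow> \<omega>\<close>, a morphism \<open>Y \<rightarrow> X\<close> is a function in \<open>M\<close> under which
  preimages of bounded sets are bounded, a name is a function on \<open>X\<close>, and standard elements are the locally
  constant names. This is a choice-free ultrapower: where AC would select witnesses, the stage \<open>X\<close> is replaced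
  by the set of all pairs of a point and a witness, cut down to a set by Collection. Hence \<open>\<in>\<close>-formulas obey
  the theorem of Los, which gives ZF and Transfer; the index map is a nonstandard natural number; and an
  \<open>A \<subseteq> \<nat>\<close> acquires a standard part after passing to the stage of pairs \<open>(n, x)\<close> for which \<open>A(x)\<close> agrees below
  \<open>n\<close> with a fixed branch \<open>B\<close> of the tree of frequently occurring initial segments. Any two stages have a common
  refinement, so all stages force the same statements about standard elements; as forcing is definable in \<open>M\<close>,
  Standardization for parameter-free formulas follows from Separation in \<open>M\<close>. Forcing respects derivations,
  so no generic object is needed.
\<close>

section \<open>Renaming and semantics\<close>

text \<open>Choice is the obstacle throughout. Forcing with infinite subsets of
  \<open>\<omega>\<close> would add an ultrafilter, but the theorem of Los for its ultrapower picks
  a witness at every index, and shrinking the index set does not provide one. A change of stage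
  along a non-injective map does, since the new points can carry their witnesses. To form such a
  stage the witnesses must be collected into a set without selecting any; the levels of the
  cumulative hierarchy are developed only for this. Implication and \<open>\<forall>\<close> have
  intuitionistic clauses, quantifying over all refinements. The relation is nevertheless classical:
  atomic formulas and \<open>Std\<close> are local, that is, forced as soon as they are forced
  densely, and locality passes to all formulas. Comparing stages works for constant names because
  they mean the same at every stage. A nonconstant name belongs to its stage, and pulling names back
  from two unrelated stages identifies nothing; hence the restriction to formulas without
  parameters. The model may look nonstandard from outside, so every formation of a set and every
  induction in it carries a definability hypothesis \<open>D\<close>.\<close>

lemma rename_cong: "(\<And>n. n < fv_bound \<phi> \<Longrightarrow> f n = g n) \<Longrightarrow> rename f \<phi> = rename g \<phi>"
proof (induction \<phi> arbitrary: f g)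
  case (Forall \<phi>)
  have "case_nat 0 (\<lambda>n. Suc (f n)) n = case_nat 0 (\<lambda>n. Suc (g n)) n" if "n < fv_bound \<phi>" for n
    using Forall.prems that by (cases n) auto
  from Forall.IH[OF this] show ?case by simp
next
  case (Imp \<phi>1 \<phi>2)
  have "rename f \<phi>1 = rename g \<phi>1" "rename f \<phi>2 = rename g \<phi>2"
    by (rule Imp.IH; rule Imp.prems; simp add: less_max_iff_disj)+
  then show ?case by simp
qed auto

lemma rename_rename: "rename f (rename g \<phi>) = rename (\<lambda>n. f (g n)) \<phi>"
proof (induction \<phi> arbitrary: f g)
  case (Forall \<phi>)
  have "(\<lambda>n. case_nat 0 (\<lambda>n. Suc (f n)) (case_nat 0 (\<lambda>n. Suc (g n)) n)) = case_nat 0 (\<lambda>n. Suc (f (g n)))"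
    by (auto simp: fun_eq_iff split: nat.splits)
  with Forall show ?case by simp
qed auto

lemma rename_id: "rename (\<lambda>n. n) \<phi> = \<phi>"
proof (induction \<phi>)
  case (Forall \<phi>)
  have "case_nat 0 (\<lambda>n. Suc n) = (\<lambda>n. n)"
    by (auto simp: fun_eq_iff split: nat.splits)
  with Forall show ?case by simp
qed auto

lemma rename_sentence: "sentence \<phi> \<Longrightarrow> rename f \<phi> = \<phi>"
  using rename_cong[of \<phi> f "\<lambda>n. n"] by (simp add: sentence_def rename_id)

lemma st_free_rename [simp]: "st_free (rename f \<phi>) = st_free \<phi>"
  by (induction \<phi> arbitrary: f) auto

lemma st_free_inst [simp]: "st_free (inst ts d \<phi>) = st_free \<phi>"
  by (simp add: inst_def)

lemma inst1: "inst [t] 0 \<phi> = rename (case_nat t (\<lambda>n. n)) \<phi>"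
proof -
  have "(\<lambda>n. if n < length [t] then [t] ! n else n - length [t] + 0) = case_nat t (\<lambda>n. n)"
    by (auto simp: fun_eq_iff split: nat.splits)
  then show ?thesis by (simp add: inst_def)
qed

lemma inst_shift: "inst [] 1 \<phi> = rename Suc \<phi>"
proof -
  have "(\<lambda>n. if n < length [] then [] ! n else n - length [] + 1) = Suc"
    by auto
  then show ?thesis unfolding inst_def by metis
qed

lemma rename_inst1:
  "rename f (inst [t] 0 \<phi>) = inst [f t] 0 (rename (case_nat 0 (\<lambda>n. Suc (f n))) \<phi>)"
proof -
  have "(\<lambda>n. f (case_nat t (\<lambda>n. n) n)) =
      (\<lambda>n. case_nat (f t) (\<lambda>n. n) (case_nat 0 (\<lambda>n. Suc (f n)) n))"
    by (auto simp: fun_eq_iff split: nat.splits)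
  then show ?thesis by (simp add: inst1 rename_rename)
qed

text \<open>\<open>Q\<close> interprets equality, so that term models need no quotient.\<close>

primrec sat :: "('a \<Rightarrow> 'a \<Rightarrow> bool) \<Rightarrow> ('a \<Rightarrow> 'a \<Rightarrow> bool) \<Rightarrow> (nat \<Rightarrow> 'a) \<Rightarrow> fm \<Rightarrow> bool" where
  "sat Q E v \<^bold>\<bottom> = False"
| "sat Q E v (i \<^bold>= j) = Q (v i) (v j)"
| "sat Q E v (i \<^bold>\<in> j) = E (v i) (v j)"
| "sat Q E v (Std i) = True"
| "sat Q E v (\<phi> \<^bold>\<longrightarrow> \<psi>) = (sat Q E v \<phi> \<longrightarrow> sat Q E v \<psi>)"
| "sat Q E v (\<^bold>\<forall>\<phi>) = (\<forall>x. sat Q E (case_nat x v) \<phi>)"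

lemma sat_Neg [simp]: "sat Q E v (\<^bold>\<not>\<phi>) = (\<not> sat Q E v \<phi>)"
  by (simp add: Neg_def)
lemma sat_Disj [simp]: "sat Q E v (\<phi> \<^bold>\<or> \<psi>) = (sat Q E v \<phi> \<or> sat Q E v \<psi>)"
  by (auto simp: Disj_def)
lemma sat_Conj [simp]: "sat Q E v (\<phi> \<^bold>\<and> \<psi>) = (sat Q E v \<phi> \<and> sat Q E v \<psi>)"
  by (auto simp: Conj_def)
lemma sat_Equiv [simp]: "sat Q E v (\<phi> \<^bold>\<longleftrightarrow> \<psi>) = (sat Q E v \<phi> \<longleftrightarrow> sat Q E v \<psi>)"
  by (auto simp: Equiv_def)
lemma sat_Exists [simp]: "sat Q E v (\<^bold>\<exists>\<phi>) = (\<exists>x. sat Q E (case_nat x v) \<phi>)"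
  by (auto simp: Exists_def)

lemma sat_cong: "(\<And>n. n < fv_bound \<phi> \<Longrightarrow> v n = w n) \<Longrightarrow> sat Q E v \<phi> = sat Q E w \<phi>"
proof (induction \<phi> arbitrary: v w)
  case (Forall \<phi>)
  have "sat Q E (case_nat x v) \<phi> = sat Q E (case_nat x w) \<phi>" for x
    by (rule Forall.IH) (use Forall.prems in \<open>auto split: nat.splits\<close>)
  then show ?case by simp
next
  case (Imp \<phi>1 \<phi>2)
  have "sat Q E v \<phi>1 = sat Q E w \<phi>1" "sat Q E v \<phi>2 = sat Q E w \<phi>2"
    by (rule Imp.IH; rule Imp.prems; simp add: less_max_iff_disj)+
  then show ?case by simp
qed auto

lemma sat_rename: "sat Q E v (rename f \<phi>) = sat Q E (\<lambda>n. v (f n)) \<phi>"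
proof (induction \<phi> arbitrary: v f)
  case (Forall \<phi>)
  have "(\<lambda>n. case_nat x v (case_nat 0 (\<lambda>n. Suc (f n)) n)) = case_nat x (\<lambda>n. v (f n))" for x
    by (auto simp: fun_eq_iff split: nat.splits)
  with Forall show ?case by simp
qed auto

text \<open>Every environment splits into a head and a tail, so quantifying over all environments
  absorbs one quantifier of the closure at a time. For a single fixed environment the two sides
  would differ by a shift.\<close>

lemma sat_forall_closure:
  fixes Q E :: "'a \<Rightarrow> 'a \<Rightarrow> bool"
  shows "(\<forall>v. sat Q E v (forall_closure \<phi>)) \<longleftrightarrow> (\<forall>v. sat Q E v \<phi>)"
proof -
  have "(\<forall>v. sat Q E v ((Forall ^^ n) \<phi>)) \<longleftrightarrow> (\<forall>v. sat Q E v \<phi>)" for n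
  proof (induction n)
    case (Suc n)
    have "(\<forall>v. sat Q E v ((Forall ^^ Suc n) \<phi>)) \<longleftrightarrow> (\<forall>v x. sat Q E (case_nat x v) ((Forall ^^ n) \<phi>))"
      by simp
    also have "\<dots> \<longleftrightarrow> (\<forall>v. sat Q E v ((Forall ^^ n) \<phi>))"
    proof safe
      fix v :: "nat \<Rightarrow> 'a" assume *: "\<forall>v x. sat Q E (case_nat x v) ((Forall ^^ n) \<phi>)"
      have "v = case_nat (v 0) (\<lambda>n. v (Suc n))"
        by (auto simp: fun_eq_iff split: nat.splits)
      with * show "sat Q E v ((Forall ^^ n) \<phi>)" by metis
    qed auto
    finally show ?case using Suc by simp
  qed simp
  then show ?thesis by (simp add: forall_closure_def)
qed

lemma st_free_abbrevs [simp]: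
  "st_free (\<^bold>\<not>\<phi>) = st_free \<phi>"
  "st_free (\<phi> \<^bold>\<or> \<psi>) = (st_free \<phi> \<and> st_free \<psi>)"
  "st_free (\<phi> \<^bold>\<and> \<psi>) = (st_free \<phi> \<and> st_free \<psi>)"
  "st_free (\<phi> \<^bold>\<longleftrightarrow> \<psi>) = (st_free \<phi> \<and> st_free \<psi>)"
  "st_free (\<^bold>\<exists>\<phi>) = st_free \<phi>"
  by (auto simp: Neg_def Disj_def Conj_def Equiv_def Exists_def)

lemma st_free_forall_closure [simp]: "st_free (forall_closure \<phi>) = st_free \<phi>"
proof -
  have "st_free ((Forall ^^ n) \<phi>) = st_free \<phi>" for n
    by (induction n) auto
  then show ?thesis by (simp add: forall_closure_def)
qed

lemma sentence_forall_closure: "sentence (forall_closure \<phi>)"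
proof -
  have "fv_bound ((Forall ^^ n) \<phi>) = fv_bound \<phi> - n" for n
    by (induction n) auto
  then show ?thesis by (simp add: forall_closure_def sentence_def)
qed

lemma ZF_st_free: "\<phi> \<in> ZF \<Longrightarrow> st_free \<phi>"
  by (auto simp: ZF_def Extensionality_def Foundation_def Pairing_def Union_Axiom_def Powerset_def
      Infinity_def Separation_def Replacement_def Inductive_def Is_empty_def Is_succ_def Subset_def
      in_language_def)

lemma ZF_sentence: "\<phi> \<in> ZF \<Longrightarrow> sentence \<phi>"
  by (auto simp: ZF_def Separation_def Replacement_def sentence_forall_closure)
    (auto simp: Extensionality_def Foundation_def Pairing_def Union_Axiom_def Powerset_def
      Infinity_def Inductive_def Is_empty_def Is_succ_def Subset_def
      Neg_def Disj_def Conj_def Equiv_def Exists_def sentence_def)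

section \<open>The completeness theorem\<close>

instance fm :: countable
  by countable_datatype

lemma derives_mono: "derives L \<Gamma> \<phi> \<Longrightarrow> \<Gamma> \<subseteq> \<Delta> \<Longrightarrow> derives L \<Delta> \<phi>"
proof (induction arbitrary: \<Delta> rule: derives.induct)
  case (AllI \<Gamma> \<phi>)
  then show ?case by (meson derives.AllI image_mono)
next
  case (Assm \<phi> \<Gamma>)
  then show ?case by (simp add: derives.Assm subsetD)
next
  case (ImpI \<phi> \<Gamma> \<psi>)
  then show ?case by (meson derives.ImpI insert_mono)
next
  case (ImpE \<Gamma> \<phi> \<psi>)
  then show ?case by (meson derives.ImpE)
next
  case (RAA \<phi> \<Gamma>)
  then show ?case by (meson derives.RAA insert_mono)
next
  case (AllE \<Gamma> \<phi> t)
  then show ?case by (meson derives.AllE)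
next
  case (EqRefl \<Gamma> t)
  show ?case by (rule derives.EqRefl)
next
  case (EqSubst \<Gamma> s t \<phi>)
  then show ?case by (meson derives.EqSubst)
qed

text \<open>Compactness of derivability, needed to carry consistency over to the union of the Henkin
  chain.\<close>

lemma derives_finite: "derives L \<Gamma> \<phi> \<Longrightarrow> \<exists>\<Delta>\<subseteq>\<Gamma>. finite \<Delta> \<and> derives L \<Delta> \<phi>"
proof (induction rule: derives.induct)
  case (Assm \<phi> \<Gamma>)
  then have "derives L {\<phi>} \<phi>" by (simp add: derives.Assm)
  with Assm show ?case by (intro exI[of _ "{\<phi>}"]) simp
next
  case (ImpI \<phi> \<Gamma> \<psi>)
  then obtain \<Delta> where \<Delta>: "\<Delta> \<subseteq> insert \<phi> \<Gamma>" "finite \<Delta>" "derives L \<Delta> \<psi>" by auto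
  then have "derives L (insert \<phi> (\<Delta> - {\<phi>})) \<psi>" by (elim derives_mono) auto
  then have "derives L (\<Delta> - {\<phi>}) (\<phi> \<^bold>\<longrightarrow> \<psi>)" using ImpI(1) by (rule derives.ImpI[rotated])
  with \<Delta> show ?case by (intro exI[of _ "\<Delta> - {\<phi>}"]) auto
next
  case (RAA \<phi> \<Gamma>)
  then obtain \<Delta> where \<Delta>: "\<Delta> \<subseteq> insert (\<^bold>\<not>\<phi>) \<Gamma>" "finite \<Delta>" "derives L \<Delta> \<^bold>\<bottom>" by auto
  then have "derives L (insert (\<^bold>\<not>\<phi>) (\<Delta> - {\<^bold>\<not>\<phi>})) \<^bold>\<bottom>" by (elim derives_mono) auto
  then have "derives L (\<Delta> - {\<^bold>\<not>\<phi>}) \<phi>" using RAA(1) by (rule derives.RAA[rotated])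
  with \<Delta> show ?case by (intro exI[of _ "\<Delta> - {\<^bold>\<not>\<phi>}"]) auto
next
  case (ImpE \<Gamma> \<phi> \<psi>)
  then obtain \<Delta>1 \<Delta>2 where \<Delta>: "finite \<Delta>1" "finite \<Delta>2" "\<Delta>1 \<subseteq> \<Gamma>" "\<Delta>2 \<subseteq> \<Gamma>"
    and d: "derives L \<Delta>1 (\<phi> \<^bold>\<longrightarrow> \<psi>)" "derives L \<Delta>2 \<phi>" by auto
  have "derives L (\<Delta>1 \<union> \<Delta>2) \<psi>"
    by (rule derives.ImpE[OF derives_mono[OF d(1)] derives_mono[OF d(2)]]) auto
  with \<Delta> show ?case by (intro exI[of _ "\<Delta>1 \<union> \<Delta>2"]) auto
next
  case (AllI \<Gamma> \<phi>)
  then obtain \<Delta> where "finite \<Delta>" "\<Delta> \<subseteq> inst [] 1 ` \<Gamma>" "derives L \<Delta> \<phi>" by auto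
  then obtain \<Delta>' where "\<Delta>' \<subseteq> \<Gamma>" "finite \<Delta>'" "\<Delta> = inst [] 1 ` \<Delta>'"
    by (meson finite_subset_image)
  with \<open>derives L \<Delta> \<phi>\<close> show ?case by (intro exI[of _ \<Delta>']) (simp add: derives.AllI)
next
  case (AllE \<Gamma> \<phi> t)
  then show ?case by (meson derives.AllE)
next
  case (EqRefl \<Gamma> t)
  show ?case by (intro exI[of _ "{}"]) (simp add: derives.EqRefl)
next
  case (EqSubst \<Gamma> s t \<phi>)
  then obtain \<Delta>1 \<Delta>2 where \<Delta>: "finite \<Delta>1" "finite \<Delta>2" "\<Delta>1 \<subseteq> \<Gamma>" "\<Delta>2 \<subseteq> \<Gamma>"
    and d: "derives L \<Delta>1 (s \<^bold>= t)" "derives L \<Delta>2 (inst [s] 0 \<phi>)" by auto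
  have "derives L (\<Delta>1 \<union> \<Delta>2) (inst [t] 0 \<phi>)"
    by (rule derives.EqSubst[OF derives_mono[OF d(1)] derives_mono[OF d(2)]]) auto
  with \<Delta> show ?case by (intro exI[of _ "\<Delta>1 \<union> \<Delta>2"]) auto
qed

section \<open>Consistent sets and their Henkin extensions\<close>

abbreviation prov :: "fm set \<Rightarrow> fm \<Rightarrow> bool" where
  "prov \<equiv> derives in_language"

lemma prov_st_free: "prov \<Gamma> \<phi> \<Longrightarrow> st_free \<phi>"
  by (induction rule: derives.induct) (auto simp: in_language_def)

text \<open>Here \<open>f\<close> need not be injective. Renaming makes it possible to move an
  arbitrary fresh variable into position 0, the only eigenvariable that \<open>AllI\<close>
  knows.\<close>

lemma prov_rename: "prov \<Gamma> \<phi> \<Longrightarrow> prov (rename f ` \<Gamma>) (rename f \<phi>)"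
proof (induction arbitrary: f rule: derives.induct)
  case (Assm \<phi> \<Gamma>)
  then show ?case by (auto intro!: derives.Assm simp: in_language_def)
next
  case (ImpI \<phi> \<Gamma> \<psi>)
  have "prov (insert (rename f \<phi>) (rename f ` \<Gamma>)) (rename f \<psi>)" using ImpI.IH[of f] by simp
  with ImpI(1) show ?case by (auto intro!: derives.ImpI simp: in_language_def)
next
  case (ImpE \<Gamma> \<phi> \<psi>)
  have "prov (rename f ` \<Gamma>) (rename f \<phi> \<^bold>\<longrightarrow> rename f \<psi>)" using ImpE.IH(1)[of f] by simp
  then show ?case using ImpE.IH(2)[of f] by (rule derives.ImpE)
next
  case (RAA \<phi> \<Gamma>)
  then have "prov (insert (\<^bold>\<not>(rename f \<phi>)) (rename f ` \<Gamma>)) \<^bold>\<bottom>"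
    by (auto simp: Neg_def dest!: meta_spec[of _ f])
  with RAA(1) show ?case by (intro derives.RAA[of "rename f \<phi>"]) (simp_all add: in_language_def)
next
  case (AllI \<Gamma> \<phi>)
  have "rename (case_nat 0 (\<lambda>n. Suc (f n))) ` inst [] 1 ` \<Gamma> = inst [] 1 ` rename f ` \<Gamma>"
    by (simp add: image_image inst_shift[unfolded One_nat_def] rename_rename)
  then show ?case using AllI.IH[of "case_nat 0 (\<lambda>n. Suc (f n))"]
    by (simp add: derives.AllI)
next
  case (AllE \<Gamma> \<phi> t)
  then show ?case unfolding rename_inst1 by (intro derives.AllE) simp
next
  case (EqRefl \<Gamma> t)
  show ?case by (auto intro: derives.EqRefl)
next
  case (EqSubst \<Gamma> s t \<phi>)
  then show ?case unfolding rename_inst1 by (intro derives.EqSubst[of _ _ "f s" "f t"]) simp_all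
qed

definition consistent :: "fm set \<Rightarrow> bool" where
  "consistent \<Gamma> \<longleftrightarrow> \<not> prov \<Gamma> \<^bold>\<bottom>"

lemma prov_Neg_if_inconsistent:
  "\<phi> \<in> in_language \<Longrightarrow> \<not> consistent (insert \<phi> \<Gamma>) \<Longrightarrow> prov \<Gamma> (\<^bold>\<not>\<phi>)"
  by (simp add: consistent_def Neg_def derives.ImpI)

lemma consistent_Neg:
  assumes "\<phi> \<in> in_language" "consistent \<Gamma>" "\<not> consistent (insert \<phi> \<Gamma>)"
  shows "consistent (insert (\<^bold>\<not>\<phi>) \<Gamma>)"
proof (rule ccontr)
  assume "\<not> ?thesis"
  then have "prov \<Gamma> \<phi>" using assms(1) by (simp add: consistent_def derives.RAA)
  moreover have "prov \<Gamma> (\<phi> \<^bold>\<longrightarrow> \<^bold>\<bottom>)"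
    using prov_Neg_if_inconsistent[OF assms(1,3)] by (simp add: Neg_def)
  ultimately show False using assms(2) unfolding consistent_def by (blast intro: derives.ImpE)
qed

text \<open>This is \<open>AllI\<close> read backwards: if the instance at a fresh \<open>t\<close>
  were derivable, so would be the universal formula, whose negation is assumed.\<close>

lemma consistent_witness:
  assumes L: "\<psi> \<in> in_language" and cons: "consistent (insert (\<^bold>\<not>(\<^bold>\<forall>\<psi>)) \<Gamma>)"
    and fresh: "\<And>\<gamma>. \<gamma> \<in> insert (\<^bold>\<not>(\<^bold>\<forall>\<psi>)) \<Gamma> \<Longrightarrow> fv_bound \<gamma> \<le> t"
  shows "consistent (insert (\<^bold>\<not>(inst [t] 0 \<psi>)) (insert (\<^bold>\<not>(\<^bold>\<forall>\<psi>)) \<Gamma>))"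
proof (rule ccontr)
  let ?\<Gamma> = "insert (\<^bold>\<not>(\<^bold>\<forall>\<psi>)) \<Gamma>"
  \<comment> \<open>This map sends the fresh \<open>t\<close> to the eigenvariable 0 and shifts the
    rest. On the assumptions it acts as the shift in \<open>AllI\<close>, and on the instance at
    \<open>t\<close> it undoes the substitution.\<close>
  let ?f = "\<lambda>n. if n = t then 0 else Suc n"
  assume "\<not> ?thesis"
  then have "prov ?\<Gamma> (inst [t] 0 \<psi>)"
    using L by (simp add: consistent_def in_language_def derives.RAA)
  then have "prov (rename ?f ` ?\<Gamma>) (rename ?f (inst [t] 0 \<psi>))"
    by (rule prov_rename)
  moreover have "rename ?f ` ?\<Gamma> = inst [] 1 ` ?\<Gamma>"
  proof (rule image_cong[OF refl])
    fix \<gamma> assume "\<gamma> \<in> ?\<Gamma>"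
    then have "fv_bound \<gamma> \<le> t" by (rule fresh)
    then show "rename ?f \<gamma> = inst [] 1 \<gamma>"
      unfolding inst_shift by (intro rename_cong) auto
  qed
  moreover have "rename ?f (inst [t] 0 \<psi>) = \<psi>"
  proof -
    have "fv_bound \<psi> \<le> Suc t" using fresh[of "\<^bold>\<not>(\<^bold>\<forall>\<psi>)"] by (auto simp: Neg_def)
    then have "rename (\<lambda>n. ?f (case_nat t (\<lambda>n. n) n)) \<psi> = rename (\<lambda>n. n) \<psi>"
      by (intro rename_cong) (auto split: nat.splits)
    then show ?thesis by (simp add: inst1 rename_rename rename_id)
  qed
  ultimately have "prov (inst [] 1 ` ?\<Gamma>) \<psi>" by metis
  then have "prov ?\<Gamma> (\<^bold>\<forall>\<psi>)" by (rule derives.AllI)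
  moreover have "prov ?\<Gamma> ((\<^bold>\<forall>\<psi>) \<^bold>\<longrightarrow> \<^bold>\<bottom>)"
    using L by (intro derives.Assm) (auto simp: Neg_def in_language_def)
  ultimately show False using cons unfolding consistent_def by (blast intro: derives.ImpE)
qed

text \<open>Deciding a formula and refuting a false universal one by an instance are joined in a
  single condition that is monotone in the set, so treating each formula once along a chain
  suffices.\<close>

definition henkin_for :: "fm \<Rightarrow> fm set \<Rightarrow> bool" where
  "henkin_for \<phi> \<Delta> \<longleftrightarrow> (\<phi> \<in> \<Delta> \<or> (\<^bold>\<not>\<phi>) \<in> \<Delta>) \<and>
     (\<forall>\<psi>. \<phi> = (\<^bold>\<forall>\<psi>) \<longrightarrow> \<phi> \<in> \<Delta> \<or> (\<exists>t. (\<^bold>\<not>(inst [t] 0 \<psi>)) \<in> \<Delta>))"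

lemma henkin_for_mono: "henkin_for \<phi> \<Delta> \<Longrightarrow> \<Delta> \<subseteq> \<Delta>' \<Longrightarrow> henkin_for \<phi> \<Delta>'"
  unfolding henkin_for_def by blast

text \<open>Variables take the role of the Henkin constants, and the common bound on free variables
  leaves fresh ones. An infinite set may have such a bound: all members of \<open>ZF\<close> are
  sentences.\<close>

definition extendable :: "fm set \<Rightarrow> bool" where
  "extendable \<Gamma> \<longleftrightarrow> consistent \<Gamma> \<and> \<Gamma> \<subseteq> in_language \<and> (\<exists>N. \<forall>\<gamma>\<in>\<Gamma>. fv_bound \<gamma> \<le> N)"

lemma extendable_step:
  assumes "extendable \<Gamma>" "\<phi> \<in> in_language"
  shows "\<exists>\<Delta>. extendable \<Delta> \<and> \<Gamma> \<subseteq> \<Delta> \<and> henkin_for \<phi> \<Delta>"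
proof -
  obtain N where N: "\<And>\<gamma>. \<gamma> \<in> \<Gamma> \<Longrightarrow> fv_bound \<gamma> \<le> N"
    using assms(1) unfolding extendable_def by blast
  have ext: "extendable (insert \<psi> \<Gamma>')"
    if c: "consistent (insert \<psi> \<Gamma>')" "\<psi> \<in> in_language" "extendable \<Gamma>'" for \<psi> \<Gamma>'
  proof -
    obtain N' where "\<And>\<gamma>. \<gamma> \<in> \<Gamma>' \<Longrightarrow> fv_bound \<gamma> \<le> N'"
      using c(3) unfolding extendable_def by blast
    then have "\<forall>\<gamma>\<in>insert \<psi> \<Gamma>'. fv_bound \<gamma> \<le> max N' (fv_bound \<psi>)" by (auto simp: le_max_iff_disj)
    then show ?thesis using c unfolding extendable_def by blast
  qed
  show ?thesis
  proof (cases "consistent (insert \<phi> \<Gamma>)")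
    case True
    then show ?thesis using ext[OF True assms(2,1)] by (auto simp: henkin_for_def)
  next
    case False
    let ?\<Gamma> = "insert (\<^bold>\<not>\<phi>) \<Gamma>"
    have cons: "consistent ?\<Gamma>"
      using consistent_Neg[OF assms(2) _ False] assms(1) by (simp add: extendable_def)
    have e: "extendable ?\<Gamma>"
      using ext[OF cons _ assms(1)] assms(2) by (simp add: in_language_def)
    show ?thesis
    proof (cases "\<exists>\<psi>. \<phi> = (\<^bold>\<forall>\<psi>)")
      case True
      then obtain \<psi> where \<psi>: "\<phi> = (\<^bold>\<forall>\<psi>)" by auto
      obtain t where "\<And>\<gamma>. \<gamma> \<in> ?\<Gamma> \<Longrightarrow> fv_bound \<gamma> \<le> t"
        using e unfolding extendable_def by blast
      then have "consistent (insert (\<^bold>\<not>(inst [t] 0 \<psi>)) ?\<Gamma>)"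
        using cons assms(2) unfolding \<psi> by (intro consistent_witness) (auto simp: in_language_def)
      then have "extendable (insert (\<^bold>\<not>(inst [t] 0 \<psi>)) ?\<Gamma>)"
        by (rule ext) (use e assms(2) \<psi> in \<open>auto simp: in_language_def\<close>)
      then show ?thesis
        by (intro exI[of _ "insert (\<^bold>\<not>(inst [t] 0 \<psi>)) ?\<Gamma>"]) (auto simp: henkin_for_def \<psi>)
    next
      case False
      then show ?thesis using e by (intro exI[of _ ?\<Gamma>]) (auto simp: henkin_for_def)
    qed
  qed
qed

section \<open>Truth in the term model of a Henkin set\<close>

locale henkin =
  fixes H :: "fm set"
  assumes cons: "consistent H" and sub: "H \<subseteq> in_language"
    and henkin: "\<phi> \<in> in_language \<Longrightarrow> henkin_for \<phi> H"

lemma henkin_extension: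
  assumes "extendable \<Gamma>"
  shows "\<exists>H. \<Gamma> \<subseteq> H \<and> henkin H"
proof -
  \<comment> \<open>Formulas are countable, so stage \<open>n\<close> of the chain treats the
    formula with code \<open>n\<close>.\<close>
  let ?Q = "\<lambda>n \<Gamma> \<Delta>. \<Gamma> \<subseteq> \<Delta> \<and> (from_nat n \<in> in_language \<longrightarrow> henkin_for (from_nat n) \<Delta>)"
  have "\<exists>S. \<forall>n. (extendable (S n) \<and> \<Gamma> \<subseteq> S n) \<and> ?Q n (S n) (S (Suc n))"
  proof (rule dependent_nat_choice)
    show "\<exists>\<Delta>. extendable \<Delta> \<and> \<Gamma> \<subseteq> \<Delta>" using assms by auto
  next
    fix \<Delta> n assume "extendable \<Delta> \<and> \<Gamma> \<subseteq> \<Delta>"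
    then show "\<exists>\<Delta>'. (extendable \<Delta>' \<and> \<Gamma> \<subseteq> \<Delta>') \<and> ?Q n \<Delta> \<Delta>'"
      using extendable_step[of \<Delta> "from_nat n"] by (cases "from_nat n \<in> in_language") blast+
  qed
  then obtain S where S: "\<And>n. extendable (S n)" "\<And>n. \<Gamma> \<subseteq> S n" "\<And>n. S n \<subseteq> S (Suc n)"
    "\<And>n. from_nat n \<in> in_language \<Longrightarrow> henkin_for (from_nat n) (S (Suc n))" by blast
  have mono: "m \<le> n \<Longrightarrow> S m \<subseteq> S n" for m n using S(3) by (rule lift_Suc_mono_le)
  have "henkin (\<Union>n. S n)"
  proof
    show "(\<Union>n. S n) \<subseteq> in_language" using S(1) by (auto simp: extendable_def)
    show "henkin_for \<phi> (\<Union>n. S n)" if "\<phi> \<in> in_language" for \<phi>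
      using henkin_for_mono[OF S(4)[of "to_nat \<phi>"]] that by auto
    show "consistent (\<Union>n. S n)"
    proof (rule ccontr)
      assume "\<not> consistent (\<Union>n. S n)"
      then obtain \<Delta> where \<Delta>: "finite \<Delta>" "\<Delta> \<subseteq> (\<Union>n. S n)" "prov \<Delta> \<^bold>\<bottom>"
        using derives_finite by (force simp: consistent_def)
      have "\<exists>n. \<Delta> \<subseteq> S n"
        using \<Delta>(1,2)
      proof (induction \<Delta> rule: finite_induct)
        case (insert \<phi> \<Delta>)
        then obtain n m where "\<phi> \<in> S n" "\<Delta> \<subseteq> S m" by auto
        then have "insert \<phi> \<Delta> \<subseteq> S (max n m)" using mono[of n "max n m"] mono[of m "max n m"] by auto
        then show ?case by blast
      qed auto
      then show False using \<Delta>(3) S(1) by (auto simp: extendable_def consistent_def dest: derives_mono)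
    qed
  qed
  then show ?thesis using S(2) by blast
qed

context henkin
begin

lemma mem_prov: "\<phi> \<in> H \<Longrightarrow> prov H \<phi>"
  using sub by (intro derives.Assm) auto

lemma not_both: "\<phi> \<in> H \<Longrightarrow> (\<^bold>\<not>\<phi>) \<in> H \<Longrightarrow> False"
  using cons derives.ImpE[OF mem_prov[of "\<phi> \<^bold>\<longrightarrow> \<^bold>\<bottom>"] mem_prov]
  unfolding consistent_def Neg_def by blast

lemma closed: "prov H \<phi> \<Longrightarrow> \<phi> \<in> H"
proof (rule ccontr)
  assume a: "prov H \<phi>" "\<phi> \<notin> H"
  then have "\<phi> \<in> in_language" using prov_st_free by (auto simp: in_language_def)
  then have "(\<phi> \<^bold>\<longrightarrow> \<^bold>\<bottom>) \<in> H" using henkin[of \<phi>] a(2) by (auto simp: henkin_for_def Neg_def)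
  from derives.ImpE[OF mem_prov[OF this] a(1)] show False using cons by (simp add: consistent_def)
qed

lemma Imp_iff:
  assumes "\<phi> \<in> in_language" "\<psi> \<in> in_language"
  shows "(\<phi> \<^bold>\<longrightarrow> \<psi>) \<in> H \<longleftrightarrow> (\<phi> \<in> H \<longrightarrow> \<psi> \<in> H)"
proof
  show "(\<phi> \<^bold>\<longrightarrow> \<psi>) \<in> H \<Longrightarrow> \<phi> \<in> H \<longrightarrow> \<psi> \<in> H"
    using closed[OF derives.ImpE[OF mem_prov mem_prov]] by simp
  assume *: "\<phi> \<in> H \<longrightarrow> \<psi> \<in> H"
  show "(\<phi> \<^bold>\<longrightarrow> \<psi>) \<in> H"
  proof (cases "\<phi> \<in> H")
    case True
    then have "prov (insert \<phi> H) \<psi>" using * mem_prov derives_mono by blast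
    then show ?thesis using assms(1) by (intro closed derives.ImpI)
  next
    case False
    then have n: "(\<phi> \<^bold>\<longrightarrow> \<^bold>\<bottom>) \<in> H" using henkin assms by (auto simp: henkin_for_def Neg_def)
    let ?\<Gamma> = "insert (\<^bold>\<not>\<psi>) (insert \<phi> H)"
    have "prov ?\<Gamma> (\<phi> \<^bold>\<longrightarrow> \<^bold>\<bottom>)" by (rule derives_mono[OF mem_prov[OF n]]) auto
    moreover have "prov ?\<Gamma> \<phi>" using assms by (intro derives.Assm) auto
    ultimately have "prov ?\<Gamma> \<^bold>\<bottom>" by (rule derives.ImpE)
    then have "prov (insert \<phi> H) \<psi>" by (rule derives.RAA[OF assms(2)])
    then show ?thesis using assms(1) by (intro closed derives.ImpI)
  qed
qed

lemma Forall_iff: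
  assumes "\<phi> \<in> in_language"
  shows "(\<^bold>\<forall>\<phi>) \<in> H \<longleftrightarrow> (\<forall>t. inst [t] 0 \<phi> \<in> H)"
proof
  show "(\<^bold>\<forall>\<phi>) \<in> H \<Longrightarrow> \<forall>t. inst [t] 0 \<phi> \<in> H"
    using closed[OF derives.AllE[OF mem_prov]] by simp
  assume *: "\<forall>t. inst [t] 0 \<phi> \<in> H"
  have "(\<^bold>\<forall>\<phi>) \<in> in_language" using assms by (simp add: in_language_def)
  from henkin[OF this] show "(\<^bold>\<forall>\<phi>) \<in> H"
    using * not_both unfolding henkin_for_def by blast
qed

definition eqv :: "nat \<Rightarrow> nat \<Rightarrow> bool" where "eqv s t \<longleftrightarrow> (s \<^bold>= t) \<in> H"

lemma eqv_refl: "eqv t t"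
  unfolding eqv_def by (intro closed derives.EqRefl)

lemma eqv_subst: "eqv s t \<Longrightarrow> inst [s] 0 \<phi> \<in> H \<Longrightarrow> inst [t] 0 \<phi> \<in> H"
  unfolding eqv_def by (rule closed[OF derives.EqSubst[OF mem_prov mem_prov]])

lemma eqv_sym: "eqv s t \<Longrightarrow> eqv t s"
  \<comment> \<open>Instantiating index 0 lowers the other indices by one, so the parameter
    \<open>s\<close> is written \<open>Suc s\<close>.\<close>
  using eqv_subst[of s t "0 \<^bold>= Suc s"] eqv_refl[of s] by (simp add: inst1 eqv_def)

lemma eqv_trans: "eqv s t \<Longrightarrow> eqv t u \<Longrightarrow> eqv s u"
  using eqv_subst[of t u "Suc s \<^bold>= 0"] by (simp add: inst1 eqv_def)

text \<open>When \<open>b\<close> enumerates representatives of the classes of \<open>eqv\<close>, the model has true equality.\<close>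

lemma truth:
  assumes b: "\<And>t. \<exists>i. eqv t (b i)"
  shows "st_free \<phi> \<Longrightarrow> sat (\<lambda>i j. eqv (b i) (b j)) (\<lambda>i j. (b i \<^bold>\<in> b j) \<in> H) v \<phi> \<longleftrightarrow>
     rename (\<lambda>n. b (v n)) \<phi> \<in> H"
proof (induction \<phi> arbitrary: v)
  case Fls
  then show ?case using cons mem_prov[of "\<^bold>\<bottom>"] by (auto simp: consistent_def)
next
  case (Imp \<phi>1 \<phi>2)
  then show ?case by (simp add: Imp_iff in_language_def)
next
  case (Forall \<phi>)
  let ?\<phi> = "rename (case_nat 0 (\<lambda>n. Suc (b (v n)))) \<phi>"
  have 1: "inst [b x] 0 ?\<phi> = rename (\<lambda>n. b (case_nat x v n)) \<phi>" for x
  proof -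
    have "(\<lambda>n. case_nat (b x) (\<lambda>n. n) (case_nat 0 (\<lambda>n. Suc (b (v n))) n)) = (\<lambda>n. b (case_nat x v n))"
      by (auto simp: fun_eq_iff split: nat.splits)
    then show ?thesis by (simp add: inst1 rename_rename)
  qed
  \<comment> \<open>The quantifier of the model runs over the listed representatives only; each
    variable is equivalent to one of them and instances respect equivalence.\<close>
  have "(\<forall>t. inst [t] 0 ?\<phi> \<in> H) \<longleftrightarrow> (\<forall>x. inst [b x] 0 ?\<phi> \<in> H)"
    by (metis b eqv_subst eqv_sym)
  then show ?case using Forall by (simp add: Forall_iff in_language_def 1)
qed (auto simp: eqv_def)

end

text \<open>A model of Pairing, Union and Separation is infinite: finitely many elements always lie in a
  common set, so that Russell's set yields a further element.\<close>

lemma (in henkin) infinite_reps: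
  assumes ZF: "ZF \<subseteq> H"
  shows "infinite (range (\<lambda>t. LEAST s. eqv s t))"
proof
  define E where "E = (\<lambda>i j. (i \<^bold>\<in> j) \<in> H)"
  have sat: "sat eqv E v \<phi>" if "\<phi> \<in> ZF" for v \<phi>
  proof -
    have "rename v \<phi> = \<phi>" using rename_sentence[OF ZF_sentence[OF that]] .
    then show ?thesis
      using truth[of "\<lambda>i. i" \<phi> v] ZF that ZF_st_free[OF that] eqv_refl by (auto simp: E_def)
  qed
  have E_subst1: "E x z \<Longrightarrow> eqv x y \<Longrightarrow> E y z" for x y z
    using eqv_subst[of x y "0 \<^bold>\<in> Suc z"] by (simp add: inst1 E_def)
  have E_subst2: "E x z \<Longrightarrow> eqv z y \<Longrightarrow> E x y" for x y z
    using eqv_subst[of z y "Suc x \<^bold>\<in> 0"] by (simp add: inst1 E_def)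
  let ?r = "\<lambda>t. LEAST s. eqv s t"
  assume fin: "finite (range ?r)"
  have pair: "\<exists>p. E x p \<and> E y p" for x y
    using sat[of Pairing "\<lambda>_. 0"] eqv_refl by (auto simp: ZF_def Pairing_def eval_nat_numeral) blast
  have Un: "\<exists>u. \<forall>w y. E y x \<longrightarrow> E w y \<longrightarrow> E w u" for x
    using sat[of Union_Axiom "\<lambda>_. 0"] by (auto simp: ZF_def Union_Axiom_def eval_nat_numeral) blast
  have "\<exists>z. \<forall>t\<in>F. E t z" if "finite F" for F
    using that
  proof (induction F)
    case (insert t F)
    then obtain z where z: "\<forall>t\<in>F. E t z" by blast
    obtain p where p: "E t p" using pair by blast
    obtain q where q: "E p q" "E z q" using pair by blast
    obtain u where "\<forall>w y. E y q \<longrightarrow> E w y \<longrightarrow> E w u" using Un by blast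
    then have "\<forall>t\<in>insert t F. E t u" using z p q by blast
    then show ?case ..
  qed auto
  from this[OF fin] obtain z where z: "\<And>t. E (?r t) z" by auto
  have all: "E t z" for t
  proof -
    have "eqv (?r t) t" by (rule LeastI) (rule eqv_refl)
    then show ?thesis using z E_subst1 by blast
  qed
  have "Separation (\<^bold>\<not>(0 \<^bold>\<in> 0)) \<in> ZF" by (auto simp: ZF_def in_language_def)
  from sat[OF this] have "\<forall>v. sat eqv E v (forall_closure (\<^bold>\<forall>\<^bold>\<exists>\<^bold>\<forall>0 \<^bold>\<in> 1 \<^bold>\<longleftrightarrow> 0 \<^bold>\<in> 2 \<^bold>\<and> inst [0] 3 (\<^bold>\<not>(0 \<^bold>\<in> 0))))"
    unfolding Separation_def by blast
  then have "\<exists>S. \<forall>x. E x S \<longleftrightarrow> E x z \<and> \<not> E x x"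
    unfolding sat_forall_closure by (simp add: inst_def sat_rename eval_nat_numeral)
  then show False using all by blast
qed

text \<open>The model lives on all of \<open>nat\<close> and has true equality because the term
  model has infinitely many classes: a bijection \<open>b\<close> enumerates their least
  representatives.\<close>

theorem zf_completeness:
  assumes th: "\<theta> \<in> in_language" "sentence \<theta>" and np: "\<not> prov ZF \<theta>"
  obtains E :: "nat \<Rightarrow> nat \<Rightarrow> bool"
  where "\<And>\<phi> v. \<phi> \<in> ZF \<Longrightarrow> sat (=) E v \<phi>" "\<And>v. \<not> sat (=) E v \<theta>"
proof -
  let ?\<Gamma> = "insert (\<^bold>\<not>\<theta>) ZF"
  have fv: "fv_bound \<gamma> = 0" "\<gamma> \<in> in_language" if "\<gamma> \<in> ?\<Gamma>" for \<gamma>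
    using that th ZF_sentence ZF_st_free by (auto simp: sentence_def Neg_def in_language_def)
  have "consistent ?\<Gamma>" using np th(1) by (auto simp: consistent_def derives.RAA)
  then have "extendable ?\<Gamma>" using fv unfolding extendable_def by fastforce
  then obtain H where H: "?\<Gamma> \<subseteq> H" "henkin H" using henkin_extension by blast
  interpret henkin H by (rule H(2))
  let ?r = "\<lambda>t. LEAST s. eqv s t"
  define U where "U = range ?r"
  have "infinite U" using infinite_reps H(1) by (auto simp: U_def)
  then obtain b :: "nat \<Rightarrow> nat" where b: "bij_betw b UNIV U"
    using bij_enumerate by blast
  have r: "eqv (?r t) t" for t by (rule LeastI) (rule eqv_refl)
  have cover: "\<exists>i. eqv t (b i)" for t
  proof -
    have "?r t \<in> range b" using b by (auto simp: bij_betw_def U_def)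
    then obtain i where "b i = ?r t" by auto
    then show ?thesis using r eqv_sym by metis
  qed
  have r_cong: "?r s = ?r t" if "eqv s t" for s t
  proof -
    have "eqv u s \<longleftrightarrow> eqv u t" for u using that eqv_sym eqv_trans by blast
    then show ?thesis by simp
  qed
  have eq: "eqv (b i) (b j) \<longleftrightarrow> i = j" for i j
  proof
    assume e: "eqv (b i) (b j)"
    obtain s t where "b i = ?r s" "b j = ?r t" using b by (force simp: bij_betw_def U_def)
    moreover from this have "eqv s t" using e r eqv_sym eqv_trans by metis
    ultimately have "b i = b j" using r_cong by metis
    then show "i = j" using b by (auto simp: bij_betw_def inj_eq)
  qed (simp add: eqv_refl)
  have eq': "(\<lambda>i j. eqv (b i) (b j)) = (=)" using eq by (intro ext) simp
  have t: "sat (=) (\<lambda>i j. (b i \<^bold>\<in> b j) \<in> H) v \<phi> \<longleftrightarrow> rename (\<lambda>n. b (v n)) \<phi> \<in> H" if "st_free \<phi>" for v \<phi>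
    using truth[OF cover that] unfolding eq' .
  show ?thesis
  proof (rule that)
    show "sat (=) (\<lambda>i j. (b i \<^bold>\<in> b j) \<in> H) v \<phi>" if "\<phi> \<in> ZF" for \<phi> v
      using t[of \<phi> v] ZF_st_free ZF_sentence H(1) that rename_sentence by auto
    show "\<not> sat (=) (\<lambda>i j. (b i \<^bold>\<in> b j) \<in> H) v \<theta>" for v
      using t[of \<theta> v] th rename_sentence[OF th(2)] H(1) not_both by (auto simp: in_language_def)
  qed
qed

section \<open>Definable classes\<close>

definition trm :: "((nat \<Rightarrow> 'a) \<Rightarrow> 'a) \<Rightarrow> bool" where
  "trm t \<longleftrightarrow> (\<exists>i. t = (\<lambda>v. v i)) \<or> (\<exists>c. t = (\<lambda>v. c))"

named_theorems def_intros

locale mem_structure =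
  fixes E :: "'a \<Rightarrow> 'a \<Rightarrow> bool"  (infix "\<epsilon>" 50)
begin

text \<open>Definability with parameters; a parameter is a constant term \<open>\<tau> n\<close>.\<close>

definition D :: "((nat \<Rightarrow> 'a) \<Rightarrow> bool) \<Rightarrow> bool" where
  "D P \<longleftrightarrow> (\<exists>\<phi> \<tau>. st_free \<phi> \<and> (\<forall>n. trm (\<tau> n)) \<and> (\<forall>v. P v = sat (=) (\<epsilon>) (\<lambda>n. \<tau> n v) \<phi>))"

text \<open>The language has no function symbols, so a function is definable through its graph, with
  the value in slot 0 and the arguments moved up by one.\<close>

definition dfun :: "((nat \<Rightarrow> 'a) \<Rightarrow> 'a) \<Rightarrow> bool" where
  "dfun F \<longleftrightarrow> D (\<lambda>v. v 0 = F (\<lambda>n. v (Suc n)))"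

lemma trm_var: "trm (\<lambda>v. v i)" and trm_const: "trm (\<lambda>v. c)"
  by (auto simp: trm_def)

lemma D_reindex:
  assumes "D P" "\<And>n. trm (s n)"
  shows "D (\<lambda>v. P (\<lambda>n. s n v))"
proof -
  obtain \<phi> \<tau> where *: "st_free \<phi>" "\<And>n. trm (\<tau> n)" "\<And>v. P v = sat (=) (\<epsilon>) (\<lambda>n. \<tau> n v) \<phi>"
    using assms(1) unfolding D_def by blast
  have "trm (\<lambda>v. \<tau> n (\<lambda>m. s m v))" for n
    using *(2)[of n] assms(2) unfolding trm_def[of "\<tau> n"] by (elim disjE exE) (simp_all add: trm_const)
  then show ?thesis unfolding D_def
    by (intro exI[of _ \<phi>] exI[of _ "\<lambda>n v. \<tau> n (\<lambda>m. s m v)"]) (simp add: *)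
qed

lemma D_const [def_intros]: "D (\<lambda>v. b)"
proof -
  have "D (\<lambda>v. False)"
    unfolding D_def by (intro exI[of _ "\<^bold>\<bottom>"] exI[of _ "\<lambda>n v. v n"]) (simp add: trm_var)
  moreover have "D (\<lambda>v. True)"
    unfolding D_def
    by (intro exI[of _ "\<^bold>\<bottom> \<^bold>\<longrightarrow> \<^bold>\<bottom>"] exI[of _ "\<lambda>n v. v n"]) (simp add: trm_var)
  ultimately show ?thesis by (cases b) auto
qed

lemma D_imp [def_intros]:
  assumes "D P" "D Q"
  shows "D (\<lambda>v. P v \<longrightarrow> Q v)"
proof -
  obtain \<phi> \<tau> where 1: "st_free \<phi>" "\<And>n. trm (\<tau> n)" "\<And>v. P v = sat (=) (\<epsilon>) (\<lambda>n. \<tau> n v) \<phi>"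
    using assms(1) unfolding D_def by blast
  obtain \<psi> \<sigma> where 2: "st_free \<psi>" "\<And>n. trm (\<sigma> n)" "\<And>v. Q v = sat (=) (\<epsilon>) (\<lambda>n. \<sigma> n v) \<psi>"
    using assms(2) unfolding D_def by blast
  \<comment> \<open>Even and odd indices keep the terms of the two formulas apart.\<close>
  let ?\<phi> = "rename (\<lambda>n. 2 * n) \<phi> \<^bold>\<longrightarrow> rename (\<lambda>n. 2 * n + 1) \<psi>"
  let ?\<tau> = "\<lambda>n. if even n then \<tau> (n div 2) else \<sigma> (n div 2)"
  show ?thesis unfolding D_def
    by (intro exI[of _ ?\<phi>] exI[of _ ?\<tau>]) (simp add: 1 2 sat_rename)
qed

lemma D_not [def_intros]: "D P \<Longrightarrow> D (\<lambda>v. \<not> P v)"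
  using D_imp[OF _ D_const[of False]] by simp

lemma D_disj [def_intros]: "D P \<Longrightarrow> D Q \<Longrightarrow> D (\<lambda>v. P v \<or> Q v)"
  using D_imp[OF D_not[of P], of Q] by (simp add: disj_imp)

lemma D_conj [def_intros]: "D P \<Longrightarrow> D Q \<Longrightarrow> D (\<lambda>v. P v \<and> Q v)"
  using D_not[OF D_imp[OF _ D_not], of P Q] by simp

lemma D_iff [def_intros]: "D P \<Longrightarrow> D Q \<Longrightarrow> D (\<lambda>v. P v \<longleftrightarrow> Q v)"
  using D_conj[OF D_imp D_imp, of P Q Q P] by (simp add: iff_conv_conj_imp)

lemma D_all [def_intros]:
  assumes "D (\<lambda>v. P (\<lambda>n. v (Suc n)) (v 0))"
  shows "D (\<lambda>v. \<forall>x. P v x)"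
proof -
  obtain \<phi> \<tau> where *: "st_free \<phi>" "\<And>n. trm (\<tau> n)"
    "\<And>v. P (\<lambda>n. v (Suc n)) (v 0) = sat (=) (\<epsilon>) (\<lambda>n. \<tau> n v) \<phi>"
    using assms unfolding D_def by blast
  \<comment> \<open>Several indices may carry the projection to slot 0, and all of them must become
    the bound variable. The remaining terms ignore slot 0, so \<open>undefined\<close> can be put
    there.\<close>
  let ?s = "\<lambda>n. if \<tau> n = (\<lambda>v. v 0) then 0 else Suc n"
  let ?\<tau> = "\<lambda>n v. \<tau> n (case_nat undefined v)"
  have t: "trm (?\<tau> n)" for n
  proof (cases "\<exists>i. \<tau> n = (\<lambda>v. v i)")
    case True
    then obtain i where "\<tau> n = (\<lambda>v. v i)" by blast
    then show ?thesis by (cases i) (auto simp: trm_def)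
  next
    case False
    then show ?thesis using *(2)[of n] by (auto simp: trm_def)
  qed
  have e: "case_nat x (\<lambda>n. ?\<tau> n v) (?s n) = \<tau> n (case_nat x v)" for x v n
  proof (cases "\<tau> n = (\<lambda>v. v 0)")
    case False
    then have "\<tau> n = (\<lambda>v. v i) \<Longrightarrow> i \<noteq> 0" for i by metis
    with False *(2)[of n] show ?thesis by (auto simp: trm_def split: nat.splits)
  qed simp
  have "(\<forall>x. P v x) = sat (=) (\<epsilon>) (\<lambda>n. ?\<tau> n v) (\<^bold>\<forall>rename ?s \<phi>)" for v
    using *(3)[of "case_nat _ v"] by (simp add: sat_rename e)
  then show ?thesis unfolding D_def
    by (intro exI[of _ "\<^bold>\<forall>rename ?s \<phi>"] exI[of _ ?\<tau>]) (use t *(1) in simp)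
qed

lemma D_ex [def_intros]:
  assumes "D (\<lambda>v. P (\<lambda>n. v (Suc n)) (v 0))"
  shows "D (\<lambda>v. \<exists>x. P v x)"
  using D_not[OF D_all[OF D_not[OF assms]]] by simp

lemma D_eq_vars: "D (\<lambda>v. v i = v j)" and D_mem_vars: "D (\<lambda>v. v i \<epsilon> v j)"
proof -
  show "D (\<lambda>v. v i = v j)" unfolding D_def
    by (intro exI[of _ "i \<^bold>= j"] exI[of _ "\<lambda>n v. v n"]) (simp add: trm_var)
  show "D (\<lambda>v. v i \<epsilon> v j)" unfolding D_def
    by (intro exI[of _ "i \<^bold>\<in> j"] exI[of _ "\<lambda>n v. v n"]) (simp add: trm_var)
qed

lemma dfun_var [def_intros]: "dfun (\<lambda>v. v i)"
  unfolding dfun_def by (rule D_eq_vars)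

lemma dfun_const [def_intros]: "dfun (\<lambda>v. c)"
proof -
  have "trm (\<lambda>v. if n = 0 then v 0 else c)" for n :: nat
    by (cases "n = 0") (simp_all add: trm_var trm_const)
  from D_reindex[OF D_eq_vars[of 0 1], of "\<lambda>n v. if n = 0 then v 0 else c", OF this] show ?thesis by (simp add: dfun_def)
qed

lemma dfun_reindex: "dfun F \<Longrightarrow> dfun (\<lambda>v. F (\<lambda>n. v (s n)))"
  unfolding dfun_def
  using D_reindex[of "\<lambda>v. v 0 = F (\<lambda>n. v (Suc n))" "\<lambda>n v. v (case_nat 0 (\<lambda>n. Suc (s n)) n)"]
  by (simp add: trm_var)

lemma dfun_graph: "dfun F \<Longrightarrow> D (\<lambda>v. v i = F (\<lambda>n. v (s n)))"
  unfolding dfun_def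
  using D_reindex[of "\<lambda>v. v 0 = F (\<lambda>n. v (Suc n))" "\<lambda>n v. v (case_nat i s n)"]
  by (simp add: trm_var)

section \<open>Substituting definable functions into definable predicates\<close>

lemma D_let:
  assumes "D (\<lambda>v. P (\<lambda>n. v (Suc n)) (v 0))" "dfun F"
  shows "D (\<lambda>v. P v (F v))"
proof -
  have "D (\<lambda>v. \<exists>y. y = F v \<and> P v y)"
    by (intro D_ex D_conj assms(1) dfun_graph[OF assms(2)])
  then show ?thesis by simp
qed

lemma D_comp1:
  assumes "D (\<lambda>v. P (v 0))" "dfun F"
  shows "D (\<lambda>v. P (F v))"
  by (rule D_let[OF assms])

lemma D_comp2:
  assumes "D (\<lambda>v. P (v 0) (v 1))" "dfun F" "dfun G"
  shows "D (\<lambda>v. P (F v) (G v))"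
proof -
  have "D (\<lambda>v. \<exists>x. x = F v \<and> (\<exists>y. y = G v \<and> P x y))"
    \<comment> \<open>The innermost quantifier occupies slot 0, so the arguments arrive in reverse
      order.\<close>
    using D_reindex[OF assms(1), of "\<lambda>n v. v (1 - n)"]
    by (intro D_ex D_conj dfun_graph assms(2,3)) (simp add: trm_var)
  then show ?thesis by simp
qed

lemma D_comp3:
  assumes "D (\<lambda>v. P (v 0) (v 1) (v 2))" "dfun F" "dfun G" "dfun H"
  shows "D (\<lambda>v. P (F v) (G v) (H v))"
proof -
  have "D (\<lambda>v. \<exists>x. x = F v \<and> (\<exists>y. y = G v \<and> (\<exists>z. z = H v \<and> P x y z)))"
    using D_reindex[OF assms(1), of "\<lambda>n v. v (2 - n)"]
    by (intro D_ex D_conj dfun_graph assms(2-4)) (simp add: trm_var eval_nat_numeral)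
  then show ?thesis by simp
qed

lemma D_comp4:
  assumes "D (\<lambda>v. P (v 0) (v 1) (v 2) (v 3))" "dfun F" "dfun G" "dfun H" "dfun K"
  shows "D (\<lambda>v. P (F v) (G v) (H v) (K v))"
proof -
  have "D (\<lambda>v. \<exists>x. x = F v \<and> (\<exists>y. y = G v \<and> (\<exists>z. z = H v \<and> (\<exists>u. u = K v \<and> P x y z u))))"
    using D_reindex[OF assms(1), of "\<lambda>n v. v (3 - n)"]
    by (intro D_ex D_conj dfun_graph assms(2-5)) (simp add: trm_var eval_nat_numeral)
  then show ?thesis by simp
qed

lemma D_mem [def_intros]: "dfun F \<Longrightarrow> dfun G \<Longrightarrow> D (\<lambda>v. F v \<epsilon> G v)"
  by (rule D_comp2[where P = "(\<epsilon>)", OF D_mem_vars])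

lemma D_eq [def_intros]: "dfun F \<Longrightarrow> dfun G \<Longrightarrow> D (\<lambda>v. F v = G v)"
  by (rule D_comp2[where P = "(=)", OF D_eq_vars])

lemma dfun_comp1:
  assumes "D (\<lambda>v. v 0 = f (v 1))" "dfun F"
  shows "dfun (\<lambda>v. f (F v))"
  unfolding dfun_def
  by (rule D_comp2[where P = "\<lambda>x y. x = f y", OF assms(1) dfun_var dfun_reindex[OF assms(2)]])

lemma dfun_comp2:
  assumes "D (\<lambda>v. v 0 = f (v 1) (v 2))" "dfun F" "dfun G"
  shows "dfun (\<lambda>v. f (F v) (G v))"
  unfolding dfun_def
  by (rule D_comp3[where P = "\<lambda>x y z. x = f y z", OF assms(1) dfun_var
        dfun_reindex[OF assms(2)] dfun_reindex[OF assms(3)]])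

lemma dfun_comp3:
  assumes "D (\<lambda>v. v 0 = f (v 1) (v 2) (v 3))" "dfun F" "dfun G" "dfun H"
  shows "dfun (\<lambda>v. f (F v) (G v) (H v))"
  unfolding dfun_def
  by (rule D_comp4[where P = "\<lambda>x y z u. x = f y z u", OF assms(1) dfun_var
        dfun_reindex[OF assms(2)] dfun_reindex[OF assms(3)] dfun_reindex[OF assms(4)]])

lemma D_sat:
  "st_free \<phi> \<Longrightarrow> (\<And>n. dfun (F n)) \<Longrightarrow> D (\<lambda>v. sat (=) (\<epsilon>) (\<lambda>n. F n v) \<phi>)"
proof (induction \<phi> arbitrary: F)
  case (Forall \<phi>)
  let ?F = "case_nat (\<lambda>v. v 0) (\<lambda>n v. F n (\<lambda>k. v (Suc k)))"
  have "dfun (?F n)" for n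
    by (cases n) (simp_all add: dfun_var dfun_reindex Forall.prems(2))
  then have "D (\<lambda>v. sat (=) (\<epsilon>) (\<lambda>n. ?F n v) \<phi>)"
    using Forall.IH[of ?F] Forall.prems(1) by simp
  moreover have "(\<lambda>n. ?F n v) = case_nat (v 0) (\<lambda>n. F n (\<lambda>k. v (Suc k)))" for v
    by (auto simp: fun_eq_iff split: nat.splits)
  ultimately show ?case by (simp add: D_all)
qed (auto intro: def_intros)

text \<open>Brings a definable relation into the form that the schemas of \<open>ZF\<close> expect:
  its arguments at indices 0 and 1, its parameters behind them.\<close>

lemma D_two_variables:
  assumes "D (\<lambda>v. R (v 0) (v 1))"
  obtains \<phi> w where "st_free \<phi>" "\<And>x y. R x y = sat (=) (\<epsilon>) (case_nat x (case_nat y w)) \<phi>"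
proof -
  obtain \<phi> \<tau> where *: "st_free \<phi>" "\<And>n. trm (\<tau> n)"
    "\<And>v. R (v 0) (v 1) = sat (=) (\<epsilon>) (\<lambda>n. \<tau> n v) \<phi>"
    using assms unfolding D_def by blast
  \<comment> \<open>The relation depends on slots 0 and 1 only, so it may be evaluated with
    \<open>y\<close> in all slots from 1 on; every projection other than the one to slot 0 then
    denotes \<open>y\<close>.\<close>
  define s where "s n = (if \<tau> n = (\<lambda>v. v 0) then 0
    else if \<exists>i. \<tau> n = (\<lambda>v. v i) then 1 else Suc (Suc n))" for n
  define w where "w n = \<tau> n (\<lambda>_. undefined)" for n
  have e: "case_nat x (case_nat y w) (s n) = \<tau> n (case_nat x (\<lambda>_. y))" for x y n
  proof (cases "\<tau> n = (\<lambda>v. v 0)")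
    case True
    then show ?thesis by (simp add: s_def)
  next
    case no_proj0: False
    show ?thesis
    proof (cases "\<exists>i. \<tau> n = (\<lambda>v. v i)")
      case True
      then obtain i where i: "\<tau> n = (\<lambda>v. v i)" by blast
      with no_proj0 have "i \<noteq> 0" by metis
      moreover have "s n = 1" using True no_proj0 by (simp add: s_def)
      ultimately show ?thesis by (cases i) (simp_all add: i)
    next
      case False
      then obtain c where "\<tau> n = (\<lambda>v. c)" using *(2)[of n] by (auto simp: trm_def)
      with False no_proj0 show ?thesis by (simp add: s_def w_def)
    qed
  qed
  show ?thesis
  proof (rule that)
    show "st_free (rename s \<phi>)" using *(1) by simp
    show "R x y = sat (=) (\<epsilon>) (case_nat x (case_nat y w)) (rename s \<phi>)" for x y
      using *(3)[of "case_nat x (\<lambda>_. y)"] by (simp add: sat_rename e)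
  qed
qed

end

section \<open>Set theory inside a model\<close>

locale zf_model = mem_structure E for E :: "'a \<Rightarrow> 'a \<Rightarrow> bool"  (infix "\<epsilon>" 50) +
  assumes zf: "\<phi> \<in> ZF \<Longrightarrow> sat (=) (\<epsilon>) v \<phi>"
begin

lemma extensionality: "(\<And>z. z \<epsilon> x \<longleftrightarrow> z \<epsilon> y) \<Longrightarrow> x = y"
  using zf[of Extensionality "\<lambda>_. x"] by (simp add: ZF_def Extensionality_def eval_nat_numeral)

lemma foundation: "y \<epsilon> x \<Longrightarrow> \<exists>y. y \<epsilon> x \<and> (\<forall>z. z \<epsilon> x \<longrightarrow> \<not> z \<epsilon> y)"
  using zf[of Foundation "\<lambda>_. x"] by (simp add: ZF_def Foundation_def eval_nat_numeral) blast

lemma ex_upair: "\<exists>p. \<forall>w. w \<epsilon> p \<longleftrightarrow> w = x \<or> w = y"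
  using zf[of Pairing "\<lambda>_. x"] by (simp add: ZF_def Pairing_def eval_nat_numeral)

lemma ex_Union: "\<exists>u. \<forall>w. w \<epsilon> u \<longleftrightarrow> (\<exists>y. y \<epsilon> x \<and> w \<epsilon> y)"
  using zf[of Union_Axiom "\<lambda>_. x"] by (simp add: ZF_def Union_Axiom_def eval_nat_numeral)

definition sub :: "'a \<Rightarrow> 'a \<Rightarrow> bool"  (infix "\<sqsubseteq>" 50) where
  "x \<sqsubseteq> y \<longleftrightarrow> (\<forall>z. z \<epsilon> x \<longrightarrow> z \<epsilon> y)"

lemma ex_Pow: "\<exists>p. \<forall>w. w \<epsilon> p \<longleftrightarrow> w \<sqsubseteq> x"
  using zf[of Powerset "\<lambda>_. x"]
  by (simp add: ZF_def Powerset_def Subset_def sub_def eval_nat_numeral)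

lemma separation:
  assumes "D (\<lambda>v. P (v 0))"
  shows "\<exists>S. \<forall>x. x \<epsilon> S \<longleftrightarrow> x \<epsilon> A \<and> P x"
proof -
  obtain \<phi> w where *: "st_free \<phi>" "\<And>x y. P x = sat (=) (\<epsilon>) (case_nat x (case_nat y w)) \<phi>"
    using D_two_variables[of "\<lambda>x y. P x"] assms by blast
  let ?\<psi> = "\<^bold>\<forall>\<^bold>\<exists>\<^bold>\<forall>0 \<^bold>\<in> 1 \<^bold>\<longleftrightarrow> 0 \<^bold>\<in> 2 \<^bold>\<and> inst [0] 3 \<phi>"
  have "Separation \<phi> \<in> ZF" using *(1) by (auto simp: ZF_def in_language_def)
  then have "\<forall>v. sat (=) (\<epsilon>) v (forall_closure ?\<psi>)" using zf unfolding Separation_def by blast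
  \<comment> \<open>The second variable supplied by \<open>D_two_variables\<close>, which
    \<open>P\<close> ignores, acts as the first parameter; \<open>A\<close> merely fills it.\<close>
  then have "sat (=) (\<epsilon>) (case_nat A w) ?\<psi>" unfolding sat_forall_closure by blast
  then have "\<forall>B. \<exists>S. \<forall>x. x \<epsilon> S \<longleftrightarrow> x \<epsilon> B \<and>
      sat (=) (\<epsilon>) (case_nat x (case_nat S (case_nat B (case_nat A w)))) (inst [0] 3 \<phi>)"
    by (simp add: eval_nat_numeral)
  from spec[OF this, of A] obtain S where S: "\<And>x. x \<epsilon> S \<longleftrightarrow> x \<epsilon> A \<and>
      sat (=) (\<epsilon>) (case_nat x (case_nat S (case_nat A (case_nat A w)))) (inst [0] 3 \<phi>)"
    by blast
  moreover have "sat (=) (\<epsilon>) (case_nat x (case_nat S (case_nat A (case_nat A w)))) (inst [0] 3 \<phi>) = P x" for x S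
    unfolding inst_def sat_rename *(2)[of x A]
    by (rule arg_cong[of _ _ "\<lambda>v. sat (=) (\<epsilon>) v \<phi>"])
      (auto simp: fun_eq_iff eval_nat_numeral split: nat.splits)
  ultimately show ?thesis by blast
qed

lemma replacement:
  assumes "D (\<lambda>v. R (v 0) (v 1))" "\<And>x y z. R x y \<Longrightarrow> R x z \<Longrightarrow> y = z"
  shows "\<exists>B. \<forall>y. y \<epsilon> B \<longleftrightarrow> (\<exists>x. x \<epsilon> A \<and> R x y)"
proof -
  obtain \<phi> w where *: "st_free \<phi>" "\<And>x y. R x y = sat (=) (\<epsilon>) (case_nat x (case_nat y w)) \<phi>"
    using D_two_variables assms(1) by blast
  let ?\<psi> = "(\<^bold>\<forall>\<^bold>\<forall>\<^bold>\<forall>inst [2, 1] 3 \<phi> \<^bold>\<and> inst [2, 0] 3 \<phi> \<^bold>\<longrightarrow> 1 \<^bold>= 0) \<^bold>\<longrightarrow>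
     (\<^bold>\<forall>\<^bold>\<exists>\<^bold>\<forall>0 \<^bold>\<in> 1 \<^bold>\<longleftrightarrow> (\<^bold>\<exists>0 \<^bold>\<in> 3 \<^bold>\<and> inst [0, 1] 4 \<phi>))"
  have "Replacement \<phi> \<in> ZF" using *(1) by (auto simp: ZF_def in_language_def)
  then have "\<forall>v. sat (=) (\<epsilon>) v (forall_closure ?\<psi>)" using zf unfolding Replacement_def by blast
  then have "sat (=) (\<epsilon>) w ?\<psi>" unfolding sat_forall_closure by blast
  moreover have "sat (=) (\<epsilon>) (case_nat z (case_nat y (case_nat x w))) (inst [2, 1] 3 \<phi>) = R x y"
    "sat (=) (\<epsilon>) (case_nat z (case_nat y (case_nat x w))) (inst [2, 0] 3 \<phi>) = R x z"
    "sat (=) (\<epsilon>) (case_nat x (case_nat y (case_nat z (case_nat u w)))) (inst [0, 1] 4 \<phi>) = R x y" for x y z u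
    unfolding inst_def sat_rename *(2)
    by (rule arg_cong[of _ _ "\<lambda>v. sat (=) (\<epsilon>) v \<phi>"];
        auto simp: fun_eq_iff eval_nat_numeral less_Suc_eq split: nat.splits)+
  ultimately show ?thesis using assms(2) by (simp add: eval_nat_numeral) blast
qed

text \<open>Arbitrary if no such set exists.\<close>

definition setof :: "('a \<Rightarrow> bool) \<Rightarrow> 'a" where
  "setof P = (THE S. \<forall>x. x \<epsilon> S \<longleftrightarrow> P x)"

text \<open>Rewrites the graph of a set operation as a first-order condition. This is how the
  operations below are seen to be definable.\<close>

lemma eq_setof:
  assumes "\<exists>S. \<forall>x. x \<epsilon> S \<longleftrightarrow> P x"
  shows "y = setof P \<longleftrightarrow> (\<forall>x. x \<epsilon> y \<longleftrightarrow> P x)"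
proof -
  obtain S where S: "\<forall>x. x \<epsilon> S \<longleftrightarrow> P x" using assms by blast
  then have "setof P = S" unfolding setof_def
    by (intro the_equality) (auto intro: extensionality)
  with S show ?thesis by (auto intro: extensionality)
qed

lemma mem_setof: "\<exists>S. \<forall>x. x \<epsilon> S \<longleftrightarrow> P x \<Longrightarrow> x \<epsilon> setof P \<longleftrightarrow> P x"
  using eq_setof[of P "setof P"] by simp

definition "emp = setof (\<lambda>x. False)"
definition "upair a b = setof (\<lambda>x. x = a \<or> x = b)"
definition "Uni a = setof (\<lambda>x. \<exists>y. y \<epsilon> a \<and> x \<epsilon> y)"
definition "un a b = setof (\<lambda>x. x \<epsilon> a \<or> x \<epsilon> b)"
definition "suc a = setof (\<lambda>x. x \<epsilon> a \<or> x = a)"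
definition "opair a b = upair (upair a a) (upair a b)"

lemma mem_emp [simp]: "\<not> x \<epsilon> emp"
  using mem_setof[of "\<lambda>x. False"] separation[OF D_const[of False]] by (simp add: emp_def)

lemma mem_upair [simp]: "x \<epsilon> upair a b \<longleftrightarrow> x = a \<or> x = b"
  using mem_setof ex_upair by (simp add: upair_def)

lemma mem_Uni [simp]: "x \<epsilon> Uni a \<longleftrightarrow> (\<exists>y. y \<epsilon> a \<and> x \<epsilon> y)"
  using mem_setof[OF ex_Union] by (simp add: Uni_def)

lemma ex_un: "\<exists>u. \<forall>x. x \<epsilon> u \<longleftrightarrow> x \<epsilon> a \<or> x \<epsilon> b"
  by (rule exI[of _ "Uni (upair a b)"]) auto

lemma mem_un [simp]: "x \<epsilon> un a b \<longleftrightarrow> x \<epsilon> a \<or> x \<epsilon> b"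
  using mem_setof[OF ex_un] by (simp add: un_def)

lemma ex_suc: "\<exists>s. \<forall>x. x \<epsilon> s \<longleftrightarrow> x \<epsilon> a \<or> x = a"
  by (rule exI[of _ "un a (upair a a)"]) auto

lemma mem_suc [simp]: "x \<epsilon> suc a \<longleftrightarrow> x \<epsilon> a \<or> x = a"
  using mem_setof[OF ex_suc] by (simp add: suc_def)

lemma opair_inject [simp]: "opair a b = opair c d \<longleftrightarrow> a = c \<and> b = d"
proof
  assume "opair a b = opair c d"
  then have "upair a a = upair c c \<or> upair a a = upair c d"
    "upair a b = upair c c \<or> upair a b = upair c d"
    "upair c d = upair a a \<or> upair c d = upair a b"
    by (metis mem_upair opair_def)+
  then show "a = c \<and> b = d" by (metis mem_upair)
qed simp

lemma D_sub [def_intros]: "dfun F \<Longrightarrow> dfun G \<Longrightarrow> D (\<lambda>v. F v \<sqsubseteq> G v)"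
  by (rule D_comp2[where P = "(\<sqsubseteq>)"]) (unfold sub_def, intro def_intros)

lemma dfun_upair [def_intros]: "dfun F \<Longrightarrow> dfun G \<Longrightarrow> dfun (\<lambda>v. upair (F v) (G v))"
  by (rule dfun_comp2[where f = upair]) (unfold upair_def eq_setof[OF ex_upair], intro def_intros)

lemma dfun_Uni [def_intros]: "dfun F \<Longrightarrow> dfun (\<lambda>v. Uni (F v))"
  by (rule dfun_comp1[where f = Uni]) (unfold Uni_def eq_setof[OF ex_Union], intro def_intros)

lemma dfun_suc [def_intros]: "dfun F \<Longrightarrow> dfun (\<lambda>v. suc (F v))"
  by (rule dfun_comp1[where f = suc]) (unfold suc_def eq_setof[OF ex_suc], intro def_intros)

lemma dfun_opair [def_intros]: "dfun F \<Longrightarrow> dfun G \<Longrightarrow> dfun (\<lambda>v. opair (F v) (G v))"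
  unfolding opair_def by (intro def_intros)

lemma no_two_cycle: "x \<epsilon> y \<Longrightarrow> y \<epsilon> x \<Longrightarrow> False"
  using foundation[of x "upair x y"] by auto

lemma irrefl [simp]: "\<not> x \<epsilon> x"
  using no_two_cycle by blast

lemma suc_inject [simp]: "suc a = suc b \<longleftrightarrow> a = b"
  by (metis mem_suc no_two_cycle)

lemma suc_neq_emp [simp]: "suc a \<noteq> emp"
  by (metis mem_suc mem_emp)

subsection \<open>The natural numbers of the model\<close>

definition ind :: "'a \<Rightarrow> bool" where
  "ind I \<longleftrightarrow> emp \<epsilon> I \<and> (\<forall>y. y \<epsilon> I \<longrightarrow> suc y \<epsilon> I)"

definition "om = setof (\<lambda>x. \<forall>I. ind I \<longrightarrow> x \<epsilon> I)"

lemma sat_Inductive: "sat (=) (\<epsilon>) v (Inductive i) \<longleftrightarrow> ind (v i)"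
proof -
  have "(\<exists>x. x \<epsilon> v i \<and> (\<forall>z. \<not> z \<epsilon> x)) \<longleftrightarrow> emp \<epsilon> v i"
    using extensionality[of _ emp] by (metis mem_emp)
  moreover have "(\<exists>s. s \<epsilon> v i \<and> (\<forall>z. z \<epsilon> s \<longleftrightarrow> z \<epsilon> y \<or> z = y)) \<longleftrightarrow> suc y \<epsilon> v i" for y
    using extensionality[of _ "suc y"] by (metis mem_suc)
  ultimately show ?thesis
    by (simp add: Inductive_def ind_def Is_empty_def Is_succ_def eval_nat_numeral)
qed

lemma ex_om: "\<exists>S. \<forall>x. x \<epsilon> S \<longleftrightarrow> (\<forall>I. ind I \<longrightarrow> x \<epsilon> I)"
proof -
  obtain I where I: "ind I"
    using zf[of Infinity undefined] by (auto simp: ZF_def Infinity_def sat_Inductive)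
  have "\<exists>S. \<forall>x. x \<epsilon> S \<longleftrightarrow> x \<epsilon> I \<and> (\<forall>I. ind I \<longrightarrow> x \<epsilon> I)"
    by (rule separation) (unfold ind_def, intro def_intros)
  with I show ?thesis by blast
qed

lemma mem_om: "x \<epsilon> om \<longleftrightarrow> (\<forall>I. ind I \<longrightarrow> x \<epsilon> I)"
  using mem_setof[OF ex_om] by (simp add: om_def)

lemma sat_In_Nat: "sat (=) (\<epsilon>) v (In_Nat i) \<longleftrightarrow> v i \<epsilon> om"
  by (simp add: In_Nat_def sat_Inductive mem_om)

lemma emp_om [simp]: "emp \<epsilon> om" and suc_om [simp]: "n \<epsilon> om \<Longrightarrow> suc n \<epsilon> om"
  by (auto simp: mem_om ind_def)

text \<open>Only definable predicates admit induction: \<open>om\<close> may be ill-founded from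
  outside, and Separation gives sets for definable predicates only.\<close>

lemma om_induct:
  assumes "n \<epsilon> om" "D (\<lambda>v. P (v 0))" "P emp" "\<And>n. n \<epsilon> om \<Longrightarrow> P n \<Longrightarrow> P (suc n)"
  shows "P n"
proof -
  obtain S where S: "\<And>x. x \<epsilon> S \<longleftrightarrow> x \<epsilon> om \<and> P x" using separation[OF assms(2)] by blast
  have "ind S" unfolding ind_def using S assms(3,4) by auto
  then show ?thesis using assms(1) S by (auto simp: mem_om)
qed

lemma om_trans: "n \<epsilon> om \<Longrightarrow> m \<epsilon> n \<Longrightarrow> m \<epsilon> om"
proof -
  assume n: "n \<epsilon> om"
  have "\<forall>m. m \<epsilon> n \<longrightarrow> m \<epsilon> om"
    by (rule om_induct[OF n]) (intro def_intros, auto)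
  then show "m \<epsilon> n \<Longrightarrow> m \<epsilon> om" by blast
qed

lemma nat_trans: "n \<epsilon> om \<Longrightarrow> m \<epsilon> n \<Longrightarrow> k \<epsilon> m \<Longrightarrow> k \<epsilon> n"
proof -
  assume n: "n \<epsilon> om"
  have "\<forall>m k. m \<epsilon> n \<longrightarrow> k \<epsilon> m \<longrightarrow> k \<epsilon> n"
    by (rule om_induct[OF n]) (intro def_intros, auto)
  then show "m \<epsilon> n \<Longrightarrow> k \<epsilon> m \<Longrightarrow> k \<epsilon> n" by blast
qed

lemma suc_le: "m \<epsilon> om \<Longrightarrow> n \<epsilon> m \<Longrightarrow> suc n = m \<or> suc n \<epsilon> m"
proof -
  assume m: "m \<epsilon> om"
  have "n \<epsilon> m \<longrightarrow> suc n = m \<or> suc n \<epsilon> m"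
    by (rule om_induct[OF m]) (intro def_intros, auto)
  then show "n \<epsilon> m \<Longrightarrow> suc n = m \<or> suc n \<epsilon> m" by blast
qed

lemma emp_le: "n \<epsilon> om \<Longrightarrow> n = emp \<or> emp \<epsilon> n"
  by (erule om_induct) (intro def_intros, auto)

lemma trichotomy:
  assumes n: "n \<epsilon> om" and m: "m \<epsilon> om"
  shows "m \<epsilon> n \<or> m = n \<or> n \<epsilon> m"
proof -
  have "\<forall>m. m \<epsilon> om \<longrightarrow> m \<epsilon> n \<or> m = n \<or> n \<epsilon> m"
  proof (rule om_induct[OF n])
    show "D (\<lambda>v. \<forall>m. m \<epsilon> om \<longrightarrow> m \<epsilon> v 0 \<or> m = v 0 \<or> v 0 \<epsilon> m)" by (intro def_intros)
    show "\<forall>m. m \<epsilon> om \<longrightarrow> m \<epsilon> emp \<or> m = emp \<or> emp \<epsilon> m" using emp_le by blast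
    show "\<forall>m. m \<epsilon> om \<longrightarrow> m \<epsilon> suc n \<or> m = suc n \<or> suc n \<epsilon> m"
      if "\<forall>m. m \<epsilon> om \<longrightarrow> m \<epsilon> n \<or> m = n \<or> n \<epsilon> m" for n
      using that suc_le by (metis mem_suc)
  qed
  with m show ?thesis by blast
qed

text \<open>Below, \<open>n \<le> m\<close> is expressed as \<open>\<not> m \<epsilon> n\<close>.\<close>

lemma le_less_trans: "n \<epsilon> om \<Longrightarrow> m \<epsilon> om \<Longrightarrow> k \<epsilon> om \<Longrightarrow> \<not> m \<epsilon> n \<Longrightarrow> m \<epsilon> k \<Longrightarrow> n \<epsilon> k"
  using trichotomy nat_trans by blast

lemma ex_upper_bound:
  assumes "n \<epsilon> om" "m \<epsilon> om"
  obtains k where "k \<epsilon> om" "n \<sqsubseteq> k" "m \<sqsubseteq> k"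
  using assms trichotomy nat_trans unfolding sub_def by metis

subsection \<open>Transitive supersets\<close>

text \<open>\<open>iterates x n u\<close> says that \<open>u\<close> is the \<open>n\<close>-fold union of \<open>x\<close>. Since the first components descend
  to \<open>emp\<close>, the witness \<open>F\<close> need not be a function.\<close>

definition iterates :: "'a \<Rightarrow> 'a \<Rightarrow> 'a \<Rightarrow> bool" where
  "iterates x n u \<longleftrightarrow> (\<exists>F. opair n u \<epsilon> F \<and> (\<forall>p. p \<epsilon> F \<longrightarrow>
     p = opair emp x \<or> (\<exists>k v. opair k v \<epsilon> F \<and> p = opair (suc k) (Uni v))))"

lemma D_iterates [def_intros]:
  "dfun F \<Longrightarrow> dfun G \<Longrightarrow> dfun H \<Longrightarrow> D (\<lambda>v. iterates (F v) (G v) (H v))"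
  by (rule D_comp3[where P = iterates]) (unfold iterates_def, intro def_intros)

lemma iterates_emp: "iterates x emp u \<longleftrightarrow> u = x"
proof
  show "iterates x emp u \<Longrightarrow> u = x"
    unfolding iterates_def using suc_neq_emp by (metis opair_inject)
  show "u = x \<Longrightarrow> iterates x emp u"
    unfolding iterates_def by (intro exI[of _ "upair (opair emp x) (opair emp x)"]) simp
qed

lemma iterates_suc: "iterates x (suc n) u \<longleftrightarrow> (\<exists>w. iterates x n w \<and> u = Uni w)"
proof
  assume "iterates x (suc n) u"
  then obtain F where F: "opair (suc n) u \<epsilon> F"
    and *: "\<And>p. p \<epsilon> F \<Longrightarrow> p = opair emp x \<or> (\<exists>k v. opair k v \<epsilon> F \<and> p = opair (suc k) (Uni v))"
    unfolding iterates_def by blast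
  then obtain w where "opair n w \<epsilon> F" "u = Uni w" using *[OF F] by auto
  with * show "\<exists>w. iterates x n w \<and> u = Uni w" unfolding iterates_def by blast
next
  assume "\<exists>w. iterates x n w \<and> u = Uni w"
  then obtain w F where F: "opair n w \<epsilon> F" "u = Uni w"
    and *: "\<And>p. p \<epsilon> F \<Longrightarrow> p = opair emp x \<or> (\<exists>k v. opair k v \<epsilon> F \<and> p = opair (suc k) (Uni v))"
    unfolding iterates_def by blast
  let ?q = "opair (suc n) u"
  show "iterates x (suc n) u"
    unfolding iterates_def
    by (rule exI[of _ "un F (upair ?q ?q)"]) (use F * in auto)
qed

lemma iterates_unique:
  assumes "n \<epsilon> om" "iterates x n u" "iterates x n u'"
  shows "u = u'"
proof -
  have "\<forall>u u'. iterates x n u \<longrightarrow> iterates x n u' \<longrightarrow> u = u'"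
    by (rule om_induct[OF assms(1)]) (intro def_intros, auto simp: iterates_emp iterates_suc)
  with assms show ?thesis by blast
qed

text \<open>The union of all \<open>n\<close>-fold unions of \<open>x\<close>. Inside such a set,
  Foundation amounts to \<epsilon>-induction for a definable class, as used in
  \<open>sub_level\<close>.\<close>

lemma ex_transitive_superset:
  "\<exists>T. x \<sqsubseteq> T \<and> (\<forall>y z. y \<epsilon> T \<longrightarrow> z \<epsilon> y \<longrightarrow> z \<epsilon> T)"
proof -
  \<comment> \<open>The condition \<open>n \<epsilon> om\<close> is repeated inside the relation
    because \<open>replacement\<close> demands functionality at all arguments, and iterates are
    known to be unique only for natural numbers.\<close>
  have "\<exists>B. \<forall>u. u \<epsilon> B \<longleftrightarrow> (\<exists>n. n \<epsilon> om \<and> (n \<epsilon> om \<and> iterates x n u))"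
    by (rule replacement) (intro def_intros, use iterates_unique in blast)
  then obtain B where B: "\<And>u. u \<epsilon> B \<longleftrightarrow> (\<exists>n. n \<epsilon> om \<and> iterates x n u)" by blast
  show ?thesis
  proof (intro exI[of _ "Uni B"] conjI allI impI)
    have "x \<epsilon> B" using B iterates_emp emp_om by blast
    then show "x \<sqsubseteq> Uni B" unfolding sub_def by auto
    show "z \<epsilon> Uni B" if yz: "y \<epsilon> Uni B" "z \<epsilon> y" for y z
    proof -
      obtain u n where u: "y \<epsilon> u" "n \<epsilon> om" "iterates x n u" using yz(1) B by auto
      then have "Uni u \<epsilon> B" using B iterates_suc suc_om by blast
      moreover have "z \<epsilon> Uni u" using u(1) yz(2) by auto
      ultimately show ?thesis by (subst mem_Uni) blast
    qed
  qed
qed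

subsection \<open>Levels of the cumulative hierarchy\<close>

text \<open>Histories and levels follow Scott, Montague and Potter in the form due to Button; they replace
  ordinals and the recursive definition of ranks.\<close>

definition history :: "'a \<Rightarrow> bool" where
  "history h \<longleftrightarrow> (\<forall>x. x \<epsilon> h \<longrightarrow> (\<forall>y. y \<epsilon> x \<longleftrightarrow> (\<exists>c. c \<epsilon> x \<and> c \<epsilon> h \<and> y \<sqsubseteq> c)))"

text \<open>A history plays the part of the set of earlier levels. A level gathers the subsets of
  its members, just as V_alpha is the union of the power sets of the V_beta with beta below
  alpha.\<close>

definition level :: "'a \<Rightarrow> bool" where
  "level s \<longleftrightarrow> (\<exists>h. history h \<and> (\<forall>y. y \<epsilon> s \<longleftrightarrow> (\<exists>c. c \<epsilon> h \<and> y \<sqsubseteq> c)))"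

lemma D_level [def_intros]: "dfun F \<Longrightarrow> D (\<lambda>v. level (F v))"
  by (rule D_comp1[where P = level]) (unfold level_def history_def, intro def_intros)

lemma sub_refl [simp]: "x \<sqsubseteq> x" and sub_trans: "x \<sqsubseteq> y \<Longrightarrow> y \<sqsubseteq> z \<Longrightarrow> x \<sqsubseteq> z"
  by (auto simp: sub_def)

lemma level_sub: "level s \<Longrightarrow> c \<epsilon> s \<Longrightarrow> x \<sqsubseteq> c \<Longrightarrow> x \<epsilon> s"
  unfolding level_def using sub_trans by blast

lemma level_trans:
  assumes "level s" "c \<epsilon> s" "x \<epsilon> c"
  shows "x \<epsilon> s"
proof -
  obtain h where h: "history h" "\<And>y. y \<epsilon> s \<longleftrightarrow> (\<exists>c. c \<epsilon> h \<and> y \<sqsubseteq> c)"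
    using assms(1) unfolding level_def by blast
  then obtain d where d: "d \<epsilon> h" "c \<sqsubseteq> d" using assms(2) by blast
  then have "x \<epsilon> d" using assms(3) by (simp add: sub_def)
  then obtain e where "e \<epsilon> h" "x \<sqsubseteq> e" using h(1) d(1) unfolding history_def by blast
  then show ?thesis using h(2) by blast
qed

text \<open>Take an \<epsilon>-minimal nontransitive \<open>d\<close> in \<open>h\<close>. The set
  \<open>x\<close> is included in some \<open>e\<close> in both \<open>d\<close> and
  \<open>h\<close>, which is transitive by minimality; so \<open>y\<close> is a subset of
  \<open>e\<close> and hence a member of \<open>d\<close>.\<close>

lemma history_trans:
  assumes h: "history h" and "d \<epsilon> h" "x \<epsilon> d" "y \<epsilon> x"
  shows "y \<epsilon> d"
proof (rule ccontr)
  assume "\<not> y \<epsilon> d"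
  have "\<exists>S. \<forall>d. d \<epsilon> S \<longleftrightarrow> d \<epsilon> h \<and> (\<exists>x y. x \<epsilon> d \<and> y \<epsilon> x \<and> \<not> y \<epsilon> d)"
    by (rule separation) (intro def_intros)
  then obtain S where S: "\<And>d. d \<epsilon> S \<longleftrightarrow> d \<epsilon> h \<and> (\<exists>x y. x \<epsilon> d \<and> y \<epsilon> x \<and> \<not> y \<epsilon> d)" by blast
  then have "d \<epsilon> S" using assms \<open>\<not> y \<epsilon> d\<close> by blast
  then obtain d where d: "d \<epsilon> S" "\<And>z. z \<epsilon> S \<Longrightarrow> \<not> z \<epsilon> d" using foundation by blast
  then obtain x y where xy: "d \<epsilon> h" "x \<epsilon> d" "y \<epsilon> x" "\<not> y \<epsilon> d" using S by blast
  then obtain e where e: "e \<epsilon> d" "e \<epsilon> h" "x \<sqsubseteq> e" using h unfolding history_def by blast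
  then have "y \<epsilon> e" using xy(3) by (simp add: sub_def)
  moreover have "\<not> e \<epsilon> S" using d(2) e(1) by blast
  ultimately have "y \<sqsubseteq> e" using S e(2) unfolding sub_def by blast
  then show False using h xy(1,4) e(1,2) unfolding history_def by blast
qed

text \<open>The part of \<open>h\<close> inside \<open>d\<close> is itself a history, because
  \<open>d\<close> is transitive, and it generates \<open>d\<close>.\<close>

lemma history_level:
  assumes h: "history h" and d: "d \<epsilon> h"
  shows "level d"
proof -
  have "\<exists>g. \<forall>x. x \<epsilon> g \<longleftrightarrow> x \<epsilon> d \<and> x \<epsilon> h" by (rule separation) (intro def_intros)
  then obtain g where g: "\<And>x. x \<epsilon> g \<longleftrightarrow> x \<epsilon> d \<and> x \<epsilon> h" by blast
  have "history g"
    unfolding history_def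
  proof (intro allI impI)
    fix x y assume x: "x \<epsilon> g"
    have "y \<epsilon> x \<longleftrightarrow> (\<exists>c. c \<epsilon> x \<and> c \<epsilon> h \<and> y \<sqsubseteq> c)" using h x g unfolding history_def by blast
    also have "\<dots> \<longleftrightarrow> (\<exists>c. c \<epsilon> x \<and> c \<epsilon> g \<and> y \<sqsubseteq> c)"
      using history_trans[OF h d] x g by blast
    finally show "y \<epsilon> x \<longleftrightarrow> (\<exists>c. c \<epsilon> x \<and> c \<epsilon> g \<and> y \<sqsubseteq> c)" .
  qed
  moreover have "y \<epsilon> d \<longleftrightarrow> (\<exists>c. c \<epsilon> g \<and> y \<sqsubseteq> c)" for y
    using h d g unfolding history_def by blast
  ultimately show ?thesis unfolding level_def by blast
qed

text \<open>A level is thus determined by the levels that belong to it, which is the key to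
  \<open>level_linear\<close>.\<close>

lemma mem_level_iff: "level s \<Longrightarrow> y \<epsilon> s \<longleftrightarrow> (\<exists>r. r \<epsilon> s \<and> level r \<and> y \<sqsubseteq> r)"
proof
  assume s: "level s"
  then obtain h where h: "history h" "\<And>y. y \<epsilon> s \<longleftrightarrow> (\<exists>c. c \<epsilon> h \<and> y \<sqsubseteq> c)"
    unfolding level_def by blast
  assume "y \<epsilon> s"
  then obtain c where c: "c \<epsilon> h" "y \<sqsubseteq> c" using h(2) by blast
  moreover have "level c" "c \<epsilon> s" using c(1) h history_level sub_refl by blast+
  ultimately show "\<exists>r. r \<epsilon> s \<and> level r \<and> y \<sqsubseteq> r" by blast
qed (auto intro: level_sub)

section \<open>Linearity of the levels, ranks and Collection\<close>

definition is_least_level :: "('a \<Rightarrow> bool) \<Rightarrow> 'a \<Rightarrow> bool" where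
  "is_least_level P s \<longleftrightarrow> level s \<and> P s \<and> (\<forall>q. q \<epsilon> s \<longrightarrow> level q \<longrightarrow> \<not> P q)"

lemma D_is_least_level [def_intros]:
  assumes "D (\<lambda>v. P (\<lambda>n. v (Suc n)) (v 0))" "dfun G"
  shows "D (\<lambda>v. is_least_level (P v) (G v))"
  unfolding is_least_level_def
  by (intro def_intros D_let[OF assms] assms dfun_reindex[OF assms(2)])

text \<open>Substitute for induction on ordinals. Inside the level \<open>s\<close> the candidates
  form a set; Foundation gives a minimal one, and transitivity of \<open>s\<close> keeps every
  smaller level among the candidates.\<close>

lemma ex_least_level:
  assumes "D (\<lambda>v. P (v 0))" "level s" "P s"
  shows "\<exists>r. is_least_level P r"
proof (cases "\<exists>r. r \<epsilon> s \<and> level r \<and> P r")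
  case True
  have "\<exists>S. \<forall>r. r \<epsilon> S \<longleftrightarrow> r \<epsilon> s \<and> (level r \<and> P r)"
    by (rule separation) (intro def_intros assms(1))
  then obtain S where S: "\<And>r. r \<epsilon> S \<longleftrightarrow> r \<epsilon> s \<and> level r \<and> P r" by blast
  then obtain r where r: "r \<epsilon> S" "\<And>z. z \<epsilon> S \<Longrightarrow> \<not> z \<epsilon> r" using True foundation by blast
  then have "is_least_level P r"
    unfolding is_least_level_def using S level_trans[OF assms(2)] by blast
  then show ?thesis ..
next
  case False
  then have "is_least_level P s" unfolding is_least_level_def using assms(2,3) by blast
  then show ?thesis ..
qed

text \<open>Let \<open>s\<close> be least among levels not comparable with all others, and
  \<open>t\<close> least among those incomparable with \<open>s\<close>. Minimality makes the same
  levels belong to both, so they are equal by \<open>mem_level_iff\<close>.\<close>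

lemma level_linear:
  assumes "level s" "level t"
  shows "s \<epsilon> t \<or> s = t \<or> t \<epsilon> s"
proof (rule ccontr)
  let ?C = "\<lambda>s t. s \<epsilon> t \<or> s = t \<or> t \<epsilon> s"
  let ?P = "\<lambda>s. \<exists>t. level t \<and> \<not> ?C s t"
  assume "\<not> ?C s t"
  then have "?P s" using assms(2) by blast
  moreover have "D (\<lambda>v. ?P (v 0))" by (intro def_intros)
  ultimately obtain s where "is_least_level ?P s"
    using ex_least_level[of ?P, OF _ assms(1)] by blast
  then have s: "level s" "?P s" "\<And>r. r \<epsilon> s \<Longrightarrow> level r \<Longrightarrow> \<not> ?P r"
    unfolding is_least_level_def by blast+
  have "D (\<lambda>v. \<not> ?C s (v 0))" by (intro def_intros)
  then obtain t where "is_least_level (\<lambda>t. \<not> ?C s t) t"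
    using ex_least_level[of "\<lambda>t. \<not> ?C s t"] s(2) by blast
  then have t: "level t" "\<not> ?C s t" "\<And>r. r \<epsilon> t \<Longrightarrow> level r \<Longrightarrow> ?C s r"
    unfolding is_least_level_def by blast+
  have "r \<epsilon> s \<longleftrightarrow> r \<epsilon> t" if "level r" for r
  proof
    assume r: "r \<epsilon> s"
    then have "?C r t" using s(3)[OF r that] t(1) by blast
    then show "r \<epsilon> t" using level_trans[OF s(1) r] r t(2) by blast
  next
    assume r: "r \<epsilon> t"
    then show "r \<epsilon> s" using t(3)[OF r that] level_trans[OF t(1) r] t(2) by blast
  qed
  then have "s = t" using mem_level_iff[OF s(1)] mem_level_iff[OF t(1)] by (intro extensionality) blast
  then show False using t(2) by blast
qed

lemma is_least_level_unique: "is_least_level P s \<Longrightarrow> is_least_level P t \<Longrightarrow> s = t"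
  unfolding is_least_level_def using level_linear by blast

text \<open>In an \<epsilon>-minimal counterexample \<open>z\<close> each member has a least level
  including it. Replacement collects these levels, and the level above them contains every member of
  \<open>z\<close>.\<close>

lemma sub_level: "\<exists>s. level s \<and> x \<sqsubseteq> s"
proof (rule ccontr)
  let ?G = "\<lambda>x. \<exists>s. level s \<and> x \<sqsubseteq> s"
  assume x: "\<not> ?G x"
  \<comment> \<open>Starting from the singleton puts \<open>x\<close> itself into
    \<open>T\<close>.\<close>
  obtain T where T: "upair x x \<sqsubseteq> T" "\<And>y z. y \<epsilon> T \<Longrightarrow> z \<epsilon> y \<Longrightarrow> z \<epsilon> T"
    using ex_transitive_superset[of "upair x x"] by blast
  have "\<exists>S. \<forall>z. z \<epsilon> S \<longleftrightarrow> z \<epsilon> T \<and> \<not> ?G z" by (rule separation) (intro def_intros)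
  then obtain S where S: "\<And>z. z \<epsilon> S \<longleftrightarrow> z \<epsilon> T \<and> \<not> ?G z" by blast
  have "x \<epsilon> S" using S T(1) x by (simp add: sub_def)
  then obtain z where z: "z \<epsilon> S" "\<And>w. w \<epsilon> S \<Longrightarrow> \<not> w \<epsilon> z" using foundation by blast
  have G: "?G w" if "w \<epsilon> z" for w using that z S T(2) by blast
  have "\<exists>B. \<forall>s. s \<epsilon> B \<longleftrightarrow> (\<exists>w. w \<epsilon> z \<and> is_least_level (\<lambda>s. w \<sqsubseteq> s) s)"
    by (rule replacement) (intro def_intros, rule is_least_level_unique)
  then obtain B where B: "\<And>s. s \<epsilon> B \<longleftrightarrow> (\<exists>w. w \<epsilon> z \<and> is_least_level (\<lambda>s. w \<sqsubseteq> s) s)" by blast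
  \<comment> \<open>Adding all levels below those in \<open>B\<close> is what makes the collection a
    history.\<close>
  have "\<exists>h. \<forall>r. r \<epsilon> h \<longleftrightarrow> r \<epsilon> un (Uni B) B \<and> level r" by (rule separation) (intro def_intros)
  then obtain h where h': "\<And>r. r \<epsilon> h \<longleftrightarrow> r \<epsilon> un (Uni B) B \<and> level r" by blast
  have h: "r \<epsilon> h \<longleftrightarrow> (\<exists>b. b \<epsilon> B \<and> (r \<epsilon> b \<or> r = b)) \<and> level r" for r
    unfolding h' mem_un mem_Uni by blast
  have down: "c \<epsilon> h" if r: "r \<epsilon> h" and c: "c \<epsilon> r" "level c" for r c
  proof -
    obtain b where b: "b \<epsilon> B" "r \<epsilon> b \<or> r = b" using r h by blast
    then have "level b" using B unfolding is_least_level_def by blast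
    then have "c \<epsilon> b" using b(2) c(1) level_trans by blast
    then show ?thesis using b(1) c(2) h by blast
  qed
  have hist: "history h"
    unfolding history_def
  proof (intro allI impI)
    fix r y assume r: "r \<epsilon> h"
    then have "level r" using h by blast
    from mem_level_iff[OF this] show "y \<epsilon> r \<longleftrightarrow> (\<exists>c. c \<epsilon> r \<and> c \<epsilon> h \<and> y \<sqsubseteq> c)"
      using down[OF r] h by blast
  qed
  have "\<exists>t. \<forall>y. y \<epsilon> t \<longleftrightarrow> (\<exists>c. c \<epsilon> h \<and> y \<sqsubseteq> c)"
  proof -
    obtain p where "\<And>w. w \<epsilon> p \<longleftrightarrow> w \<sqsubseteq> Uni h" using ex_Pow by blast
    moreover have "y \<sqsubseteq> Uni h" if "c \<epsilon> h" "y \<sqsubseteq> c" for c y using that by (auto simp: sub_def)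
    moreover have "\<exists>t. \<forall>y. y \<epsilon> t \<longleftrightarrow> y \<epsilon> p \<and> (\<exists>c. c \<epsilon> h \<and> y \<sqsubseteq> c)"
      by (rule separation) (intro def_intros)
    ultimately show ?thesis by blast
  qed
  then obtain t where t: "\<And>y. y \<epsilon> t \<longleftrightarrow> (\<exists>c. c \<epsilon> h \<and> y \<sqsubseteq> c)" by blast
  have "level t" using hist t unfolding level_def by blast
  moreover have "w \<epsilon> t" if w: "w \<epsilon> z" for w
  proof -
    obtain s where "level s" "w \<sqsubseteq> s" using G[OF w] by blast
    moreover have "D (\<lambda>v. w \<sqsubseteq> v 0)" by (intro def_intros)
    ultimately obtain r where r: "is_least_level (\<lambda>s. w \<sqsubseteq> s) r"
      using ex_least_level[of "\<lambda>s. w \<sqsubseteq> s" s] by blast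
    then have "r \<epsilon> h" "w \<sqsubseteq> r" using B h w unfolding is_least_level_def by blast+
    then show ?thesis using t by blast
  qed
  ultimately have "?G z" unfolding sub_def by blast
  then show False using z(1) S by blast
qed

text \<open>Scott's trick: the least level that includes some witness is unique, so Replacement
  applies to it. The power set of the union of these levels then contains a witness for each
  \<open>x\<close> in \<open>A\<close>.\<close>

lemma collection:
  assumes R: "D (\<lambda>v. R (v 0) (v 1))" and ex: "\<And>x. x \<epsilon> A \<Longrightarrow> \<exists>y. R x y"
  shows "\<exists>C. \<forall>x. x \<epsilon> A \<longrightarrow> (\<exists>y. y \<epsilon> C \<and> R x y)"
proof -
  let ?P = "\<lambda>x s. \<exists>y. y \<sqsubseteq> s \<and> R x y"
  have R': "D (\<lambda>v. R (F v) (G v))" if "dfun F" "dfun G" for F G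
    using D_comp2[OF R that] .
  have "\<exists>B. \<forall>s. s \<epsilon> B \<longleftrightarrow> (\<exists>x. x \<epsilon> A \<and> is_least_level (?P x) s)"
    by (rule replacement) (intro def_intros R', erule (1) is_least_level_unique)
  then obtain B where B: "\<And>s. s \<epsilon> B \<longleftrightarrow> (\<exists>x. x \<epsilon> A \<and> is_least_level (?P x) s)" by blast
  obtain C where C: "\<And>w. w \<epsilon> C \<longleftrightarrow> w \<sqsubseteq> Uni B" using ex_Pow by blast
  show ?thesis
  proof (rule exI[of _ C], intro allI impI)
    fix x assume x: "x \<epsilon> A"
    then obtain y s where "R x y" "level s" "y \<sqsubseteq> s" using ex sub_level by blast
    moreover have "D (\<lambda>v. ?P x (v 0))" by (intro def_intros R')
    ultimately obtain r where r: "is_least_level (?P x) r"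
      using ex_least_level[of "?P x" s] by blast
    then have "r \<epsilon> B" using B x by blast
    moreover obtain y where "y \<sqsubseteq> r" "R x y" using r by (auto simp: is_least_level_def)
    ultimately have "y \<epsilon> C" "R x y" using C by (auto simp: sub_def)
    then show "\<exists>y. y \<epsilon> C \<and> R x y" by blast
  qed
qed

subsection \<open>Pairs and functions\<close>

text \<open>Defaults make projections and application total, so they are definable functions on the
  whole model, and any element can serve as a name.\<close>

definition "fst' p = (if \<exists>a b. p = opair a b then THE a. \<exists>b. p = opair a b else emp)"
definition "snd' p = (if \<exists>a b. p = opair a b then THE b. \<exists>a. p = opair a b else emp)"
definition "app f x = (if \<exists>!y. opair x y \<epsilon> f then THE y. opair x y \<epsilon> f else emp)"
definition "lam X F = setof (\<lambda>p. \<exists>x. x \<epsilon> X \<and> p = opair x (F x))"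

lemma fst'_opair [simp]: "fst' (opair a b) = a" and snd'_opair [simp]: "snd' (opair a b) = b"
  by (auto simp: fst'_def snd'_def)

lemma ex_lam:
  assumes "dfun (\<lambda>v. F (v 0))"
  shows "\<exists>S. \<forall>p. p \<epsilon> S \<longleftrightarrow> (\<exists>x. x \<epsilon> X \<and> p = opair x (F x))"
  by (rule replacement) (intro def_intros assms, auto)

lemma app_lam [simp]:
  assumes "dfun (\<lambda>v. F (v 0))" "x \<epsilon> X"
  shows "app (lam X F) x = F x"
proof -
  have "opair x y \<epsilon> lam X F \<longleftrightarrow> y = F x" for y
    using assms(2) by (auto simp: lam_def mem_setof[OF ex_lam[OF assms(1)]])
  then show ?thesis by (simp add: app_def)
qed

lemma dfun_fst' [def_intros]: "dfun F \<Longrightarrow> dfun (\<lambda>v. fst' (F v))"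
proof (rule dfun_comp1[where f = fst'])
  have "y = fst' p \<longleftrightarrow> (\<exists>b. p = opair y b) \<or> (\<not> (\<exists>a b. p = opair a b) \<and> y = emp)" for y p
    by (auto simp: fst'_def)
  then show "D (\<lambda>v. v 0 = fst' (v 1))" by (simp only:) (intro def_intros)
qed

lemma dfun_snd' [def_intros]: "dfun F \<Longrightarrow> dfun (\<lambda>v. snd' (F v))"
proof (rule dfun_comp1[where f = snd'])
  have "y = snd' p \<longleftrightarrow> (\<exists>a. p = opair a y) \<or> (\<not> (\<exists>a b. p = opair a b) \<and> y = emp)" for y p
    by (auto simp: snd'_def)
  then show "D (\<lambda>v. v 0 = snd' (v 1))" by (simp only:) (intro def_intros)
qed

lemma dfun_app [def_intros]: "dfun F \<Longrightarrow> dfun G \<Longrightarrow> dfun (\<lambda>v. app (F v) (G v))"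
proof (rule dfun_comp2[where f = app])
  have "y = app f x \<longleftrightarrow> (opair x y \<epsilon> f \<and> (\<forall>z. opair x z \<epsilon> f \<longrightarrow> z = y)) \<or>
      (\<not> (\<exists>w. opair x w \<epsilon> f \<and> (\<forall>z. opair x z \<epsilon> f \<longrightarrow> z = w)) \<and> y = emp)" for y f x
  proof (cases "\<exists>!w. opair x w \<epsilon> f")
    case True
    then obtain w where w: "opair x w \<epsilon> f" "\<And>z. opair x z \<epsilon> f \<Longrightarrow> z = w" by blast
    have "(THE y. opair x y \<epsilon> f) = w" using w by (intro the_equality)
    then have "app f x = w" using True by (simp only: app_def if_True)
    then show ?thesis using w by metis
  next
    case False
    then have "app f x = emp" unfolding app_def by (rule if_not_P)
    moreover have "\<not> (opair x y \<epsilon> f \<and> (\<forall>z. opair x z \<epsilon> f \<longrightarrow> z = y))" for y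
      using False by blast
    ultimately show ?thesis by metis
  qed
  then show "D (\<lambda>v. v 0 = app (v 1) (v 2))" by (simp only:) (intro def_intros)
qed

definition "comp_on f h Y = lam Y (\<lambda>y. app f (app h y))"

lemma app_comp_on [simp]: "y \<epsilon> Y \<Longrightarrow> app (comp_on f h Y) y = app f (app h y)"
  unfolding comp_on_def by (intro app_lam) (intro def_intros)

lemma dfun_comp_on [def_intros]:
  "dfun F \<Longrightarrow> dfun G \<Longrightarrow> dfun H \<Longrightarrow> dfun (\<lambda>v. comp_on (F v) (G v) (H v))"
proof (rule dfun_comp3[where f = comp_on])
  have "\<exists>S. \<forall>p. p \<epsilon> S \<longleftrightarrow> (\<exists>x. x \<epsilon> Y \<and> p = opair x (app f (app h x)))" for f h Y
    by (rule ex_lam) (intro def_intros)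
  then show "D (\<lambda>v. v 0 = comp_on (v 1) (v 2) (v 3))"
    unfolding comp_on_def lam_def by (subst eq_setof) (blast, intro def_intros)
qed

section \<open>Forcing\<close>

subsection \<open>Stages and their morphisms\<close>

text \<open>The index of a point is its first component, so a stage needs no data besides the
  set.\<close>

definition stage :: "'a \<Rightarrow> bool" where
  "stage X \<longleftrightarrow> (\<forall>x. x \<epsilon> X \<longrightarrow> fst' x \<epsilon> om) \<and> (\<forall>n. n \<epsilon> om \<longrightarrow> (\<exists>x. x \<epsilon> X \<and> \<not> fst' x \<epsilon> n))"

text \<open>The second clause is what lets \<open>aa\<close> survive pulling back. Surjectivity is
  not demanded, so passing to an unbounded subset is a refinement too.\<close>

definition mor :: "'a \<Rightarrow> 'a \<Rightarrow> 'a \<Rightarrow> bool" where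
  "mor h Y X \<longleftrightarrow> (\<forall>y. y \<epsilon> Y \<longrightarrow> app h y \<epsilon> X) \<and>
     (\<forall>n. n \<epsilon> om \<longrightarrow> (\<exists>m. m \<epsilon> om \<and> (\<forall>y. y \<epsilon> Y \<longrightarrow> fst' (app h y) \<epsilon> n \<longrightarrow> fst' y \<epsilon> m)))"

text \<open>Almost all of \<open>X\<close> means all but a set of bounded index.\<close>

definition aa :: "'a \<Rightarrow> ('a \<Rightarrow> bool) \<Rightarrow> bool" where
  "aa X P \<longleftrightarrow> (\<exists>n. n \<epsilon> om \<and> (\<forall>x. x \<epsilon> X \<longrightarrow> \<not> fst' x \<epsilon> n \<longrightarrow> P x))"

lemma D_stage [def_intros]: "dfun F \<Longrightarrow> D (\<lambda>v. stage (F v))"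
  by (rule D_comp1[where P = stage]) (unfold stage_def, intro def_intros)

lemma D_mor [def_intros]: "dfun F \<Longrightarrow> dfun G \<Longrightarrow> dfun H \<Longrightarrow> D (\<lambda>v. mor (F v) (G v) (H v))"
  by (rule D_comp3[where P = mor]) (unfold mor_def, intro def_intros)

lemma aa_mono: "aa X P \<Longrightarrow> (\<And>x. x \<epsilon> X \<Longrightarrow> P x \<Longrightarrow> Q x) \<Longrightarrow> aa X Q"
  unfolding aa_def by blast

lemma aa_all: "(\<And>x. x \<epsilon> X \<Longrightarrow> P x) \<Longrightarrow> aa X P"
  unfolding aa_def using emp_om by blast

lemma aa_conj: "aa X P \<Longrightarrow> aa X Q \<Longrightarrow> aa X (\<lambda>x. P x \<and> Q x)"
proof -
  assume "aa X P" "aa X Q"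
  then obtain n m where n: "n \<epsilon> om" "\<And>x. x \<epsilon> X \<Longrightarrow> \<not> fst' x \<epsilon> n \<Longrightarrow> P x"
    and m: "m \<epsilon> om" "\<And>x. x \<epsilon> X \<Longrightarrow> \<not> fst' x \<epsilon> m \<Longrightarrow> Q x"
    unfolding aa_def by blast
  obtain k where "k \<epsilon> om" "n \<sqsubseteq> k" "m \<sqsubseteq> k" using ex_upper_bound[OF n(1) m(1)] .
  with n(2) m(2) show ?thesis unfolding aa_def sub_def by blast
qed

lemma aa_cong: "aa X (\<lambda>x. P x \<longleftrightarrow> Q x) \<Longrightarrow> aa X P \<longleftrightarrow> aa X Q"
  using aa_conj[of X "\<lambda>x. P x \<longleftrightarrow> Q x"] aa_mono[of X _ P] aa_mono[of X _ Q] by blast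

lemma aa_ex: "stage X \<Longrightarrow> aa X P \<Longrightarrow> \<exists>x. x \<epsilon> X \<and> P x"
  unfolding aa_def stage_def by blast

lemma aa_const [simp]: "stage X \<Longrightarrow> aa X (\<lambda>x. b) \<longleftrightarrow> b"
  using aa_ex[of X "\<lambda>x. b"] aa_all[of X "\<lambda>x. b"] by blast

lemma not_aaD: "\<not> aa X P \<Longrightarrow> n \<epsilon> om \<Longrightarrow> \<exists>x. x \<epsilon> X \<and> \<not> fst' x \<epsilon> n \<and> \<not> P x"
  unfolding aa_def by blast

lemma aa_mor: "mor h Y X \<Longrightarrow> aa X P \<Longrightarrow> aa Y (\<lambda>y. P (app h y))"
proof -
  assume h: "mor h Y X" and "aa X P"
  then obtain n where n: "n \<epsilon> om" "\<And>x. x \<epsilon> X \<Longrightarrow> \<not> fst' x \<epsilon> n \<Longrightarrow> P x"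
    unfolding aa_def by blast
  then obtain m where "m \<epsilon> om" "\<And>y. y \<epsilon> Y \<Longrightarrow> fst' (app h y) \<epsilon> n \<Longrightarrow> fst' y \<epsilon> m"
    using h unfolding mor_def by blast
  then show ?thesis using h n(2) unfolding aa_def mor_def by blast
qed

lemma morD: "mor h Y X \<Longrightarrow> y \<epsilon> Y \<Longrightarrow> app h y \<epsilon> X"
  unfolding mor_def by blast

lemma mor_comp: "mor h Y X \<Longrightarrow> mor g Z Y \<Longrightarrow> mor (comp_on h g Z) Z X"
proof -
  assume h: "mor h Y X" and g: "mor g Z Y"
  have "\<exists>k. k \<epsilon> om \<and> (\<forall>z. z \<epsilon> Z \<longrightarrow> fst' (app h (app g z)) \<epsilon> n \<longrightarrow> fst' z \<epsilon> k)" if n: "n \<epsilon> om" for n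
  proof -
    obtain m where m: "m \<epsilon> om" "\<And>y. y \<epsilon> Y \<Longrightarrow> fst' (app h y) \<epsilon> n \<Longrightarrow> fst' y \<epsilon> m"
      using h n unfolding mor_def by blast
    then obtain k where "k \<epsilon> om" "\<And>z. z \<epsilon> Z \<Longrightarrow> fst' (app g z) \<epsilon> m \<Longrightarrow> fst' z \<epsilon> k"
      using g unfolding mor_def by blast
    then show ?thesis using m(2) morD[OF g] by blast
  qed
  then show ?thesis unfolding mor_def using morD[OF g] morD[OF h] by simp
qed

text \<open>The hypothesis says that the image has at least the index of the point; a bound on image
  indices then bounds the preimage as well.\<close>

lemma mor_lam:
  assumes F: "dfun (\<lambda>v. F (v 0))" and "stage Z" "stage X"
    and le: "\<And>z. z \<epsilon> Z \<Longrightarrow> F z \<epsilon> X \<and> \<not> fst' (F z) \<epsilon> fst' z"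
  shows "mor (lam Z F) Z X"
proof -
  have "fst' z \<epsilon> n" if "z \<epsilon> Z" "fst' (F z) \<epsilon> n" "n \<epsilon> om" for z n
    using le_less_trans[of "fst' z" "fst' (F z)" n] assms(2,3) le[OF that(1)] that
    unfolding stage_def by blast
  then show ?thesis unfolding mor_def using le by (auto simp: F)
qed

definition "idf X = lam X (\<lambda>x. x)"

lemma app_idf [simp]: "x \<epsilon> X \<Longrightarrow> app (idf X) x = x"
  unfolding idf_def by (intro app_lam) (intro def_intros)

lemma mor_idf_sub: "stage X \<Longrightarrow> stage Y \<Longrightarrow> Y \<sqsubseteq> X \<Longrightarrow> mor (idf Y) Y X"
  unfolding idf_def by (rule mor_lam) (intro def_intros, auto simp: sub_def)

lemma mor_idf: "stage X \<Longrightarrow> mor (idf X) X X"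
  by (rule mor_idf_sub) auto

text \<open>Replaces a choice of one \<open>u\<close> for each \<open>n\<close>: Collection yields a
  set holding some suitable pair for every \<open>n\<close>, and all suitable pairs in it are
  kept.\<close>

lemma ex_stage:
  assumes Q: "D (\<lambda>v. Q (v 0) (v 1))" and ex: "\<And>n. n \<epsilon> om \<Longrightarrow> \<exists>u. Q n u"
  shows "\<exists>Z. stage Z \<and> (\<forall>z. z \<epsilon> Z \<longrightarrow> Q (fst' z) (snd' z))"
proof -
  have Q': "D (\<lambda>v. Q (F v) (G v))" if "dfun F" "dfun G" for F G
    using D_comp2[OF Q that] .
  have "\<exists>C. \<forall>n. n \<epsilon> om \<longrightarrow> (\<exists>z. z \<epsilon> C \<and> (\<exists>u. z = opair n u \<and> Q n u))"
    by (rule collection) (intro def_intros Q', use ex in blast)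
  then obtain C where C: "\<And>n. n \<epsilon> om \<Longrightarrow> \<exists>u. opair n u \<epsilon> C \<and> Q n u" by blast
  have "\<exists>Z. \<forall>z. z \<epsilon> Z \<longleftrightarrow> z \<epsilon> C \<and> (fst' z \<epsilon> om \<and> Q (fst' z) (snd' z))"
    by (rule separation) (intro def_intros Q')
  then obtain Z where Z: "\<And>z. z \<epsilon> Z \<longleftrightarrow> z \<epsilon> C \<and> fst' z \<epsilon> om \<and> Q (fst' z) (snd' z)" by blast
  have "\<exists>z. z \<epsilon> Z \<and> \<not> fst' z \<epsilon> n" if n: "n \<epsilon> om" for n
  proof -
    obtain u where "opair n u \<epsilon> C" "Q n u" using C n by blast
    then show ?thesis using Z n by (intro exI[of _ "opair n u"]) simp
  qed
  then show ?thesis using Z unfolding stage_def by blast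
qed

text \<open>Over index \<open>n\<close> lie the pairs of points whose own indices are at least
  \<open>n\<close>, so neither projection lowers the index.\<close>

lemma common_refinement:
  assumes "stage X" "stage X'"
  shows "\<exists>Z g g'. stage Z \<and> mor g Z X \<and> mor g' Z X'"
proof -
  let ?Q = "\<lambda>n u. fst' u \<epsilon> X \<and> snd' u \<epsilon> X' \<and> \<not> fst' (fst' u) \<epsilon> n \<and> \<not> fst' (snd' u) \<epsilon> n"
  have "\<exists>u. ?Q n u" if n: "n \<epsilon> om" for n
  proof -
    obtain x x' where "x \<epsilon> X" "\<not> fst' x \<epsilon> n" "x' \<epsilon> X'" "\<not> fst' x' \<epsilon> n"
      using assms n unfolding stage_def by blast
    then show ?thesis by (intro exI[of _ "opair x x'"]) simp
  qed
  moreover have "D (\<lambda>v. ?Q (v 0) (v 1))" by (intro def_intros)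
  ultimately obtain Z where Z: "stage Z" "\<And>z. z \<epsilon> Z \<Longrightarrow> ?Q (fst' z) (snd' z)"
    using ex_stage[of ?Q] by blast
  have "mor (lam Z (\<lambda>z. fst' (snd' z))) Z X"
    by (rule mor_lam) (intro def_intros, use assms Z in auto)
  moreover have "mor (lam Z (\<lambda>z. snd' (snd' z))) Z X'"
    by (rule mor_lam) (intro def_intros, use assms Z in auto)
  ultimately show ?thesis using Z(1) by blast
qed

text \<open>If \<open>P\<close> failed at unbounded indices, the failing points would form a stage
  below \<open>X\<close>, and no refinement of it could satisfy \<open>P\<close> almost
  everywhere.\<close>

lemma aa_dense:
  assumes X: "stage X" and P: "D (\<lambda>v. P (v 0))"
    and dense: "\<And>Y h. stage Y \<Longrightarrow> mor h Y X \<Longrightarrow>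
      \<exists>Z g. stage Z \<and> mor g Z Y \<and> aa Z (\<lambda>z. P (app h (app g z)))"
  shows "aa X P"
proof (rule ccontr)
  assume n: "\<not> aa X P"
  have "\<exists>Y. \<forall>x. x \<epsilon> Y \<longleftrightarrow> x \<epsilon> X \<and> \<not> P x" by (rule separation) (intro def_intros P)
  then obtain Y where Y: "\<And>x. x \<epsilon> Y \<longleftrightarrow> x \<epsilon> X \<and> \<not> P x" by blast
  have sY: "stage Y" using not_aaD[OF n] X Y unfolding stage_def by blast
  then have "mor (idf Y) Y X" using X Y by (intro mor_idf_sub) (auto simp: sub_def)
  from dense[OF sY this] obtain Z g where Z: "stage Z" "mor g Z Y" "aa Z (\<lambda>z. P (app (idf Y) (app g z)))"
    by blast
  then obtain z where "z \<epsilon> Z" "P (app (idf Y) (app g z))" using aa_ex by blast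
  moreover from this have "app g z \<epsilon> Y" using Z(2) morD by blast
  ultimately show False using Y by simp
qed

subsection \<open>The forcing relation\<close>

text \<open>Environments assign names to variables. A name is any element \<open>f\<close> of the model, read as the
  function \<open>app f\<close> on the stage at hand; \<open>res e h Y\<close> pulls an environment back along \<open>h\<close>.\<close>

definition res :: "(nat \<Rightarrow> 'a) \<Rightarrow> 'a \<Rightarrow> 'a \<Rightarrow> nat \<Rightarrow> 'a" where
  "res e h Y = (\<lambda>n. comp_on (e n) h Y)"

text \<open>The clause for \<open>Std\<close> asks for constancy on a dense set of refinements, not
  at \<open>X\<close>. The atomic clauses need no such closure, being local by
  \<open>aa_dense\<close>.\<close>

primrec forces :: "fm \<Rightarrow> 'a \<Rightarrow> (nat \<Rightarrow> 'a) \<Rightarrow> bool" where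
  "forces \<^bold>\<bottom> X e = False"
| "forces (i \<^bold>= j) X e = aa X (\<lambda>x. app (e i) x = app (e j) x)"
| "forces (i \<^bold>\<in> j) X e = aa X (\<lambda>x. app (e i) x \<epsilon> app (e j) x)"
| "forces (Std i) X e = (\<forall>Y h. stage Y \<longrightarrow> mor h Y X \<longrightarrow>
     (\<exists>Z g c. stage Z \<and> mor g Z Y \<and> aa Z (\<lambda>z. app (e i) (app h (app g z)) = c)))"
| "forces (\<phi> \<^bold>\<longrightarrow> \<psi>) X e = (\<forall>Y h. stage Y \<longrightarrow> mor h Y X \<longrightarrow>
     forces \<phi> Y (res e h Y) \<longrightarrow> forces \<psi> Y (res e h Y))"
| "forces (\<^bold>\<forall>\<phi>) X e = (\<forall>Y h f. stage Y \<longrightarrow> mor h Y X \<longrightarrow> forces \<phi> Y (case_nat f (res e h Y)))"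

lemma app_res [simp]: "y \<epsilon> Y \<Longrightarrow> app (res e h Y n) y = app (e n) (app h y)"
  by (simp add: res_def)

lemma res_case_nat: "res (case_nat f e) h Y = case_nat (comp_on f h Y) (res e h Y)"
  by (auto simp: res_def fun_eq_iff split: nat.splits)

lemma lam_cong: "(\<And>x. x \<epsilon> X \<Longrightarrow> F x = G x) \<Longrightarrow> lam X F = lam X G"
  unfolding lam_def by (rule arg_cong[of _ _ setof]) (metis)

text \<open>The environments are literally equal, not just almost everywhere: both consist of
  functions rebuilt by \<open>lam\<close> on \<open>Z\<close>.\<close>

lemma res_res: "mor g Z Y \<Longrightarrow> res (res e h Y) g Z = res e (comp_on h g Z) Z"
  unfolding res_def fun_eq_iff
  by (intro allI, subst comp_on_def, subst (3) comp_on_def) (intro lam_cong, simp add: morD)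

text \<open>Names that agree almost everywhere denote the same object. This absorbs the changes that
  restriction, even along the identity, makes to a name off the stage.\<close>

lemma forces_cong:
  "(\<And>i. i < fv_bound \<phi> \<Longrightarrow> aa X (\<lambda>x. app (e i) x = app (e' i) x)) \<Longrightarrow>
    forces \<phi> X e \<longleftrightarrow> forces \<phi> X e'"
proof (induction \<phi> arbitrary: X e e')
  case (Eql i j)
  then have "aa X (\<lambda>x. app (e i) x = app (e' i) x \<and> app (e j) x = app (e' j) x)"
    by (intro aa_conj) auto
  then have "aa X (\<lambda>x. app (e i) x = app (e j) x \<longleftrightarrow> app (e' i) x = app (e' j) x)"
    by (rule aa_mono) simp
  from aa_cong[OF this] show ?case by simp
next
  case (Mem i j)
  then have "aa X (\<lambda>x. app (e i) x = app (e' i) x \<and> app (e j) x = app (e' j) x)"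
    by (intro aa_conj) auto
  then have "aa X (\<lambda>x. app (e i) x \<epsilon> app (e j) x \<longleftrightarrow> app (e' i) x \<epsilon> app (e' j) x)"
    by (rule aa_mono) simp
  from aa_cong[OF this] show ?case by simp
next
  case (Std i)
  have "aa Z (\<lambda>z. app (e i) (app h (app g z)) = c) \<longleftrightarrow> aa Z (\<lambda>z. app (e' i) (app h (app g z)) = c)"
    if "mor h Y X" "mor g Z Y" for Y h Z g c
  proof (rule aa_cong)
    have "aa X (\<lambda>x. app (e i) x = app (e' i) x)" using Std by simp
    then have "aa Z (\<lambda>z. app (e i) (app h (app g z)) = app (e' i) (app h (app g z)))"
      using aa_mor that by blast
    then show "aa Z (\<lambda>z. app (e i) (app h (app g z)) = c \<longleftrightarrow> app (e' i) (app h (app g z)) = c)"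
      by (rule aa_mono) simp
  qed
  then show ?case by simp blast
next
  case (Imp \<phi> \<psi>)
  have r: "aa Y (\<lambda>y. app (res e h Y i) y = app (res e' h Y i) y)"
    if "mor h Y X" "i < max (fv_bound \<phi>) (fv_bound \<psi>)" for Y h i
  proof -
    have "aa X (\<lambda>x. app (e i) x = app (e' i) x)" using Imp.prems that(2) by simp
    then have "aa Y (\<lambda>y. app (e i) (app h y) = app (e' i) (app h y))" by (rule aa_mor[OF that(1)])
    then show ?thesis by (rule aa_mono) simp
  qed
  have "forces \<phi> Y (res e h Y) \<longleftrightarrow> forces \<phi> Y (res e' h Y)" if "mor h Y X" for Y h
    by (rule Imp.IH(1)) (use r[OF that] in auto)
  moreover have "forces \<psi> Y (res e h Y) \<longleftrightarrow> forces \<psi> Y (res e' h Y)" if "mor h Y X" for Y h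
    by (rule Imp.IH(2)) (use r[OF that] in auto)
  ultimately show ?case by simp
next
  case (Forall \<phi>)
  have "forces \<phi> Y (case_nat f (res e h Y)) \<longleftrightarrow> forces \<phi> Y (case_nat f (res e' h Y))"
    if h: "mor h Y X" for Y h f
  proof (rule Forall.IH)
    fix i assume i: "i < fv_bound \<phi>"
    show "aa Y (\<lambda>y. app (case_nat f (res e h Y) i) y = app (case_nat f (res e' h Y) i) y)"
    proof (cases i)
      case 0
      then show ?thesis by (simp add: aa_all)
    next
      case (Suc j)
      then have "aa X (\<lambda>x. app (e j) x = app (e' j) x)" using Forall.prems i by simp
      then have "aa Y (\<lambda>y. app (e j) (app h y) = app (e' j) (app h y))" by (rule aa_mor[OF h])
      then show ?thesis unfolding Suc by (auto elim: aa_mono)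
    qed
  qed
  then show ?case by simp
qed simp

lemma forces_idf: "forces \<phi> X (res e (idf X) X) \<longleftrightarrow> forces \<phi> X e"
  by (rule forces_cong) (simp add: aa_all)

text \<open>A case distinction is enough: every nonatomic clause already quantifies over all
  refinements, and morphisms compose.\<close>

lemma forces_mono:
  assumes f: "forces \<phi> X e" and h: "mor h Y X"
  shows "forces \<phi> Y (res e h Y)"
proof (cases \<phi>)
  case (Eql i j)
  then have "aa Y (\<lambda>y. app (e i) (app h y) = app (e j) (app h y))"
    using aa_mor[OF h, of "\<lambda>x. app (e i) x = app (e j) x"] f by simp
  then show ?thesis unfolding Eql by (auto elim: aa_mono)
next
  case (Mem i j)
  then have "aa Y (\<lambda>y. app (e i) (app h y) \<epsilon> app (e j) (app h y))"
    using aa_mor[OF h, of "\<lambda>x. app (e i) x \<epsilon> app (e j) x"] f by simp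
  then show ?thesis unfolding Mem by (auto elim: aa_mono)
next
  case (Std i)
  have "\<exists>Z g c. stage Z \<and> mor g Z Y' \<and> aa Z (\<lambda>z. app (res e h Y i) (app h' (app g z)) = c)"
    if Y': "stage Y'" "mor h' Y' Y" for Y' h'
  proof -
    obtain Z g c where Z: "stage Z" "mor g Z Y'"
      "aa Z (\<lambda>z. app (e i) (app (comp_on h h' Y') (app g z)) = c)"
      using f Y'(1) mor_comp[OF h Y'(2)] unfolding Std forces.simps by blast
    from Z(3) have "aa Z (\<lambda>z. app (res e h Y i) (app h' (app g z)) = c)"
      by (rule aa_mono) (simp add: morD[OF Z(2)] morD[OF Y'(2)])
    with Z(1,2) show ?thesis by blast
  qed
  then show ?thesis unfolding Std by simp
next
  case (Imp \<psi> \<chi>)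
  then show ?thesis using f by (auto simp: res_res mor_comp[OF h])
next
  case (Forall \<psi>)
  then show ?thesis using f by (auto simp: res_res mor_comp[OF h])
qed (use f in simp)

lemma forces_mp: "stage X \<Longrightarrow> forces (\<phi> \<^bold>\<longrightarrow> \<psi>) X e \<Longrightarrow> forces \<phi> X e \<Longrightarrow> forces \<psi> X e"
  using mor_idf[of X] forces_idf unfolding forces.simps by blast

text \<open>Locality of forcing, which makes the logic classical: \<open>RAA\<close> holds because a
  formula whose negation is forced at no refinement is forced densely.\<close>

lemma forces_dense:
  "stage X \<Longrightarrow>
    (\<And>Y h. stage Y \<Longrightarrow> mor h Y X \<Longrightarrow>
      \<exists>Z g. stage Z \<and> mor g Z Y \<and> forces \<phi> Z (res (res e h Y) g Z)) \<Longrightarrow>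
    forces \<phi> X e"
proof (induction \<phi> arbitrary: X e)
  case Fls
  then show ?case using mor_idf[OF Fls.prems(1)] by fastforce
next
  case (Eql i j)
  have "aa X (\<lambda>x. app (e i) x = app (e j) x)"
  proof (rule aa_dense[OF Eql.prems(1)])
    show "D (\<lambda>v. app (e i) (v 0) = app (e j) (v 0))" by (intro def_intros)
    fix Y h assume h: "stage Y" "mor h Y X"
    obtain Z g where Z: "stage Z" "mor g Z Y"
      "aa Z (\<lambda>z. app (res (res e h Y) g Z i) z = app (res (res e h Y) g Z j) z)"
      using Eql.prems(2)[OF h] by auto
    from Z(3) have "aa Z (\<lambda>z. app (e i) (app h (app g z)) = app (e j) (app h (app g z)))"
      by (rule aa_mono) (simp add: morD[OF Z(2)])
    with Z(1,2) show "\<exists>Z g. stage Z \<and> mor g Z Y \<and>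
      aa Z (\<lambda>z. app (e i) (app h (app g z)) = app (e j) (app h (app g z)))" by blast
  qed
  then show ?case by simp
next
  case (Mem i j)
  have "aa X (\<lambda>x. app (e i) x \<epsilon> app (e j) x)"
  proof (rule aa_dense[OF Mem.prems(1)])
    show "D (\<lambda>v. app (e i) (v 0) \<epsilon> app (e j) (v 0))" by (intro def_intros)
    fix Y h assume h: "stage Y" "mor h Y X"
    obtain Z g where Z: "stage Z" "mor g Z Y"
      "aa Z (\<lambda>z. app (res (res e h Y) g Z i) z \<epsilon> app (res (res e h Y) g Z j) z)"
      using Mem.prems(2)[OF h] by auto
    from Z(3) have "aa Z (\<lambda>z. app (e i) (app h (app g z)) \<epsilon> app (e j) (app h (app g z)))"
      by (rule aa_mono) (simp add: morD[OF Z(2)])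
    with Z(1,2) show "\<exists>Z g. stage Z \<and> mor g Z Y \<and>
      aa Z (\<lambda>z. app (e i) (app h (app g z)) \<epsilon> app (e j) (app h (app g z)))" by blast
  qed
  then show ?case by simp
next
  case (Std i)
  have "\<exists>Z g c. stage Z \<and> mor g Z Y \<and> aa Z (\<lambda>z. app (e i) (app h (app g z)) = c)"
    if h: "stage Y" "mor h Y X" for Y h
  proof -
    obtain Z g where Z: "stage Z" "mor g Z Y" "forces (Std i) Z (res (res e h Y) g Z)"
      using Std.prems(2)[OF h] by blast
    then obtain Z' g' c where Z': "stage Z'" "mor g' Z' Z"
      "aa Z' (\<lambda>z. app (res (res e h Y) g Z i) (app (idf Z) (app g' z)) = c)"
      using mor_idf[OF Z(1)] unfolding forces.simps by blast
    from Z'(3) have "aa Z' (\<lambda>z. app (e i) (app h (app (comp_on g g' Z') z)) = c)"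
      by (rule aa_mono) (simp add: morD[OF Z(2)] morD[OF Z'(2)])
    with Z'(1) mor_comp[OF Z(2) Z'(2)] show ?thesis by blast
  qed
  then show ?case by simp
next
  case (Imp \<phi> \<psi>)
  have "forces \<psi> Y (res e h Y)"
    if h: "stage Y" "mor h Y X" "forces \<phi> Y (res e h Y)" for Y h
  proof (rule Imp.IH(2)[OF h(1)])
    fix Y' h' assume h': "stage Y'" "mor h' Y' Y"
    obtain Z g where Z: "stage Z" "mor g Z Y'"
      "forces (\<phi> \<^bold>\<longrightarrow> \<psi>) Z (res (res e (comp_on h h' Y') Y') g Z)"
      using Imp.prems(2)[OF h'(1) mor_comp[OF h(2) h'(2)]] by blast
    have "forces \<phi> Z (res (res (res e h Y) h' Y') g Z)"
      using forces_mono[OF forces_mono[OF h(3) h'(2)] Z(2)] .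
    then have "forces \<psi> Z (res (res (res e h Y) h' Y') g Z)"
      using forces_mp[OF Z(1,3)] res_res[OF h'(2)] by simp
    then show "\<exists>Z g. stage Z \<and> mor g Z Y' \<and> forces \<psi> Z (res (res (res e h Y) h' Y') g Z)"
      using Z(1,2) by blast
  qed
  then show ?case by simp
next
  case (Forall \<phi>)
  have "forces \<phi> Y (case_nat f (res e h Y))" if h: "stage Y" "mor h Y X" for Y h f
  proof (rule Forall.IH[OF h(1)])
    fix Y' h' assume h': "stage Y'" "mor h' Y' Y"
    obtain Z g where Z: "stage Z" "mor g Z Y'"
      "forces (\<^bold>\<forall>\<phi>) Z (res (res e (comp_on h h' Y') Y') g Z)"
      using Forall.prems(2)[OF h'(1) mor_comp[OF h(2) h'(2)]] by blast
    \<comment> \<open>The name \<open>f\<close> lives on \<open>Y\<close>; its pullback to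
      \<open>Z\<close>, the head of \<open>?e\<close>, instantiates the quantifier there.\<close>
    let ?e = "res (res (case_nat f (res e h Y)) h' Y') g Z"
    let ?e' = "res (res e (comp_on h h' Y') Y') g Z"
    have "forces \<phi> Z (case_nat (?e 0) (res ?e' (idf Z) Z))"
      using Z(1,3) mor_idf by simp
    moreover have "?e = case_nat (?e 0) ?e'"
      by (simp add: res_case_nat res_res[OF h'(2)])
    moreover have "forces \<phi> Z (case_nat (?e 0) (res ?e' (idf Z) Z)) \<longleftrightarrow> forces \<phi> Z (case_nat (?e 0) ?e')"
      by (rule forces_cong) (auto intro!: aa_all split: nat.splits)
    ultimately have "forces \<phi> Z ?e" by simp
    then show "\<exists>Z g. stage Z \<and> mor g Z Y' \<and> forces \<phi> Z (res (res (case_nat f (res e h Y)) h' Y') g Z)"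
      using Z(1,2) by blast
  qed
  then show ?case by simp
qed

lemma forces_rename: "forces (rename r \<phi>) X e \<longleftrightarrow> forces \<phi> X (\<lambda>n. e (r n))"
proof (induction \<phi> arbitrary: r X e)
  case (Imp \<phi> \<psi>)
  have "(\<lambda>n. res e h Y (r n)) = res (\<lambda>n. e (r n)) h Y" for h Y by (simp add: res_def)
  with Imp show ?case by simp
next
  case (Forall \<phi>)
  have "(\<lambda>n. case_nat f (res e h Y) (case_nat 0 (\<lambda>n. Suc (r n)) n)) = case_nat f (res (\<lambda>n. e (r n)) h Y)"
    for f h Y by (auto simp: res_def fun_eq_iff split: nat.splits)
  with Forall show ?case by simp
qed simp_all

theorem forces_sound:
  "derives L \<Gamma> \<phi> \<Longrightarrow> stage X \<Longrightarrow> (\<And>\<gamma>. \<gamma> \<in> \<Gamma> \<Longrightarrow> forces \<gamma> X e) \<Longrightarrow> forces \<phi> X e"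
proof (induction arbitrary: X e rule: derives.induct)
  case (Assm \<phi> \<Gamma>)
  then show ?case by blast
next
  case (ImpI \<phi> \<Gamma> \<psi>)
  have "forces \<psi> Y (res e h Y)" if h: "stage Y" "mor h Y X" "forces \<phi> Y (res e h Y)" for Y h
    by (rule ImpI.IH[OF h(1)]) (use h(3) forces_mono[OF ImpI.prems(2) h(2)] in auto)
  then show ?case by simp
next
  case (ImpE \<Gamma> \<phi> \<psi>)
  then show ?case using forces_mp by blast
next
  case (RAA \<phi> \<Gamma>)
  show ?case
  proof (rule forces_dense[OF RAA.prems(1)])
    fix Y h assume h: "stage Y" "mor h Y X"
    show "\<exists>Z g. stage Z \<and> mor g Z Y \<and> forces \<phi> Z (res (res e h Y) g Z)"
    proof (rule ccontr)
      assume "\<not> ?thesis"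
      then have "forces (\<^bold>\<not>\<phi>) Y (res e h Y)" by (auto simp: Neg_def)
      then have "forces \<^bold>\<bottom> Y (res e h Y)"
        using RAA.IH[OF h(1), of "res e h Y"] forces_mono[OF RAA.prems(2) h(2)] by blast
      then show False by simp
    qed
  qed
next
  case (AllI \<Gamma> \<phi>)
  have "forces \<phi> Y (case_nat f (res e h Y))" if h: "stage Y" "mor h Y X" for Y h f
  proof (rule AllI.IH[OF h(1)])
    fix \<gamma> assume "\<gamma> \<in> inst [] 1 ` \<Gamma>"
    then obtain \<delta> where "\<delta> \<in> \<Gamma>" "\<gamma> = rename Suc \<delta>" unfolding inst_shift by blast
    then show "forces \<gamma> Y (case_nat f (res e h Y))"
      using forces_mono[OF AllI.prems(2) h(2), of \<delta>] by (simp add: forces_rename)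
  qed
  then show ?case by simp
next
  case (AllE \<Gamma> \<phi> t)
  then have "forces \<phi> X (case_nat (e t) (res e (idf X) X))"
    using mor_idf[of X] by simp
  moreover have "forces \<phi> X (case_nat (e t) (res e (idf X) X)) \<longleftrightarrow>
      forces \<phi> X (\<lambda>n. e (case_nat t (\<lambda>n. n) n))"
    by (rule forces_cong) (auto intro!: aa_all split: nat.splits)
  ultimately show ?case by (simp add: inst1 forces_rename)
next
  case (EqRefl \<Gamma> t)
  show ?case by (simp add: aa_all)
next
  case (EqSubst \<Gamma> s t \<phi>)
  then have s: "aa X (\<lambda>x. app (e s) x = app (e t) x)" by simp
  have "forces \<phi> X (\<lambda>n. e (case_nat s (\<lambda>n. n) n)) \<longleftrightarrow> forces \<phi> X (\<lambda>n. e (case_nat t (\<lambda>n. n) n))"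
    by (rule forces_cong) (use s in \<open>auto intro: aa_all split: nat.splits\<close>)
  then show ?case using EqSubst.IH(2)[OF EqSubst.prems] by (simp add: inst1 forces_rename)
qed

subsection \<open>Derived connectives\<close>

lemma forces_Neg:
  "forces (\<^bold>\<not>\<phi>) X e \<longleftrightarrow> (\<forall>Y h. stage Y \<longrightarrow> mor h Y X \<longrightarrow> \<not> forces \<phi> Y (res e h Y))"
  by (simp add: Neg_def)

text \<open>Since conjunction is coded by negation and implication, recovering the conjuncts is a
  classical step and goes through \<open>forces_dense\<close>.\<close>

lemma forces_Conj:
  assumes X: "stage X"
  shows "forces (\<phi> \<^bold>\<and> \<psi>) X e \<longleftrightarrow> forces \<phi> X e \<and> forces \<psi> X e"
proof
  assume f: "forces \<phi> X e \<and> forces \<psi> X e"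
  have "\<not> forces (\<phi> \<^bold>\<longrightarrow> \<^bold>\<not>\<psi>) Y (res e h Y)" if h: "stage Y" "mor h Y X" for Y h
  proof
    assume "forces (\<phi> \<^bold>\<longrightarrow> \<^bold>\<not>\<psi>) Y (res e h Y)"
    then have "forces (\<^bold>\<not>\<psi>) Y (res e h Y)" using forces_mp[OF h(1)] forces_mono[OF _ h(2)] f by blast
    then have "forces \<^bold>\<bottom> Y (res e h Y)"
      unfolding Neg_def using forces_mp[OF h(1)] forces_mono[OF _ h(2)] f by blast
    then show False by simp
  qed
  then show "forces (\<phi> \<^bold>\<and> \<psi>) X e" unfolding Conj_def forces_Neg by blast
next
  assume f: "forces (\<phi> \<^bold>\<and> \<psi>) X e"
  have n: "\<not> forces (\<phi> \<^bold>\<longrightarrow> \<^bold>\<not>\<psi>) Y (res e h Y)" if "stage Y" "mor h Y X" for Y h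
    using f that unfolding Conj_def forces_Neg by blast
  show "forces \<phi> X e \<and> forces \<psi> X e"
  proof (intro conjI forces_dense[OF X])
    fix Y h assume h: "stage Y" "mor h Y X"
    then obtain Z g where Z: "stage Z" "mor g Z Y" "forces \<phi> Z (res (res e h Y) g Z)"
      and np: "\<not> forces (\<^bold>\<not>\<psi>) Z (res (res e h Y) g Z)"
      using n[OF h] unfolding forces.simps by blast
    then show "\<exists>Z g. stage Z \<and> mor g Z Y \<and> forces \<phi> Z (res (res e h Y) g Z)" by blast
    obtain Z' g' where Z': "stage Z'" "mor g' Z' Z" "forces \<psi> Z' (res (res (res e h Y) g Z) g' Z')"
      using np unfolding forces_Neg by blast
    then have "forces \<psi> Z' (res (res e h Y) (comp_on g g' Z') Z')" by (simp add: res_res)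
    then show "\<exists>Z g. stage Z \<and> mor g Z Y \<and> forces \<psi> Z (res (res e h Y) g Z)"
      using Z'(1) mor_comp[OF Z(2) Z'(2)] by blast
  qed
qed

lemma forces_ImpI:
  assumes "\<And>Y h. stage Y \<Longrightarrow> mor h Y X \<Longrightarrow> forces \<phi> Y (res e h Y) \<Longrightarrow> forces \<psi> Y (res e h Y)"
  shows "forces (\<phi> \<^bold>\<longrightarrow> \<psi>) X e"
  using assms by simp

lemma forces_EquivI:
  assumes "stage X"
    "\<And>Y h. stage Y \<Longrightarrow> mor h Y X \<Longrightarrow> forces \<phi> Y (res e h Y) \<longleftrightarrow> forces \<psi> Y (res e h Y)"
  shows "forces (\<phi> \<^bold>\<longleftrightarrow> \<psi>) X e"
  unfolding Equiv_def forces_Conj[OF assms(1)] using assms(2) by simp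

text \<open>As \<open>\<exists>\<close> abbreviates a negated universal, it suffices to find
  witnesses on a dense set of refinements.\<close>

lemma forces_ExistsI:
  assumes X: "stage X" and dense: "\<And>Y h. stage Y \<Longrightarrow> mor h Y X \<Longrightarrow>
    \<exists>Z g f. stage Z \<and> mor g Z Y \<and> forces \<phi> Z (case_nat f (res (res e h Y) g Z))"
  shows "forces (\<^bold>\<exists>\<phi>) X e"
  unfolding Exists_def forces_Neg
proof (intro allI impI notI)
  fix Y h assume h: "stage Y" "mor h Y X" and f: "forces (\<^bold>\<forall>\<^bold>\<not>\<phi>) Y (res e h Y)"
  obtain Z g f' where Z: "stage Z" "mor g Z Y" "forces \<phi> Z (case_nat f' (res (res e h Y) g Z))"
    using dense[OF h] by blast
  then have "forces (\<phi> \<^bold>\<longrightarrow> \<^bold>\<bottom>) Z (case_nat f' (res (res e h Y) g Z))"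
    using f unfolding Neg_def by (simp only: forces.simps(6))
  then have "forces \<^bold>\<bottom> Z (case_nat f' (res (res e h Y) g Z))"
    using forces_mp Z(1,3) by blast
  then show False by simp
qed

text \<open>The canonical name for the standard copy of the element \<open>c\<close>.\<close>

definition "con c X = lam X (\<lambda>x. c)"

lemma app_con [simp]: "x \<epsilon> X \<Longrightarrow> app (con c X) x = c"
  unfolding con_def by (intro app_lam) (intro def_intros)

lemma forces_Std_con: "stage X \<Longrightarrow> forces (Std 0) X (case_nat (con c X) e)"
proof -
  have "aa Z (\<lambda>z. app (con c X) (app h (app g z)) = c)"
    if "mor h Y X" "mor g Z Y" for Y h Z g
    by (rule aa_all) (simp add: morD[OF that(1)] morD[OF that(2)])
  then show ?thesis using mor_idf by simp blast
qed

text \<open>A standard name becomes constant on a dense set of refinements, where it can be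
  exchanged for some \<open>con c\<close>; \<open>forces_dense\<close> brings the result
  back.\<close>

lemma forces_Forall_stI:
  assumes f: "\<And>Y h c. stage Y \<Longrightarrow> mor h Y X \<Longrightarrow> forces \<phi> Y (case_nat (con c Y) (res e h Y))"
  shows "forces (\<^bold>\<forall>\<^sup>s\<^sup>t\<phi>) X e"
  unfolding Forall_st_def forces.simps(5,6)
proof (intro allI impI)
  fix Y h u Y' h'
  assume Y: "stage Y" "mor h Y X" and Y': "stage Y'" "mor h' Y' Y"
  let ?e = "res (case_nat u (res e h Y)) h' Y'"
  assume std: "forces (Std 0) Y' ?e"
  show "forces \<phi> Y' ?e"
  proof (rule forces_dense[OF Y'(1)])
    fix Y'' h'' assume Y'': "stage Y''" "mor h'' Y'' Y'"
    then obtain Z g c where Z: "stage Z" "mor g Z Y''"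
      and c: "aa Z (\<lambda>z. app (?e 0) (app h'' (app g z)) = c)"
      using std unfolding forces.simps by blast
    \<comment> \<open>The whole composite from \<open>Z\<close> down to \<open>X\<close>, along
      which the remaining names are restricted.\<close>
    let ?g = "comp_on h (comp_on h' (comp_on h'' g Z) Z) Z"
    have g: "mor (comp_on h'' g Z) Z Y'" by (rule mor_comp[OF Y''(2) Z(2)])
    have g': "mor (comp_on h' (comp_on h'' g Z) Z) Z Y" by (rule mor_comp[OF Y'(2) g])
    have "forces \<phi> Z (case_nat (con c Z) (res e ?g Z))"
      by (rule f[OF Z(1) mor_comp[OF Y(2) g']])
    moreover have e: "res (res ?e h'' Y'') g Z =
        case_nat (res (res ?e h'' Y'') g Z 0) (res e ?g Z)"
      by (simp add: res_case_nat res_res[OF Z(2)] res_res[OF g] res_res[OF g'])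
    have "forces \<phi> Z (case_nat (con c Z) (res e ?g Z)) \<longleftrightarrow> forces \<phi> Z (res (res ?e h'' Y'') g Z)"
    proof (rule forces_cong)
      have "aa Z (\<lambda>z. app (con c Z) z = app (res (res ?e h'' Y'') g Z 0) z)"
        using c by (rule aa_mono) (simp add: morD[OF Z(2)])
      then show "aa Z (\<lambda>z. app (case_nat (con c Z) (res e ?g Z) i) z = app (res (res ?e h'' Y'') g Z i) z)" for i
        by (subst e) (auto intro: aa_all split: nat.splits)
    qed
    ultimately show "\<exists>Z g. stage Z \<and> mor g Z Y'' \<and> forces \<phi> Z (res (res ?e h'' Y'') g Z)"
      using Z by blast
  qed
qed

lemma forces_Forall_stD:
  assumes X: "stage X" and f: "forces (\<^bold>\<forall>\<^sup>s\<^sup>t\<phi>) X e"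
  shows "forces \<phi> X (case_nat (con c X) e)"
proof -
  let ?e = "case_nat (con c X) (res e (idf X) X)"
  have "forces (Std 0 \<^bold>\<longrightarrow> \<phi>) X ?e"
    using f mor_idf[OF X] X unfolding Forall_st_def by (simp only: forces.simps(6))
  then have "forces \<phi> X ?e" using forces_mp[OF X] forces_Std_con[OF X] by blast
  moreover have "forces \<phi> X ?e \<longleftrightarrow> forces \<phi> X (case_nat (con c X) e)"
    by (rule forces_cong) (auto intro!: aa_all split: nat.splits)
  ultimately show ?thesis by simp
qed

lemma forces_Exists_stI:
  assumes X: "stage X" and dense: "\<And>Y h. stage Y \<Longrightarrow> mor h Y X \<Longrightarrow>
    \<exists>Z g c. stage Z \<and> mor g Z Y \<and> forces \<phi> Z (case_nat (con c Z) (res (res e h Y) g Z))"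
  shows "forces (\<^bold>\<exists>\<^sup>s\<^sup>t\<phi>) X e"
  unfolding Exists_st_def
proof (rule forces_ExistsI[OF X])
  fix Y h assume "stage Y" "mor h Y X"
  from dense[OF this] obtain Z g c where "stage Z" "mor g Z Y"
    "forces \<phi> Z (case_nat (con c Z) (res (res e h Y) g Z))" by blast
  then show "\<exists>Z g f. stage Z \<and> mor g Z Y \<and> forces (Std 0 \<^bold>\<and> \<phi>) Z (case_nat f (res (res e h Y) g Z))"
    using forces_Std_con forces_Conj by blast
qed

subsection \<open>The theorem of Los\<close>

abbreviation models :: "(nat \<Rightarrow> 'a) \<Rightarrow> fm \<Rightarrow> bool"  (infix "\<Turnstile>" 50) where
  "v \<Turnstile> \<phi> \<equiv> sat (=) (\<epsilon>) v \<phi>"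

lemma app_case_nat: "(\<lambda>n. app (case_nat f e n) x) = case_nat (app f x) (\<lambda>n. app (e n) x)"
  by (auto simp: fun_eq_iff split: nat.splits)

lemma sat_app_res: "y \<epsilon> Y \<Longrightarrow> (\<lambda>n. app (res e h Y n) y) = (\<lambda>n. app (e n) (app h y))"
  by (simp add: fun_eq_iff)

lemma D_sat_case_nat:
  assumes "st_free \<phi>" "dfun F" "\<And>n. dfun (G n)"
  shows "D (\<lambda>v. case_nat (F v) (\<lambda>n. G n v) \<Turnstile> \<phi>)"
proof -
  have "dfun (case_nat F G n)" for n using assms by (cases n) auto
  from D_sat[OF assms(1) this] show ?thesis
    by (rule back_subst[of D]) (auto simp: fun_eq_iff intro!: arg_cong[of _ _ "\<lambda>v. v \<Turnstile> \<phi>"] split: nat.splits)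
qed

theorem Los:
  "st_free \<phi> \<Longrightarrow> stage X \<Longrightarrow> forces \<phi> X e \<longleftrightarrow> aa X (\<lambda>x. (\<lambda>n. app (e n) x) \<Turnstile> \<phi>)"
proof (induction \<phi> arbitrary: X e)
  case (Imp \<phi> \<psi>)
  let ?s = "\<lambda>\<chi> x. (\<lambda>n. app (e n) x) \<Turnstile> \<chi>"
  have IH: "forces \<chi> Y (res e h Y) \<longleftrightarrow> aa Y (\<lambda>y. ?s \<chi> (app h y))"
    if "stage Y" "\<chi> = \<phi> \<or> \<chi> = \<psi>" for \<chi> Y h
  proof -
    have "forces \<chi> Y (res e h Y) \<longleftrightarrow> aa Y (\<lambda>y. (\<lambda>n. app (res e h Y n) y) \<Turnstile> \<chi>)"
      using Imp.IH Imp.prems(1) that by auto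
    also have "\<dots> \<longleftrightarrow> aa Y (\<lambda>y. ?s \<chi> (app h y))"
      by (rule aa_cong, rule aa_all) (simp add: sat_app_res)
    finally show ?thesis .
  qed
  show ?case
  proof
    assume f: "forces (\<phi> \<^bold>\<longrightarrow> \<psi>) X e"
    show "aa X (?s (\<phi> \<^bold>\<longrightarrow> \<psi>))"
    proof (rule ccontr)
      assume n: "\<not> aa X (?s (\<phi> \<^bold>\<longrightarrow> \<psi>))"
      \<comment> \<open>The failing points form a stage that forces \<open>\<phi>\<close> but not
        \<open>\<psi>\<close>.\<close>
      have "\<exists>Y. \<forall>x. x \<epsilon> Y \<longleftrightarrow> x \<epsilon> X \<and> \<not> ?s (\<phi> \<^bold>\<longrightarrow> \<psi>) x"
        by (rule separation) (intro def_intros D_sat Imp.prems(1))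
      then obtain Y where Y: "\<And>x. x \<epsilon> Y \<longleftrightarrow> x \<epsilon> X \<and> \<not> ?s (\<phi> \<^bold>\<longrightarrow> \<psi>) x" by blast
      have sY: "stage Y" using not_aaD[OF n] Imp.prems(2) Y unfolding stage_def by blast
      have "mor (idf Y) Y X" using Y by (intro mor_idf_sub sY Imp.prems(2)) (simp add: sub_def)
      moreover have "aa Y (\<lambda>y. ?s \<phi> (app (idf Y) y))" by (rule aa_all) (use Y in auto)
      ultimately have "aa Y (\<lambda>y. ?s \<psi> (app (idf Y) y))" using f IH sY by auto
      then obtain y where "y \<epsilon> Y" "?s \<psi> (app (idf Y) y)" using aa_ex[OF sY] by blast
      then show False using Y by simp
    qed
  next
    assume a: "aa X (?s (\<phi> \<^bold>\<longrightarrow> \<psi>))"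
    show "forces (\<phi> \<^bold>\<longrightarrow> \<psi>) X e"
    proof (rule forces_ImpI)
      fix Y h assume h: "stage Y" "mor h Y X" "forces \<phi> Y (res e h Y)"
      have "aa Y (\<lambda>y. ?s (\<phi> \<^bold>\<longrightarrow> \<psi>) (app h y) \<and> ?s \<phi> (app h y))"
        using aa_conj[OF aa_mor[OF h(2) a]] h(3) IH[OF h(1)] by blast
      then have "aa Y (\<lambda>y. ?s \<psi> (app h y))" by (rule aa_mono) simp
      then show "forces \<psi> Y (res e h Y)" using IH[OF h(1)] by blast
    qed
  qed
next
  case (Forall \<phi>)
  let ?s = "\<lambda>y x. case_nat y (\<lambda>n. app (e n) x) \<Turnstile> \<phi>"
  have IH: "forces \<phi> Y (case_nat f (res e h Y)) \<longleftrightarrow> aa Y (\<lambda>y. ?s (app f y) (app h y))"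
    if "stage Y" for Y h f
  proof -
    have "forces \<phi> Y (case_nat f (res e h Y)) \<longleftrightarrow>
        aa Y (\<lambda>y. (\<lambda>n. app (case_nat f (res e h Y) n) y) \<Turnstile> \<phi>)"
      using Forall.IH Forall.prems(1) that by auto
    also have "\<dots> \<longleftrightarrow> aa Y (\<lambda>y. ?s (app f y) (app h y))"
      by (rule aa_cong, rule aa_all) (simp add: app_case_nat sat_app_res)
    finally show ?thesis .
  qed
  show ?case
  proof
    assume f: "forces (\<^bold>\<forall>\<phi>) X e"
    show "aa X (\<lambda>x. (\<lambda>n. app (e n) x) \<Turnstile> (\<^bold>\<forall>\<phi>))"
    proof (rule ccontr)
      assume n: "\<not> aa X (\<lambda>x. (\<lambda>n. app (e n) x) \<Turnstile> (\<^bold>\<forall>\<phi>))"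
      \<comment> \<open>Here Choice is avoided: no counterexample is selected for a point. The new
        stage consists of pairs of a point and a counterexample, and \<open>?f\<close> below names
        the counterexample.\<close>
      let ?Q = "\<lambda>n u. fst' u \<epsilon> X \<and> \<not> fst' (fst' u) \<epsilon> n \<and> \<not> ?s (snd' u) (fst' u)"
      have "D (\<lambda>v. ?Q (v 0) (v 1))"
        by (intro def_intros D_sat_case_nat) (use Forall.prems(1) in simp)
      moreover have "\<exists>u. ?Q n u" if m: "n \<epsilon> om" for n
      proof -
        obtain x y where "x \<epsilon> X" "\<not> fst' x \<epsilon> n" "\<not> ?s y x" using not_aaD[OF n m] by auto
        then show ?thesis by (intro exI[of _ "opair x y"]) simp
      qed
      ultimately obtain Z where Z: "stage Z" "\<And>z. z \<epsilon> Z \<Longrightarrow> ?Q (fst' z) (snd' z)"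
        using ex_stage[of ?Q] by blast
      let ?h = "lam Z (\<lambda>z. fst' (snd' z))" and ?f = "lam Z (\<lambda>z. snd' (snd' z))"
      have "mor ?h Z X"
        by (rule mor_lam) (intro def_intros, use Z Forall.prems(2) in auto)
      then have "forces \<phi> Z (case_nat ?f (res e ?h Z))" using f Z(1) by simp
      then have "aa Z (\<lambda>z. ?s (app ?f z) (app ?h z))" unfolding IH[OF Z(1)] .
      then obtain z where z: "z \<epsilon> Z" "?s (app ?f z) (app ?h z)" using aa_ex[OF Z(1)] by blast
      have "app ?f z = snd' (snd' z)" "app ?h z = fst' (snd' z)"
        by (rule app_lam[OF _ z(1)]; intro def_intros)+
      then show False using z Z(2) by auto
    qed
  next
    assume a: "aa X (\<lambda>x. (\<lambda>n. app (e n) x) \<Turnstile> (\<^bold>\<forall>\<phi>))"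
    have "forces \<phi> Y (case_nat f (res e h Y))" if h: "stage Y" "mor h Y X" for Y h f
      unfolding IH[OF h(1)] using aa_mor[OF h(2) a] by (rule aa_mono) simp
    then show "forces (\<^bold>\<forall>\<phi>) X e" by simp
  qed
qed simp_all

lemma forces_true: "st_free \<phi> \<Longrightarrow> stage X \<Longrightarrow> (\<And>v. v \<Turnstile> \<phi>) \<Longrightarrow> forces \<phi> X e"
  by (simp add: Los aa_all)

subsection \<open>The axioms of SPOT\<close>

text \<open>The effect of the leading standard quantifiers: the parameters become names that are
  constant on the stage.\<close>

definition constant_below :: "nat \<Rightarrow> 'a \<Rightarrow> (nat \<Rightarrow> 'a) \<Rightarrow> bool" where
  "constant_below k X e \<longleftrightarrow> (\<forall>i<k. \<exists>c. \<forall>x. x \<epsilon> X \<longrightarrow> app (e i) x = c)"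

lemma forces_Forall_st_iterate:
  assumes "\<And>X e. stage X \<Longrightarrow> constant_below k X e \<Longrightarrow> forces \<phi> X e" "stage X"
  shows "forces ((Forall_st ^^ k) \<phi>) X e"
proof -
  have "forces ((Forall_st ^^ k) \<phi>) X e" if "\<And>X e. stage X \<Longrightarrow> constant_below (m + k) X e \<Longrightarrow> forces \<phi> X e"
    "stage X" "constant_below m X e" for m X e \<phi>
    using that
  proof (induction k arbitrary: m X e \<phi>)
    case (Suc k)
    have "forces (\<^bold>\<forall>\<^sup>s\<^sup>t\<phi>) X e" if X: "stage X" "constant_below (m + k) X e" for X e
    proof (rule forces_Forall_stI, rule Suc.prems(1))
      fix Y h c assume h: "stage Y" "mor h Y X"
      show "constant_below (m + Suc k) Y (case_nat (con c Y) (res e h Y))"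
        unfolding constant_below_def
      proof (intro allI impI)
        fix i assume i: "i < m + Suc k"
        show "\<exists>c'. \<forall>y. y \<epsilon> Y \<longrightarrow> app (case_nat (con c Y) (res e h Y) i) y = c'"
        proof (cases i)
          case (Suc j)
          then obtain c' where "\<forall>x. x \<epsilon> X \<longrightarrow> app (e j) x = c'"
            using X(2) i unfolding constant_below_def by fastforce
          then show ?thesis using morD[OF h(2)] unfolding Suc by auto
        qed auto
      qed
    qed
    then have "forces ((Forall_st ^^ k) (\<^bold>\<forall>\<^sup>s\<^sup>t\<phi>)) X e"
      using Suc.IH[of m "\<^bold>\<forall>\<^sup>s\<^sup>t\<phi>"] Suc.prems(2,3) by blast
    then show ?case by (simp add: funpow_swap1)
  qed simp
  from this[of 0] show ?thesis using assms by (simp add: constant_below_def)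
qed

text \<open>With constant parameters the truth of \<open>\<phi>\<close> does not depend on the
  point. By Los the premise yields it for every element of the model, hence for the value of any
  name at any point.\<close>

lemma forces_Transfer:
  assumes "st_free \<phi>" "stage X"
  shows "forces (Transfer \<phi>) X e"
  unfolding Transfer_def forall_closure_st_def
proof (rule forces_Forall_st_iterate[OF _ assms(2)])
  let ?k = "fv_bound ((\<^bold>\<forall>\<^sup>s\<^sup>t\<phi>) \<^bold>\<longrightarrow> (\<^bold>\<forall>\<phi>))"
  have k: "fv_bound \<phi> - 1 \<le> ?k" by simp
  fix X e assume X: "stage X" "constant_below ?k X e"
  obtain c where c: "\<And>i x. i < ?k \<Longrightarrow> x \<epsilon> X \<Longrightarrow> app (e i) x = c i"
    using X(2) unfolding constant_below_def by metis
  show "forces ((\<^bold>\<forall>\<^sup>s\<^sup>t\<phi>) \<^bold>\<longrightarrow> (\<^bold>\<forall>\<phi>)) X e"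
  proof (rule forces_ImpI)
    fix Y h assume Y: "stage Y" "mor h Y X" "forces (\<^bold>\<forall>\<^sup>s\<^sup>t\<phi>) Y (res e h Y)"
    have app: "app (res e h Y i) y = c i" if "y \<epsilon> Y" "i < fv_bound \<phi> - 1" for i y
      using c[of i "app h y"] that morD[OF Y(2)] k by simp
    have sat: "case_nat x (\<lambda>n. app (res e h Y n) y) \<Turnstile> \<phi> \<longleftrightarrow> case_nat x c \<Turnstile> \<phi>" if y: "y \<epsilon> Y" for x y
      by (rule sat_cong) (auto simp del: app_res simp: app[OF y] split: nat.splits)
    have "case_nat x c \<Turnstile> \<phi>" for x
    proof -
      have "aa Y (\<lambda>y. (\<lambda>n. app (case_nat (con x Y) (res e h Y) n) y) \<Turnstile> \<phi>)"
        using forces_Forall_stD[OF Y(1,3)] Los[OF assms(1) Y(1)] by blast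
      then obtain y where y: "y \<epsilon> Y" "(\<lambda>n. app (case_nat (con x Y) (res e h Y) n) y) \<Turnstile> \<phi>"
        using aa_ex[OF Y(1)] by blast
      then show ?thesis using sat[OF y(1)] by (simp only: app_case_nat app_con)
    qed
    then have "aa Y (\<lambda>y. (\<lambda>n. app (res e h Y n) y) \<Turnstile> (\<^bold>\<forall>\<phi>))"
      by (intro aa_all) (simp only: sat.simps sat simp_thms)
    then show "forces (\<^bold>\<forall>\<phi>) Y (res e h Y)" using Los[of "\<^bold>\<forall>\<phi>"] assms(1) Y(1) by simp
  qed
qed

lemma st_free_In_Nat [simp]: "st_free (In_Nat i)" and st_free_Subset_Nat [simp]: "st_free (Subset_Nat i)"
  by (simp_all add: In_Nat_def Subset_Nat_def Inductive_def Is_empty_def Is_succ_def)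

lemma sat_Subset_Nat: "v \<Turnstile> Subset_Nat i \<longleftrightarrow> v i \<sqsubseteq> om"
  by (simp add: Subset_Nat_def sat_In_Nat sub_def)

lemma forces_Nontriviality:
  assumes X: "stage X"
  shows "forces Nontriviality X e"
  unfolding Nontriviality_def
proof (rule forces_ExistsI[OF X])
  fix Y h assume Y: "stage Y" "mor h Y X"
  let ?nu = "lam Y fst'" and ?e = "res (res e h Y) (idf Y) Y"
  have nu: "app ?nu y = fst' y" if "y \<epsilon> Y" for y
    by (rule app_lam[OF _ that]) (intro def_intros)
  have "forces (In_Nat 0 \<^bold>\<and> (\<^bold>\<forall>\<^sup>s\<^sup>tIn_Nat 0 \<^bold>\<longrightarrow> \<^bold>\<not>(0 \<^bold>= 1))) Y (case_nat ?nu ?e)"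
    unfolding forces_Conj[OF Y(1)]
  proof
    show "forces (In_Nat 0) Y (case_nat ?nu ?e)"
      using Y(1) by (simp add: Los sat_In_Nat aa_all nu stage_def)
    show "forces (\<^bold>\<forall>\<^sup>s\<^sup>tIn_Nat 0 \<^bold>\<longrightarrow> \<^bold>\<not>(0 \<^bold>= 1)) Y (case_nat ?nu ?e)"
    proof (rule forces_Forall_stI)
      fix Z g c assume Z: "stage Z" "mor g Z Y"
      have "aa Y (\<lambda>y. c \<epsilon> om \<longrightarrow> c \<noteq> fst' y)"
      proof (cases "c \<epsilon> om")
        case True
        then have "suc c \<epsilon> om" by simp
        \<comment> \<open>An index outside \<open>suc c\<close> differs from
          \<open>c\<close>.\<close>
        then show ?thesis unfolding aa_def by (intro exI[of _ "suc c"]) auto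
      qed (simp add: aa_all)
      from aa_mor[OF Z(2) this] have "aa Z (\<lambda>z. (\<lambda>n. app (case_nat (con c Z) (res (case_nat ?nu ?e) g Z) n) z)
          \<Turnstile> (In_Nat 0 \<^bold>\<longrightarrow> \<^bold>\<not>(0 \<^bold>= 1)))"
        by (rule aa_mono) (simp add: sat_In_Nat morD[OF Z(2)] nu)
      then show "forces (In_Nat 0 \<^bold>\<longrightarrow> \<^bold>\<not>(0 \<^bold>= 1)) Z (case_nat (con c Z) (res (case_nat ?nu ?e) g Z))"
        by (subst Los) (simp_all add: Z(1))
    qed
  qed
  then show "\<exists>Z g f. stage Z \<and> mor g Z Y \<and>
      forces (In_Nat 0 \<^bold>\<and> (\<^bold>\<forall>\<^sup>s\<^sup>tIn_Nat 0 \<^bold>\<longrightarrow> \<^bold>\<not>(0 \<^bold>= 1))) Z (case_nat f (res (res e h Y) g Z))"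
    using Y(1) mor_idf by blast
qed

section \<open>Standard parts of sets of natural numbers\<close>

text \<open>The nodes of the tree in question: below \<open>n\<close>, the pattern of
  \<open>t\<close> occurs among the values of \<open>A\<close> at points of arbitrarily large
  index.\<close>

definition big :: "'a \<Rightarrow> 'a \<Rightarrow> 'a \<Rightarrow> 'a \<Rightarrow> bool" where
  "big Y A n t \<longleftrightarrow> (\<forall>k. k \<epsilon> om \<longrightarrow> (\<exists>y. y \<epsilon> Y \<and> \<not> fst' y \<epsilon> k \<and> (\<forall>m. m \<epsilon> n \<longrightarrow> (m \<epsilon> t \<longleftrightarrow> m \<epsilon> app A y))))"

text \<open>\<open>t\<close> is the lexicographically least big subset of \<open>n\<close>: a number enters only when leaving it out
  fails to be big.\<close>

definition greedy :: "'a \<Rightarrow> 'a \<Rightarrow> 'a \<Rightarrow> 'a \<Rightarrow> bool" where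
  "greedy Y A n t \<longleftrightarrow> t \<sqsubseteq> n \<and> big Y A n t \<and> (\<forall>m s. m \<epsilon> n \<longrightarrow> m \<epsilon> t \<longrightarrow> \<not> m \<epsilon> s \<longrightarrow>
     (\<forall>j. j \<epsilon> m \<longrightarrow> (j \<epsilon> s \<longleftrightarrow> j \<epsilon> t)) \<longrightarrow> \<not> big Y A (suc m) s)"

lemma D_big [def_intros]: "dfun F \<Longrightarrow> dfun G \<Longrightarrow> D (\<lambda>v. big Y A (F v) (G v))"
  by (rule D_comp2[where P = "big Y A"]) (unfold big_def, intro def_intros)

lemma D_greedy [def_intros]: "dfun F \<Longrightarrow> dfun G \<Longrightarrow> D (\<lambda>v. greedy Y A (F v) (G v))"
  by (rule D_comp2[where P = "greedy Y A"]) (unfold greedy_def, intro def_intros)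

lemma big_mono:
  "big Y A n t \<Longrightarrow> (\<And>m. m \<epsilon> n' \<Longrightarrow> m \<epsilon> n \<and> (m \<epsilon> t' \<longleftrightarrow> m \<epsilon> t)) \<Longrightarrow> big Y A n' t'"
  unfolding big_def by meson

text \<open>A big pattern on \<open>n\<close> has two extensions to \<open>suc n\<close>, one of
  which is big; omitting \<open>n\<close> takes precedence.\<close>

lemma ex_greedy:
  assumes Y: "stage Y"
  shows "n \<epsilon> om \<Longrightarrow> \<exists>t. greedy Y A n t"
proof (erule om_induct)
  show "D (\<lambda>v. \<exists>t. greedy Y A (v 0) t)" by (intro def_intros)
  show "\<exists>t. greedy Y A emp t"
    by (rule exI[of _ emp]) (use Y in \<open>simp add: greedy_def big_def sub_def stage_def\<close>)
  fix n assume n: "n \<epsilon> om" and "\<exists>t. greedy Y A n t"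
  then obtain t where t: "t \<sqsubseteq> n" "big Y A n t"
    "\<And>m s. m \<epsilon> n \<Longrightarrow> m \<epsilon> t \<Longrightarrow> \<not> m \<epsilon> s \<Longrightarrow> (\<And>j. j \<epsilon> m \<Longrightarrow> j \<epsilon> s \<longleftrightarrow> j \<epsilon> t) \<Longrightarrow> \<not> big Y A (suc m) s"
    unfolding greedy_def by blast
  have nt: "\<not> n \<epsilon> t" using t(1) by (auto simp: sub_def)
  show "\<exists>t. greedy Y A (suc n) t"
  proof (cases "big Y A (suc n) t")
    case True
    then have "greedy Y A (suc n) t" unfolding greedy_def using t nt by (auto simp: sub_def)
    then show ?thesis ..
  next
    case False
    let ?t = "un t (upair n n)"
    \<comment> \<open>From index \<open>k\<close> on no point follows \<open>t\<close> on all of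
      \<open>suc n\<close>, so those that follow it below \<open>n\<close> must contain
      \<open>n\<close>.\<close>
    obtain k where k: "k \<epsilon> om" "\<And>y. y \<epsilon> Y \<Longrightarrow> \<not> fst' y \<epsilon> k \<Longrightarrow>
        \<exists>m. m \<epsilon> suc n \<and> \<not> (m \<epsilon> t \<longleftrightarrow> m \<epsilon> app A y)"
      using False unfolding big_def by blast
    have "big Y A (suc n) ?t"
      unfolding big_def
    proof (intro allI impI)
      fix k' assume "k' \<epsilon> om"
      then obtain l where l: "l \<epsilon> om" "k \<sqsubseteq> l" "k' \<sqsubseteq> l" using ex_upper_bound[OF k(1)] by blast
      then obtain y where y: "y \<epsilon> Y" "\<not> fst' y \<epsilon> l" "\<And>m. m \<epsilon> n \<Longrightarrow> m \<epsilon> t \<longleftrightarrow> m \<epsilon> app A y"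
        using t(2) unfolding big_def by blast
      have "\<not> fst' y \<epsilon> k" "\<not> fst' y \<epsilon> k'" using y(2) l unfolding sub_def by blast+
      moreover from this have "n \<epsilon> app A y" using k(2)[OF y(1)] y(3) nt by auto
      ultimately show "\<exists>y. y \<epsilon> Y \<and> \<not> fst' y \<epsilon> k' \<and> (\<forall>m. m \<epsilon> suc n \<longrightarrow> (m \<epsilon> ?t \<longleftrightarrow> m \<epsilon> app A y))"
        using y(1,3) by (intro exI[of _ y]) auto
    qed
    moreover have "\<not> big Y A (suc m) s"
      if m: "m \<epsilon> suc n" "m \<epsilon> ?t" "\<not> m \<epsilon> s" and s: "\<And>j. j \<epsilon> m \<Longrightarrow> j \<epsilon> s \<longleftrightarrow> j \<epsilon> ?t" for m s
    proof (cases "m = n")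
      case True
      then show ?thesis using False big_mono[of Y A "suc n" s "suc n" t] m(3) s nt by auto
    next
      case mn: False
      then have "m \<epsilon> n" "m \<epsilon> t" using m by auto
      moreover have "j \<epsilon> s \<longleftrightarrow> j \<epsilon> t" if "j \<epsilon> m" for j
        using s[OF that] that \<open>m \<epsilon> n\<close> no_two_cycle by auto
      ultimately show ?thesis using t(3) m(3) by blast
    qed
    moreover have "?t \<sqsubseteq> suc n" using t(1) by (auto simp: sub_def)
    ultimately have "greedy Y A (suc n) ?t" unfolding greedy_def by blast
    then show ?thesis ..
  qed
qed

text \<open>All greedy sets are initial segments of one branch. At a first disagreement
  \<open>k\<close>, the set without \<open>k\<close> shows that omitting it is big, so the other set
  should have omitted it.\<close>

lemma greedy_coherent:
  assumes "greedy Y A n t" "greedy Y A n' t'" "n \<epsilon> om" "n' \<epsilon> om" "m \<epsilon> n" "m \<epsilon> n'"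
  shows "m \<epsilon> t \<longleftrightarrow> m \<epsilon> t'"
proof -
  \<comment> \<open>The two sets enter symmetrically, so the one-sided implication yields the
    equivalence.\<close>
  let ?P = "\<lambda>k. \<forall>j. j \<epsilon> k \<longrightarrow> (\<forall>n n' t t'. n \<epsilon> om \<longrightarrow> n' \<epsilon> om \<longrightarrow> greedy Y A n t \<longrightarrow> greedy Y A n' t' \<longrightarrow>
     j \<epsilon> n \<longrightarrow> j \<epsilon> n' \<longrightarrow> j \<epsilon> t \<longrightarrow> j \<epsilon> t')"
  have "?P (suc m)"
  proof (rule om_induct[where P = ?P])
    show "suc m \<epsilon> om" using om_trans[OF assms(3,5)] by simp
    show "D (\<lambda>v. ?P (v 0))" by (intro def_intros)
    show "?P emp" by simp
    fix k assume k: "k \<epsilon> om" and IH: "?P k"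
    have "k \<epsilon> t'" if n: "n \<epsilon> om" "n' \<epsilon> om" and t: "greedy Y A n t" "greedy Y A n' t'"
      and kn: "k \<epsilon> n" "k \<epsilon> n'" "k \<epsilon> t" for n n' t t'
    proof (rule ccontr)
      assume nk: "\<not> k \<epsilon> t'"
      have "j \<epsilon> t' \<longleftrightarrow> j \<epsilon> t" if "j \<epsilon> k" for j
        using IH that n t nat_trans[OF n(1) kn(1) that] nat_trans[OF n(2) kn(2) that] by blast
      then have "\<not> big Y A (suc k) t'" using t(1) kn(1,3) nk unfolding greedy_def by blast
      moreover have "big Y A n' t'" using t(2) unfolding greedy_def by blast
      then have "big Y A (suc k) t'"
        by (rule big_mono) (use kn(2) nat_trans[OF n(2) kn(2)] in auto)
      ultimately show False by blast
    qed
    with IH show "?P (suc k)" unfolding mem_suc by blast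
  qed
  moreover have "m \<epsilon> suc m" by simp
  ultimately show ?thesis using assms by blast
qed

lemma standard_part:
  assumes Y: "stage Y"
  shows "\<exists>Z g B. stage Z \<and> mor g Z Y \<and> B \<sqsubseteq> om \<and>
    (\<forall>n. n \<epsilon> om \<longrightarrow> aa Z (\<lambda>z. n \<epsilon> B \<longleftrightarrow> n \<epsilon> app A (app g z)))"
proof -
  \<comment> \<open>The full branch; by coherence it agrees below \<open>n\<close> with any greedy
    set for \<open>n\<close>.\<close>
  have "\<exists>B. \<forall>m. m \<epsilon> B \<longleftrightarrow> m \<epsilon> om \<and> (\<exists>n t. n \<epsilon> om \<and> greedy Y A n t \<and> m \<epsilon> t)"
    by (rule separation) (intro def_intros)
  then obtain B where B: "\<And>m. m \<epsilon> B \<longleftrightarrow> m \<epsilon> om \<and> (\<exists>n t. n \<epsilon> om \<and> greedy Y A n t \<and> m \<epsilon> t)" by blast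
  have big: "big Y A n B" if n: "n \<epsilon> om" for n
  proof -
    obtain t where t: "greedy Y A n t" using ex_greedy[OF Y n] by blast
    have "m \<epsilon> B \<longleftrightarrow> m \<epsilon> t" if m: "m \<epsilon> n" for m
    proof
      assume "m \<epsilon> B"
      then obtain n' t' where t': "n' \<epsilon> om" "greedy Y A n' t'" "m \<epsilon> t'" using B by blast
      then have "m \<epsilon> n'" unfolding greedy_def sub_def by blast
      then show "m \<epsilon> t" using greedy_coherent[OF t t'(2) n t'(1) m] t'(3) by blast
    next
      assume "m \<epsilon> t"
      then show "m \<epsilon> B" using B t n om_trans[OF n m] by blast
    qed
    moreover have "big Y A n t" using t unfolding greedy_def by blast
    ultimately show ?thesis using big_mono[of Y A n t n B] by blast
  qed
  let ?Q = "\<lambda>n y. y \<epsilon> Y \<and> \<not> fst' y \<epsilon> n \<and> (\<forall>m. m \<epsilon> n \<longrightarrow> (m \<epsilon> B \<longleftrightarrow> m \<epsilon> app A y))"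
  have "D (\<lambda>v. ?Q (v 0) (v 1))" by (intro def_intros)
  then obtain Z where Z: "stage Z" "\<And>z. z \<epsilon> Z \<Longrightarrow> ?Q (fst' z) (snd' z)"
    using ex_stage[of ?Q] big unfolding big_def by blast
  have g: "app (lam Z snd') z = snd' z" if "z \<epsilon> Z" for z
    by (rule app_lam[OF _ that]) (intro def_intros)
  have "aa Z (\<lambda>z. n \<epsilon> B \<longleftrightarrow> n \<epsilon> app A (app (lam Z snd') z))" if n: "n \<epsilon> om" for n
    unfolding aa_def
  \<comment> \<open>A point of the new stage follows \<open>B\<close> strictly below its index, so
    \<open>n\<close> is covered only from index \<open>suc n\<close> on.\<close>
  proof (intro exI[of _ "suc n"] conjI allI impI)
    fix z assume z: "z \<epsilon> Z" "\<not> fst' z \<epsilon> suc n"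
    then have "n \<epsilon> fst' z" using trichotomy[OF n, of "fst' z"] Z(1) unfolding stage_def by auto
    then show "n \<epsilon> B \<longleftrightarrow> n \<epsilon> app A (app (lam Z snd') z)" using Z(2)[OF z(1)] g[OF z(1)] by simp
  qed (use n in simp)
  moreover have "mor (lam Z snd') Z Y"
    by (rule mor_lam) (intro def_intros, use Z Y in auto)
  moreover have "B \<sqsubseteq> om" using B unfolding sub_def by blast
  ultimately show ?thesis using Z(1) by blast
qed

lemma forces_Standard_Part: "forces Standard_Part X e"
  unfolding Standard_Part_def forces.simps(6)
proof (intro allI impI forces_ImpI)
  fix X X' h f e Y' h'
  assume "stage X'"
  fix e' assume Y': "stage Y'"
  show "forces (\<^bold>\<exists>\<^sup>s\<^sup>tSubset_Nat 0 \<^bold>\<and> (\<^bold>\<forall>\<^sup>s\<^sup>tIn_Nat 0 \<^bold>\<longrightarrow> (0 \<^bold>\<in> 1 \<^bold>\<longleftrightarrow> 0 \<^bold>\<in> 2))) Y' (res (case_nat f (res e h X')) h' Y')"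
    (is "forces (\<^bold>\<exists>\<^sup>s\<^sup>t?\<phi>) Y' ?e")
  proof (rule forces_Exists_stI[OF Y'])
    fix Y h assume Y: "stage Y" "mor h Y Y'"
    let ?A = "res ?e h Y 0"
    obtain Z g B where Z: "stage Z" "mor g Z Y" and B: "B \<sqsubseteq> om"
      "\<And>n. n \<epsilon> om \<Longrightarrow> aa Z (\<lambda>z. n \<epsilon> B \<longleftrightarrow> n \<epsilon> app ?A (app g z))"
      using standard_part[OF Y(1), of ?A] by blast
    let ?e' = "case_nat (con B Z) (res (res ?e h Y) g Z)"
    have "forces (Subset_Nat 0) Z ?e'"
      using Z(1) B(1) by (simp add: Los sat_Subset_Nat aa_all)
    moreover have "forces (\<^bold>\<forall>\<^sup>s\<^sup>tIn_Nat 0 \<^bold>\<longrightarrow> (0 \<^bold>\<in> 1 \<^bold>\<longleftrightarrow> 0 \<^bold>\<in> 2)) Z ?e'"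
    proof (rule forces_Forall_stI)
      fix Z' g' c assume Z': "stage Z'" "mor g' Z' Z"
      have "aa Z (\<lambda>z. c \<epsilon> om \<longrightarrow> (c \<epsilon> B \<longleftrightarrow> c \<epsilon> app ?A (app g z)))"
        using B(2)[of c] by (cases "c \<epsilon> om") (simp_all add: aa_all)
      from aa_mor[OF Z'(2) this]
      have "aa Z' (\<lambda>z. (\<lambda>n. app (case_nat (con c Z') (res ?e' g' Z') n) z) \<Turnstile>
          (In_Nat 0 \<^bold>\<longrightarrow> (0 \<^bold>\<in> 1 \<^bold>\<longleftrightarrow> 0 \<^bold>\<in> 2)))"
        by (rule aa_mono) (simp add: sat_In_Nat morD[OF Z'(2)] eval_nat_numeral del: app_res,
            simp add: app_res morD[OF Z'(2)])
      then show "forces (In_Nat 0 \<^bold>\<longrightarrow> (0 \<^bold>\<in> 1 \<^bold>\<longleftrightarrow> 0 \<^bold>\<in> 2)) Z' (case_nat (con c Z') (res ?e' g' Z'))"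
        by (subst Los) (simp_all add: Z'(1))
    qed
    ultimately have "forces ?\<phi> Z ?e'" by (simp add: forces_Conj[OF Z(1)])
    then show "\<exists>Z g c. stage Z \<and> mor g Z Y \<and> forces ?\<phi> Z (case_nat (con c Z) (res (res ?e h Y) g Z))"
      using Z by blast
  qed
qed

subsection \<open>Standardization\<close>

text \<open>Stages, morphisms and names are all elements of the model, so each clause is first-order
  over it. The induction on the formula takes place outside the model, giving one definition per
  formula.\<close>

lemma D_forces:
  "dfun G \<Longrightarrow> (\<And>n. dfun (F n)) \<Longrightarrow> D (\<lambda>v. forces \<phi> (G v) (\<lambda>n. F n v))"
proof (induction \<phi> arbitrary: F G)
  case Fls
  show ?case by (simp add: D_const)
next
  case (Eql i j)
  show ?case unfolding forces.simps aa_def by (intro def_intros dfun_reindex[OF Eql.prems(1)] dfun_reindex[OF Eql.prems(2)])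
next
  case (Mem i j)
  show ?case unfolding forces.simps aa_def by (intro def_intros dfun_reindex[OF Mem.prems(1)] dfun_reindex[OF Mem.prems(2)])
next
  case (Std i)
  show ?case unfolding forces.simps aa_def by (intro def_intros dfun_reindex[OF Std.prems(1)] dfun_reindex[OF Std.prems(2)])
next
  case (Imp \<phi> \<psi>)
  show ?case unfolding forces.simps res_def
    by (intro def_intros Imp.IH dfun_reindex[OF Imp.prems(1)] dfun_reindex[OF Imp.prems(2)])
next
  case (Forall \<phi>)
  have "dfun (\<lambda>v. case_nat (v 0) (\<lambda>n. comp_on (F n (\<lambda>n. v (Suc (Suc (Suc n))))) (v (Suc 0)) (v (Suc (Suc 0)))) n)" for n
    by (cases n) (simp_all, (intro def_intros dfun_reindex[OF Forall.prems(1)] dfun_reindex[OF Forall.prems(2)])+)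
  then have "D (\<lambda>v. forces \<phi> (v (Suc (Suc 0))) (\<lambda>n. case_nat (v 0)
      (\<lambda>n. comp_on (F n (\<lambda>n. v (Suc (Suc (Suc n))))) (v (Suc 0)) (v (Suc (Suc 0)))) n))"
    by (intro Forall.IH def_intros)
  then show ?case unfolding forces.simps res_def
    by (intro def_intros dfun_reindex[OF Forall.prems(1)] dfun_reindex[OF Forall.prems(2)]) simp
qed

text \<open>Any stage over \<open>X'\<close> has a common refinement with \<open>X\<close>, on which
  both environments are almost everywhere the same constants. What \<open>X\<close> forces is thus
  forced densely over \<open>X'\<close>.\<close>

lemma forces_homogeneous:
  assumes X: "stage X" "stage X'" and f: "forces \<phi> X e"
    and e: "\<And>i. i < fv_bound \<phi> \<Longrightarrow> aa X (\<lambda>x. app (e i) x = c i)"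
    and e': "\<And>i. i < fv_bound \<phi> \<Longrightarrow> aa X' (\<lambda>x. app (e' i) x = c i)"
  shows "forces \<phi> X' e'"
proof (rule forces_dense[OF X(2)])
  fix Y h assume Y: "stage Y" "mor h Y X'"
  obtain Z g g' where Z: "stage Z" "mor g Z Y" "mor g' Z X"
    using common_refinement[OF Y(1) X(1)] by blast
  have "forces \<phi> Z (res e g' Z) \<longleftrightarrow> forces \<phi> Z (res (res e' h Y) g Z)"
  proof (rule forces_cong)
    fix i assume i: "i < fv_bound \<phi>"
    have "aa Z (\<lambda>z. app (e i) (app g' z) = c i \<and> app (e' i) (app h (app g z)) = c i)"
      using aa_mor[OF Z(3) e[OF i]] aa_mor[OF Z(2) aa_mor[OF Y(2) e'[OF i]]] by (rule aa_conj)
    then show "aa Z (\<lambda>z. app (res e g' Z i) z = app (res (res e' h Y) g Z i) z)"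
      by (rule aa_mono) (simp add: morD[OF Z(2)])
  qed
  then show "\<exists>Z g. stage Z \<and> mor g Z Y \<and> forces \<phi> Z (res (res e' h Y) g Z)"
    using forces_mono[OF f Z(3)] Z by blast
qed

lemma forces_Standardization:
  assumes \<phi>: "fv_bound \<phi> \<le> 1"
  shows "forces (Standardization \<phi>) X e"
  unfolding Standardization_def
proof (rule forces_Forall_stI, rule forces_Exists_stI, assumption)
  fix X' h a Y h' assume X': "stage X'" and Y: "stage Y" "mor h' Y X'"
  let ?e = "res (case_nat (con a X') (res e h X')) h' Y"
  \<comment> \<open>The set is computed at \<open>Y\<close>, but by homogeneity every other stage
    would give the same one. Only variable 0 can be free in \<open>\<phi>\<close>, so all variables
    may receive the constant name.\<close>
  have "\<exists>S. \<forall>x. x \<epsilon> S \<longleftrightarrow> x \<epsilon> a \<and> forces \<phi> Y (\<lambda>_. lam Y (\<lambda>_. x))"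
  proof (rule separation)
    have "y = lam Y (\<lambda>_. x) \<longleftrightarrow> (\<forall>p. p \<epsilon> y \<longleftrightarrow> (\<exists>z. z \<epsilon> Y \<and> p = opair z x))" for x y
      unfolding lam_def by (rule eq_setof[OF ex_lam]) (intro def_intros)
    then have "D (\<lambda>v. v 0 = lam Y (\<lambda>_. v 1))" by (simp only:) (intro def_intros)
    from dfun_comp1[where f = "\<lambda>x. lam Y (\<lambda>_. x)", OF this dfun_var]
    show "D (\<lambda>v. forces \<phi> Y (\<lambda>_. lam Y (\<lambda>_. v 0)))" by (intro D_forces def_intros)
  qed
  then obtain S where S: "\<And>x. x \<epsilon> S \<longleftrightarrow> x \<epsilon> a \<and> forces \<phi> Y (\<lambda>_. con x Y)"
    unfolding con_def by blast
  let ?e1 = "case_nat (con S Y) (res ?e (idf Y) Y)"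
  have "forces (\<^bold>\<forall>\<^sup>s\<^sup>t0 \<^bold>\<in> 1 \<^bold>\<longleftrightarrow> 0 \<^bold>\<in> 2 \<^bold>\<and> \<phi>) Y ?e1"
  proof (rule forces_Forall_stI, rule forces_EquivI, assumption)
    fix Z g x W k assume Z: "stage Z" "mor g Z Y" and W: "stage W" "mor k W Z"
    let ?e2 = "res (case_nat (con x Z) (res ?e1 g Z)) k W"
    have in_Z: "app k w \<epsilon> Z" if "w \<epsilon> W" for w using morD[OF W(2) that] .
    have in_Y: "app g (app k w) \<epsilon> Y" if "w \<epsilon> W" for w using morD[OF Z(2) in_Z[OF that]] .
    have app: "app (?e2 0) w = x" "app (?e2 1) w = S" "app (?e2 2) w = a" if w: "w \<epsilon> W" for w
      using w in_Z[OF w] in_Y[OF w] morD[OF Y(2) in_Y[OF w]] by (simp_all add: eval_nat_numeral)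
    have "forces (0 \<^bold>\<in> 1) W ?e2 \<longleftrightarrow> x \<epsilon> S"
    proof -
      have "forces (0 \<^bold>\<in> 1) W ?e2 \<longleftrightarrow> aa W (\<lambda>w. x \<epsilon> S)"
        unfolding forces.simps by (rule aa_cong, rule aa_all) (simp only: app)
      then show ?thesis using W(1) by simp
    qed
    moreover have "forces (0 \<^bold>\<in> 2) W ?e2 \<longleftrightarrow> x \<epsilon> a"
    proof -
      have "forces (0 \<^bold>\<in> 2) W ?e2 \<longleftrightarrow> aa W (\<lambda>w. x \<epsilon> a)"
        unfolding forces.simps by (rule aa_cong, rule aa_all) (simp only: app)
      then show ?thesis using W(1) by simp
    qed
    moreover have "forces \<phi> W ?e2 \<longleftrightarrow> forces \<phi> Y (\<lambda>_. con x Y)"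
    proof -
      have e: "aa W (\<lambda>w. app (?e2 i) w = x)" if "i < fv_bound \<phi>" for i
      proof -
        have "i = 0" using that \<phi> by simp
        then show ?thesis by (intro aa_all) (simp only: app)
      qed
      have e': "aa Y (\<lambda>y. app (con x Y) y = x)" by (rule aa_all) simp
      show ?thesis
      proof
        assume "forces \<phi> W ?e2"
        from forces_homogeneous[where c = "\<lambda>_. x", OF W(1) Y(1) this e e']
        show "forces \<phi> Y (\<lambda>_. con x Y)" .
      next
        assume "forces \<phi> Y (\<lambda>_. con x Y)"
        from forces_homogeneous[where c = "\<lambda>_. x", OF Y(1) W(1) this e' e]
        show "forces \<phi> W ?e2" .
      qed
    qed
    ultimately show "forces (0 \<^bold>\<in> 1) W ?e2 \<longleftrightarrow> forces (0 \<^bold>\<in> 2 \<^bold>\<and> \<phi>) W ?e2"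
      unfolding forces_Conj[OF W(1)] using S by blast
  qed
  then show "\<exists>Z g c. stage Z \<and> mor g Z Y \<and>
      forces (\<^bold>\<forall>\<^sup>s\<^sup>t0 \<^bold>\<in> 1 \<^bold>\<longleftrightarrow> 0 \<^bold>\<in> 2 \<^bold>\<and> \<phi>) Z (case_nat (con c Z) (res ?e g Z))"
    using Y(1) mor_idf by blast
qed

lemma ex_a_stage: "\<exists>X. stage X"
  using ex_stage[of "\<lambda>_ _. True", OF D_const] by blast

text \<open>A forced \<open>\<theta>\<close> holds at almost all points by Los; the environment is
  read off at one of them, since a stage has points of unbounded index.\<close>

theorem SPOT_SN_theorem_holds:
  assumes "st_free \<theta>" "derives L (SPOT \<union> SN) \<theta>"
  shows "\<exists>v. v \<Turnstile> \<theta>"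
proof -
  obtain X where X: "stage X" using ex_a_stage by blast
  \<comment> \<open>Each axiom is forced in every environment, so an arbitrary one is taken.\<close>
  have "forces \<gamma> X undefined" if \<gamma>: "\<gamma> \<in> SPOT \<union> SN" for \<gamma>
  proof -
    consider "\<gamma> \<in> ZF" | \<phi> where "\<gamma> = Transfer \<phi>" "st_free \<phi>" | "\<gamma> = Nontriviality" | "\<gamma> = Standard_Part"
      | \<phi> where "\<gamma> = Standardization \<phi>" "fv_bound \<phi> \<le> 1"
      using \<gamma> unfolding SPOT_def SN_def in_language_def by blast
    then show ?thesis
      by cases (use X in \<open>auto intro: forces_true ZF_st_free zf forces_Transfer forces_Nontriviality
          forces_Standard_Part forces_Standardization\<close>)
  qed
  with forces_sound[OF assms(2) X] have "forces \<theta> X undefined" by blast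
  then show ?thesis using Los[OF assms(1) X] aa_ex[OF X] by blast
qed

end

theorem theoremB:
  fixes \<theta> :: fm
  assumes "\<theta> \<in> in_language"
    and "sentence \<theta>"
    and "derives st_in_language (SPOT \<union> SN) \<theta>"
  shows "derives in_language ZF \<theta>"
proof (rule ccontr)
  assume "\<not> derives in_language ZF \<theta>"
  then obtain E :: "nat \<Rightarrow> nat \<Rightarrow> bool"
    where E: "\<And>\<phi> v. \<phi> \<in> ZF \<Longrightarrow> sat (=) E v \<phi>" "\<And>v. \<not> sat (=) E v \<theta>"
    using zf_completeness[OF assms(1,2)] by metis
  interpret zf_model E using E(1) by unfold_locales
  show False using SPOT_SN_theorem_holds[OF _ assms(3)] assms(1) E(2) by (auto simp: in_language_def)
qed

end
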